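(* Let $(X,\mu)$ be a connected $d$-partite complex with sites $V$, and let $W$ be an absorbing random walk matrix on $V\cup B$. Let $M_\varnothing\in\mathbb{R}^{V\times V}$ be the symmetric matrix with zero diagonal and $M_\varnothing(u,v)=\sqrt{\mathbb{W}_{\{v\}}[u\to v]\cdot\mathbb{W}_{\{u\}}[v\to u]}$ for distinct $u,v\in V$. Suppose that for every $\sigma\in X(d-2)$ we have $\lambda_2(P_\sigma)\leq\sqrt{W(u,v)\cdot W(v,u)}$, where $u,v$ are the two distinct sites of $V\setminus V(\sigma)$. Then $$\lambda_2(P_\varnothing)\leq\frac{\lambda_{\max}(M_\varnothing)}{d-1},$$ and more generally, for every $\tau\in X$ with $\operatorname{codim}(\tau)\geq 2$, $$\lambda_2(P_\tau)\leq\frac{\lambda_{\max}(M_\tau)}{\operatorname{codim}(\tau)-1},$$ where $M_\tau\in\mathbb{R}^{(V\setminus V(\tau))\times(V\setminus V(\tau))}$ is the symmetric matrix with zero diagonal and $M_\tau(u,v)=\sqrt{\mathbb{W}_{V(\tau)\cup\{v\}}[u\to v]\cdot\mathbb{W}_{V(\tau)\cup\{u\}}[v\to u]}$ for distinct $u,v\in V\setminus V(\tau)$.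
   Context: A $d$-partite complex $(X,\mu)$: a set $V$ of $d$ sites; each site $v$ has a finite nonempty set $S_v$ of spins (pairwise disjoint; elements written $vs_v$); $X$ is a pure simplicial complex on $\bigcup_v S_v$ whose facets contain exactly one spin from each $S_v$; $\mu$ is a probability distribution on facets, each facet having positive probability. For a face $\tau$: $V(\tau)$ is the set of sites having a spin in $\tau$; $\operatorname{codim}(\tau)=d-|\tau|$; $X(k)$ is the set of faces of size $k$; the link is $X_\tau=\{\sigma\setminus\tau:\sigma\in X,\sigma\supseteq\tau\}$ with $X_\tau(k)$ its faces of size $k$. For $\operatorname{codim}(\tau)\ge2$, $G_\tau$ is the weighted graph on $X_\tau(1)$ with edges $X_\tau(2)$ and weights $w_\tau(x,y)=\sum_{\text{facets }\omega\supseteq\tau\cup\{x,y\}}\mu(\omega)$; $P_\tau$ is the simple random walk transition matrix on $G_\tau$, and $\lambda_2(P_\tau)$ its second largest eigenvalue. $X$ is connected if every such $G_\tau$ is connected. Absorbing random walk: $B$ is a finite set disjoint from $V$ ("boundary vertices"), and $W\in\mathbb{R}^{(V\cup B)\times(V\cup B)}$ is a stochastic matrix (non-negative entries, row sums $1$) such that from every $v\in V$ there is a sequence $v=x_0,x_1,\dots,x_k$ with $x_k\in B$ and $W(x_{i-1},x_i)>0$ for all $i$. For $U\subseteq V$ and $u,v\in V\cup B$, $\mathbb{W}_U[u\to v]=\sum\prod_{i=1}^{\ell}W(x_{i-1},x_i)$, the sum over all walks $(x_0,\dots,x_\ell)$, $\ell\ge0$, with $x_0=u$, $x_\ell=v$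 and $x_1,\dots,x_{\ell-1}\notin B\cup U$. For $u\ne v$ with $v\in U$ this is the probability that the random walk started at $u$ visits $v$ before visiting any other vertex of $B\cup U$. *)

theory Defs
  imports
    "HOL-Analysis.Infinite_Sum"
    "HOL-Library.Countable_Set"
    "HOL-Library.Disjoint_Sets"
    "Jordan_Normal_Form.Spectral_Radius"
begin

section \<open>Matrices indexed by a finite set and their eigenvalues\<close>

text \<open>A matrix with rows and columns indexed by a finite set \<open>A\<close> is a function on \<open>A \<times> A\<close>;
  it is turned into a library matrix along the enumeration \<^const>\<open>from_nat_into\<close> of \<open>A\<close>.
  Another enumeration gives a matrix conjugate under a permutation, with the same
  characteristic polynomial.\<close>

definition mat_on :: "'i set \<Rightarrow> ('i \<Rightarrow> 'i \<Rightarrow> real) \<Rightarrow> real mat" where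
  "mat_on A M =
     mat (card A) (card A) (\<lambda>(i, j). M (from_nat_into A i) (from_nat_into A j))"

text \<open>Real eigenvalues in decreasing order, repeated according to their multiplicity as roots
  of the characteristic polynomial. The matrices below are symmetric or, being transition
  matrices of walks on undirected weighted graphs, similar to symmetric ones, so that no
  eigenvalue is lost over the reals.\<close>

definition eigenvalues_desc :: "real mat \<Rightarrow> real list" where
  "eigenvalues_desc A = rev (sorted_list_of_multiset (proots (char_poly A)))"

definition lambda2 :: "real mat \<Rightarrow> real" where
  "lambda2 A = eigenvalues_desc A ! 1"

definition lambda_max :: "real mat \<Rightarrow> real" where
  "lambda_max A = Max (spectrum A)"


section \<open>Partite complexes\<close>

definition facets :: "'s set set \<Rightarrow> 's set set" where
  "facets X = {\<omega> \<in> X. \<forall>\<omega>' \<in> X. \<omega> \<subseteq> \<omega>' \<longrightarrow> \<omega>' = \<omega>}"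

definition faces_of_size :: "'s set set \<Rightarrow> nat \<Rightarrow> 's set set" where
  "faces_of_size X k = {\<sigma> \<in> X. card \<sigma> = k}"

definition link :: "'s set set \<Rightarrow> 's set \<Rightarrow> 's set set" where
  "link X \<tau> = {\<sigma> - \<tau> | \<sigma>. \<sigma> \<in> X \<and> \<tau> \<subseteq> \<sigma>}"

text \<open>Purity is a consequence of \<open>facet_spin\<close>: every facet has exactly \<open>card V\<close> elements.\<close>

locale partite_complex =
  fixes V :: "'v set"
    and S :: "'v \<Rightarrow> 's set"
    and X :: "'s set set"
    and \<mu> :: "'s set \<Rightarrow> real"
  assumes finite_sites: "finite V"
    and finite_spins: "\<And>v. v \<in> V \<Longrightarrow> finite (S v)"
    and spins_nonempty: "\<And>v. v \<in> V \<Longrightarrow> S v \<noteq> {}"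
    and disjoint_spins: "disjoint_family_on S V"
    and faces_subset: "\<And>\<sigma>. \<sigma> \<in> X \<Longrightarrow> \<sigma> \<subseteq> (\<Union>v\<in>V. S v)"
    and faces_down_closed: "\<And>\<sigma> \<rho>. \<sigma> \<in> X \<Longrightarrow> \<rho> \<subseteq> \<sigma> \<Longrightarrow> \<rho> \<in> X"
    and facet_spin: "\<And>\<omega> v. \<omega> \<in> facets X \<Longrightarrow> v \<in> V \<Longrightarrow> \<exists>!x. x \<in> \<omega> \<inter> S v"
    and facet_pos: "\<And>\<omega>. \<omega> \<in> facets X \<Longrightarrow> \<mu> \<omega> > 0"
    and facet_sum: "(\<Sum>\<omega>\<in>facets X. \<mu> \<omega>) = 1"

definition sites_of :: "'v set \<Rightarrow> ('v \<Rightarrow> 's set) \<Rightarrow> 's set \<Rightarrow> 'v set" where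
  "sites_of V S \<tau> = {v \<in> V. S v \<inter> \<tau> \<noteq> {}}"

definition codim :: "'v set \<Rightarrow> 's set \<Rightarrow> nat" where
  "codim V \<tau> = card V - card \<tau>"

text \<open>The graph on the link of \<open>\<tau>\<close>; the vertex \<open>{x}\<close> is identified with \<open>x\<close>. The weight is
  set to 0 off the edges: without this guard the sum would not vanish for \<open>x = y\<close>.\<close>

definition link_vertices :: "'s set set \<Rightarrow> 's set \<Rightarrow> 's set" where
  "link_vertices X \<tau> = {x. {x} \<in> faces_of_size (link X \<tau>) 1}"

definition link_edges :: "'s set set \<Rightarrow> 's set \<Rightarrow> ('s \<times> 's) set" where
  "link_edges X \<tau> = {(x, y). {x, y} \<in> faces_of_size (link X \<tau>) 2}"

definition link_weight ::
  "'s set set \<Rightarrow> ('s set \<Rightarrow> real) \<Rightarrow> 's set \<Rightarrow> 's \<Rightarrow> 's \<Rightarrow> real" where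
  "link_weight X \<mu> \<tau> x y =
     (if (x, y) \<in> link_edges X \<tau>
      then \<Sum>\<omega> | \<omega> \<in> facets X \<and> \<tau> \<union> {x, y} \<subseteq> \<omega>. \<mu> \<omega> else 0)"

definition link_walk ::
  "'s set set \<Rightarrow> ('s set \<Rightarrow> real) \<Rightarrow> 's set \<Rightarrow> real mat" where
  "link_walk X \<mu> \<tau> = mat_on (link_vertices X \<tau>)
     (\<lambda>x y. link_weight X \<mu> \<tau> x y / (\<Sum>z\<in>link_vertices X \<tau>. link_weight X \<mu> \<tau> x z))"

definition link_connected :: "'s set set \<Rightarrow> 's set \<Rightarrow> bool" where
  "link_connected X \<tau> \<longleftrightarrow>
     (\<forall>x \<in> link_vertices X \<tau>. \<forall>y \<in> link_vertices X \<tau>. (x, y) \<in> (link_edges X \<tau>)\<^sup>*)"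

locale connected_partite_complex = partite_complex +
  assumes connected: "\<And>\<tau>. \<tau> \<in> X \<Longrightarrow> 2 \<le> codim V \<tau> \<Longrightarrow> link_connected X \<tau>"


section \<open>Absorbing random walks\<close>

locale absorbing_walk =
  fixes V B :: "'v set"
    and W :: "'v \<Rightarrow> 'v \<Rightarrow> real"
  assumes finite_interior: "finite V"
    and finite_boundary: "finite B"
    and disjoint_boundary: "V \<inter> B = {}"
    and W_nonneg: "\<And>x y. x \<in> V \<union> B \<Longrightarrow> y \<in> V \<union> B \<Longrightarrow> 0 \<le> W x y"
    and W_row_sum: "\<And>x. x \<in> V \<union> B \<Longrightarrow> (\<Sum>y\<in>V \<union> B. W x y) = 1"
    and absorbing: "\<And>v. v \<in> V \<Longrightarrow>
      \<exists>b\<in>B. (v, b) \<in> {(x, y). x \<in> V \<union> B \<and> y \<in> V \<union> B \<and> W x y > 0}\<^sup>*"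

text \<open>A walk \<open>(x\<^sub>0, \<dots>, x\<^sub>l)\<close> is the list of its \<open>l + 1\<close> vertices.\<close>

definition walks :: "'v set \<Rightarrow> 'v set \<Rightarrow> 'v set \<Rightarrow> 'v \<Rightarrow> 'v \<Rightarrow> 'v list set" where
  "walks V B U u v =
     {xs. xs \<noteq> [] \<and> set xs \<subseteq> V \<union> B \<and> hd xs = u \<and> last xs = v \<and>
        (\<forall>i \<in> {1..<length xs - 1}. xs ! i \<notin> B \<union> U)}"

definition walk_weight :: "('v \<Rightarrow> 'v \<Rightarrow> real) \<Rightarrow> 'v list \<Rightarrow> real" where
  "walk_weight W xs = (\<Prod>i\<in>{1..length xs - 1}. W (xs ! (i - 1)) (xs ! i))"

definition hit_weight ::
  "'v set \<Rightarrow> 'v set \<Rightarrow> ('v \<Rightarrow> 'v \<Rightarrow> real) \<Rightarrow> 'v set \<Rightarrow> 'v \<Rightarrow> 'v \<Rightarrow> real" where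
  "hit_weight V B W U u v = (\<Sum>\<^sub>\<infinity>xs\<in>walks V B U u v. walk_weight W xs)"

text \<open>\<open>hit_matrix V B W U\<close> is \<open>M\<^sub>\<tau>\<close> for the pinned sites \<open>U = V(\<tau>)\<close>.\<close>

definition hit_matrix ::
  "'v set \<Rightarrow> 'v set \<Rightarrow> ('v \<Rightarrow> 'v \<Rightarrow> real) \<Rightarrow> 'v set \<Rightarrow> real mat" where
  "hit_matrix V B W U = mat_on (V - U)
     (\<lambda>u v. if u = v then 0
        else sqrt (hit_weight V B W (U \<union> {v}) u v * hit_weight V B W (U \<union> {u}) v u))"

end

theory Submission
  imports Defs "HOL-Analysis.Function_Topology"
begin

text \<open>The spins outside \<open>\<tau>\<close> of a random facet \<open>\<omega> \<supseteq> \<tau>\<close> are random variables \<open>X\<^sub>v\<close>. It is enough to show that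
  for two sites \<open>u \<noteq> v\<close> their maximal correlation is at most \<open>M\<^sub>\<tau>(u,v)\<close>: splitting a function on the
  vertices of the link into its site means and its centred parts \<open>f\<^sub>v\<close>, the site means contribute a
  nonpositive amount to the quadratic form of the walk, and the centred parts contribute at most
  \<open>\<Sum> M\<^sub>\<tau>(u,v) \<parallel>f\<^sub>u\<parallel> \<parallel>f\<^sub>v\<parallel> \<le> \<lambda>\<^sub>m\<^sub>a\<^sub>x(M\<^sub>\<tau>) \<Sum> \<parallel>f\<^sub>v\<parallel>\<^sup>2\<close>.

  The correlation bound goes by induction on the codimension and involves only three sites at a time:
  if \<open>\<kappa>\<^sub>s\<close> bounds the correlation of the other two sites given \<open>X\<^sub>s\<close>, a Bochner-type argument in the
  style of Shenfeld and van Handel bounds the unconditional correlation of sites 0 and 1 by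
  \<open>(\<kappa>\<^sub>2 + \<kappa>\<^sub>0 \<kappa>\<^sub>1) / sqrt ((1 - \<kappa>\<^sub>0\<^sup>2) (1 - \<kappa>\<^sub>1\<^sup>2))\<close>, the correlation in a Gaussian vector whose partial
  correlations are the \<open>\<kappa>\<^sub>s\<close>. The strong Markov property and the inequality of arithmetic and
  geometric means show that the hitting probabilities dominate this expression.\<close>

section \<open>Eigenbases of symmetric pencils\<close>

text \<open>The inequality \<open>d \<le> d\<^sup>2\<close> leaves open that several eigenvalues
  reach 1, and only connectivity excludes this. With more than three free sites, however, a path in
  the link may pass through spins of sites outside the chosen triple. Such a spin can be pinned too,
  and the bounds of the smaller link, if they are below 1, force a common function of two sites to
  be constant there. So the induction needs strict bounds, both for this and for the positive
  determinant behind the three-site argument. Strictness comes from absorption: it yields a positive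
  function \<open>\<psi>\<close> on the vertices whose average over one step of \<open>W\<close> is
  strictly smaller at every site. Weighting hitting probabilities by \<open>\<psi>\<close> makes
  them strictly substochastic, and the weights cancel in every cyclic product, hence in the
  geometric means that form \<open>M\<^sub>\<tau>\<close>. Pinning keeps the walk and only enlarges
  \<open>U\<close>, so hitting probabilities of smaller and larger links are related by a recursion
  of the same shape as the Gaussian formula; the discrepancy lies only in the two
  three-cycles.\<close>

definition bil :: "'a set \<Rightarrow> ('a \<Rightarrow> 'a \<Rightarrow> real) \<Rightarrow> ('a \<Rightarrow> real) \<Rightarrow> ('a \<Rightarrow> real) \<Rightarrow> real" where
  "bil A B f g = (\<Sum>x\<in>A. \<Sum>y\<in>A. B x y * f x * g y)"

definition ip :: "'a set \<Rightarrow> ('a \<Rightarrow> real) \<Rightarrow> ('a \<Rightarrow> real) \<Rightarrow> ('a \<Rightarrow> real) \<Rightarrow> real" where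
  "ip A D f g = (\<Sum>x\<in>A. D x * f x * g x)"

lemma ip_commute: "ip A D f g = ip A D g f"
  by (simp add: ip_def mult.commute mult.left_commute)

lemma ip_add_left: "ip A D (\<lambda>x. f x + g x) h = ip A D f h + ip A D g h"
  by (simp add: ip_def algebra_simps sum.distrib)

lemma ip_scale_left: "ip A D (\<lambda>x. c * f x) h = c * ip A D f h"
  by (simp add: ip_def algebra_simps sum_distrib_left)

lemma ip_add_right: "ip A D h (\<lambda>x. f x + g x) = ip A D h f + ip A D h g"
  by (simp add: ip_def algebra_simps sum.distrib)

lemma ip_scale_right: "ip A D h (\<lambda>x. c * f x) = c * ip A D h f"
  by (simp add: ip_def algebra_simps sum_distrib_left)

lemma ip_diff_left: "ip A D (\<lambda>x. f x - g x) h = ip A D f h - ip A D g h"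
  by (simp add: ip_def algebra_simps sum_subtractf)

lemma ip_sum_left: "ip A D (\<lambda>x. \<Sum>i\<in>I. f i x) h = (\<Sum>i\<in>I. ip A D (f i) h)"
  unfolding ip_def by (subst sum.swap) (simp add: sum_distrib_left sum_distrib_right)

lemma ip_nonneg: "(\<And>x. x \<in> A \<Longrightarrow> D x \<ge> 0) \<Longrightarrow> ip A D f f \<ge> 0"
  by (auto simp: ip_def mult.assoc intro!: sum_nonneg)

lemma ip_eq_0_iff:
  assumes "finite A" "\<And>x. x \<in> A \<Longrightarrow> D x > 0"
  shows "ip A D f f = 0 \<longleftrightarrow> (\<forall>x\<in>A. f x = 0)"
proof -
  have "ip A D f f = 0 \<longleftrightarrow> (\<forall>x\<in>A. D x * f x * f x = 0)"
    unfolding ip_def using assms less_imp_le[OF assms(2)]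
    by (intro sum_nonneg_eq_0_iff) (auto simp: mult.assoc)
  also have "\<dots> \<longleftrightarrow> (\<forall>x\<in>A. f x = 0)" using assms(2) by force
  finally show ?thesis .
qed

lemma bil_eq_ip:
  assumes "\<And>x. x \<in> A \<Longrightarrow> (\<Sum>y\<in>A. B x y * g y) = lam * (D x * g x)"
  shows "bil A B f g = lam * ip A D f g"
proof -
  have "bil A B f g = (\<Sum>x\<in>A. f x * (\<Sum>y\<in>A. B x y * g y))"
    by (simp add: bil_def sum_distrib_left algebra_simps)
  also have "\<dots> = (\<Sum>x\<in>A. f x * (lam * (D x * g x)))" using assms by simp
  also have "\<dots> = lam * ip A D f g" by (simp add: ip_def sum_distrib_left algebra_simps)
  finally show ?thesis .
qed

lemma bil_commute:
  assumes "\<And>x y. x \<in> A \<Longrightarrow> y \<in> A \<Longrightarrow> B x y = B y x"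
  shows "bil A B f g = bil A B g f"
  unfolding bil_def by (subst sum.swap) (auto intro!: sum.cong simp: assms)

lemma bil_add_left: "bil A B (\<lambda>x. f x + g x) h = bil A B f h + bil A B g h"
  by (simp add: bil_def algebra_simps sum.distrib)

lemma bil_scale_left: "bil A B (\<lambda>x. c * f x) h = c * bil A B f h"
  by (simp add: bil_def algebra_simps sum_distrib_left)

lemma bil_add_right: "bil A B h (\<lambda>x. f x + g x) = bil A B h f + bil A B h g"
  by (simp add: bil_def algebra_simps sum.distrib)

lemma bil_scale_right: "bil A B h (\<lambda>x. c * f x) = c * bil A B h f"
  by (simp add: bil_def algebra_simps sum_distrib_left)

lemma bil_sum_left: "finite I \<Longrightarrow> bil A B (\<lambda>x. \<Sum>i\<in>I. f i x) h = (\<Sum>i\<in>I. bil A B (f i) h)"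
  by (induction I rule: finite_induct) (simp_all add: bil_add_left, simp add: bil_def)

lemma ip_delta:
  assumes "finite A" "x \<in> A"
  shows "ip A D f (\<lambda>z. if z = x then 1 else 0) = D x * f x"
  using assms by (simp add: ip_def if_distrib[of "\<lambda>t. _ * t"] cong: if_cong)

lemma bil_delta:
  assumes "finite A" "x \<in> A" "\<And>x y. x \<in> A \<Longrightarrow> y \<in> A \<Longrightarrow> B x y = B y x"
  shows "bil A B f (\<lambda>z. if z = x then 1 else 0) = (\<Sum>y\<in>A. B x y * f y)"
  using assms by (simp add: bil_def if_distrib[of "\<lambda>t. _ * t"] cong: if_cong)

text \<open>Once functions are cut off to 0 outside \<open>A\<close>, the unit vectors satisfying
  the constraints form a compact set, on which the continuous form attains its maximum. The function
  \<open>g0\<close> shows that this set is nonempty.\<close>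

lemma rayleigh_maximizer:
  fixes q :: "nat \<Rightarrow> 'a \<Rightarrow> real"
  assumes A: "finite A" and D: "\<And>x. x \<in> A \<Longrightarrow> D x > 0"
    and g0: "\<And>i. i < k \<Longrightarrow> ip A D g0 (q i) = 0" "ip A D g0 g0 \<noteq> 0"
  shows "\<exists>f. ip A D f f = 1 \<and> (\<forall>i<k. ip A D f (q i) = 0) \<and>
    (\<forall>g. (\<forall>i<k. ip A D g (q i) = 0) \<longrightarrow> bil A B g g \<le> bil A B f f * ip A D g g)"
proof -
  \<comment> \<open>A unit vector satisfies \<open>D x * f x * f x \<le> 1\<close>, which bounds its
    value at \<open>x\<close> by \<open>1 / sqrt (D x)\<close>. With the bound 0 outside
    \<open>A\<close>, the box is a product of compact intervals over the whole type, compact by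
    Tychonoff's theorem.\<close>
  define C where "C x = (if x \<in> A then 1 / sqrt (D x) else 0)" for x
  define K where "K = (\<Pi>\<^sub>E x\<in>UNIV. {- C x .. C x})"
  have "compactin (product_topology (\<lambda>i::'a. euclidean :: real topology) UNIV) K"
    unfolding K_def by (subst compactin_PiE) auto
  hence K: "compact K" by (simp add: euclidean_product_topology)
  have cont: "continuous_on S (\<lambda>f. f x)" for S :: "('a \<Rightarrow> real) set" and x
    by (rule continuous_on_subset[OF continuous_on_product_coordinates]) simp
  have cip: "continuous_on S (\<lambda>f. ip A D f f)" "continuous_on S (\<lambda>f. ip A D f (q i))"
    "continuous_on S (\<lambda>f. bil A B f f)" for S i
    unfolding ip_def bil_def by (intro continuous_intros cont)+
  define U where "U = K \<inter> {f. ip A D f f = 1} \<inter> (\<Inter>i<k. {f. ip A D f (q i) = 0})"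
  have "closed {f. ip A D f f = 1}" by (intro closed_Collect_eq cip continuous_intros)
  moreover have "closed (\<Inter>i<k. {f. ip A D f (q i) = 0})"
    by (intro closed_INT ballI closed_Collect_eq cip continuous_intros)
  ultimately have U: "compact U" unfolding U_def
    by (intro compact_Int_closed K)
  have normalize: "\<exists>f\<in>U. \<forall>x\<in>A. f x = inverse (sqrt (ip A D g g)) * g x"
    if g: "\<And>i. i < k \<Longrightarrow> ip A D g (q i) = 0" "ip A D g g \<noteq> 0" for g
  proof -
    have pos: "ip A D g g > 0" using g(2) ip_nonneg[of A D g] D by force
    define s where "s = inverse (sqrt (ip A D g g))"
    define f where "f x = (if x \<in> A then s * g x else 0)" for x
    have ipf: "ip A D f h = s * ip A D g h" for h
      unfolding ip_scale_left[symmetric] by (simp add: ip_def f_def)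
    have "ip A D f f = s * s * ip A D g g"
      using ipf[of f] ipf[of g] by (simp add: ip_commute[of A D g f])
    also have "\<dots> = 1" using pos by (simp add: s_def field_simps)
    finally have one: "ip A D f f = 1" .
    have "f x \<in> {- C x .. C x}" for x
    proof (cases "x \<in> A")
      case True
      have "D x * f x * f x \<le> ip A D f f" unfolding ip_def
        using D A True by (intro member_le_sum) (auto simp: mult.assoc less_imp_le)
      hence "(f x)\<^sup>2 \<le> (1 / sqrt (D x))\<^sup>2" using D[OF True] one
        by (simp add: field_simps power2_eq_square)
      hence "\<bar>f x\<bar> \<le> 1 / sqrt (D x)" using D[OF True] by (intro abs_le_square_iff[THEN iffD2, of "f x" "1 / sqrt (D x)", THEN order_trans]) auto
      thus ?thesis using True by (auto simp: C_def)
    qed (auto simp: C_def f_def)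
    hence "f \<in> U" using one g(1) by (auto simp: U_def K_def ipf)
    thus ?thesis by (intro bexI[of _ f]) (auto simp: f_def s_def)
  qed
  have "U \<noteq> {}" using normalize[OF g0] by auto
  then obtain f where f: "f \<in> U" "\<And>g. g \<in> U \<Longrightarrow> bil A B g g \<le> bil A B f f"
    using continuous_attains_sup[OF U _ cip(3)] by blast
  show ?thesis
  proof (intro exI[of _ f] conjI allI impI)
    show "ip A D f f = 1" "\<And>i. i < k \<Longrightarrow> ip A D f (q i) = 0" using f(1) by (auto simp: U_def)
    fix g assume "\<forall>i<k. ip A D g (q i) = 0"
    hence g: "\<And>i. i < k \<Longrightarrow> ip A D g (q i) = 0" by blast
    show "bil A B g g \<le> bil A B f f * ip A D g g"
    proof (cases "ip A D g g = 0")
      case True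
      hence "\<forall>x\<in>A. g x = 0" using ip_eq_0_iff A D by blast
      thus ?thesis using True by (simp add: bil_def)
    next
      case False
      have pos: "ip A D g g > 0" using False ip_nonneg[of A D g] D by force
      from normalize[OF g False] obtain f' where f': "f' \<in> U"
        "\<forall>x\<in>A. f' x = inverse (sqrt (ip A D g g)) * g x" by blast
      have "bil A B f' f' = bil A B (\<lambda>x. inverse (sqrt (ip A D g g)) * g x) (\<lambda>x. inverse (sqrt (ip A D g g)) * g x)"
        using f'(2) by (simp add: bil_def)
      also have "\<dots> = bil A B g g / ip A D g g"
        using pos unfolding bil_scale_left bil_scale_right by (simp add: field_simps)
      finally have "bil A B g g = bil A B f' f' * ip A D g g" using pos by simp
      also have "\<dots> \<le> bil A B f f * ip A D g g"
        using f(2)[OF f'(1)] pos by (intro mult_right_mono) auto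
      finally show ?thesis .
    qed
  qed
qed

text \<open>First variation: perturbing a maximiser by \<open>t * g\<close> gives such a bound, with
  \<open>u\<close> the first-order and \<open>c\<close> the second-order coefficient.\<close>

lemma real_quadratic_linear_coeff_zero:
  fixes u c :: real
  assumes "\<And>t. 2 * t * u \<le> t\<^sup>2 * c" "c \<ge> 0"
  shows "u = 0"
proof (rule ccontr)
  assume "u \<noteq> 0"
  \<comment> \<open>The optimal choice would be \<open>t = u / c\<close>; dividing by
    \<open>c + 1\<close> instead also covers \<open>c = 0\<close>.\<close>
  have c: "c + 1 > 0" using assms by simp
  have "2 * (u / (c+1)) * u * (c+1)\<^sup>2 \<le> (u / (c+1))\<^sup>2 * c * (c+1)\<^sup>2"
    using assms(1)[of "u / (c+1)"] by (intro mult_right_mono) auto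
  also have "(u / (c+1))\<^sup>2 * c * (c+1)\<^sup>2 = u\<^sup>2 * c" using c by (simp add: field_simps)
  also have "2 * (u / (c+1)) * u * (c+1)\<^sup>2 = 2 * u\<^sup>2 * (c + 1)"
    using c by (simp add: field_simps power2_eq_square)
  finally have "u\<^sup>2 * (c + 2) \<le> 0" by (simp add: algebra_simps)
  thus False using \<open>u \<noteq> 0\<close> assms(2) by (simp add: mult_le_0_iff)
qed

lemma orthonormal_residual:
  fixes q :: "nat \<Rightarrow> 'a \<Rightarrow> real"
  assumes A: "finite A" and D: "\<And>x. x \<in> A \<Longrightarrow> D x > 0"
    and orth: "\<And>i j. i < k \<Longrightarrow> j < k \<Longrightarrow> ip A D (q i) (q j) = (if i = j then 1 else 0)"
  defines "r \<equiv> \<lambda>f x. f x - (\<Sum>i<k. ip A D f (q i) * q i x)"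
  shows "j < k \<Longrightarrow> ip A D (r f) (q j) = 0"
    and "ip A D (r f) (r f) = ip A D f f - (\<Sum>i<k. (ip A D f (q i))\<^sup>2)"
proof -
  have ipr: "ip A D (r f) h = ip A D f h - (\<Sum>i<k. ip A D f (q i) * ip A D (q i) h)" for h f
    unfolding r_def by (simp only: ip_diff_left ip_sum_left ip_scale_left)
  show *: "ip A D (r f) (q j) = 0" if "j < k" for j
    using that by (simp add: ipr orth if_distrib[of "\<lambda>t. _ * t"] cong: if_cong)
  have "ip A D (r f) (r f) = ip A D f (r f)" using * unfolding ipr[of f "r f"]
    by (simp add: ip_commute[of A D "q _" "r f"])
  also have "\<dots> = ip A D (r f) f" by (rule ip_commute)
  also have "\<dots> = ip A D f f - (\<Sum>i<k. (ip A D f (q i))\<^sup>2)"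
    unfolding ipr by (simp add: power2_eq_square ip_commute[of A D "q _" f])
  finally show "ip A D (r f) (r f) = ip A D f f - (\<Sum>i<k. (ip A D f (q i))\<^sup>2)" .
qed

text \<open>Courant-Fischer, one vector at a time: a maximiser of the form on the complement of the
  eigenvectors found so far is the next one, and the symmetry of \<open>B\<close> makes it
  orthogonal to them for \<open>B\<close> as well as for \<open>D\<close>.\<close>

lemma orthonormal_eigenfamily:
  assumes A: "finite A" and D: "\<And>x. x \<in> A \<Longrightarrow> D x > 0"
    and sym: "\<And>x y. x \<in> A \<Longrightarrow> y \<in> A \<Longrightarrow> B x y = B y x"
  shows "k \<le> card A \<Longrightarrow> \<exists>(q :: nat \<Rightarrow> 'a \<Rightarrow> real) d.
    (\<forall>i<k. \<forall>j<k. ip A D (q i) (q j) = (if i = j then 1 else 0)) \<and>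
    (\<forall>i<k. \<forall>x\<in>A. (\<Sum>y\<in>A. B x y * q i y) = d i * (D x * q i x))"
proof (induction k)
  case (Suc k)
  then obtain q :: "nat \<Rightarrow> 'a \<Rightarrow> real" and d where
    qd: "\<forall>i<k. \<forall>j<k. ip A D (q i) (q j) = (if i = j then 1 else 0)"
      "\<forall>i<k. \<forall>x\<in>A. (\<Sum>y\<in>A. B x y * q i y) = d i * (D x * q i x)"
    by (auto dest: Suc_leD)
  have q: "ip A D (q i) (q j) = (if i = j then 1 else 0)" if "i < k" "j < k" for i j
    using qd(1) that by blast
  have d: "(\<Sum>y\<in>A. B x y * q i y) = d i * (D x * q i x)" if "i < k" "x \<in> A" for i x
    using qd(2) that by blast
  define r where "r f x = f x - (\<Sum>i<k. ip A D f (q i) * q i x)" for f x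
  note res = orthonormal_residual[where k = k and q = q, OF A D q, folded r_def]
  define e where "e x = (\<lambda>z. if z = x then 1 else (0::real))" for x :: 'a
  \<comment> \<open>While \<open>k < card A\<close>, some indicator \<open>e x\<close> lies outside
    the span: otherwise Bessel's identity at every \<open>x\<close>, divided by \<open>D x\<close>
    and summed over \<open>x\<close>, would give \<open>card A = k\<close>.\<close>
  have "\<exists>x\<in>A. ip A D (r (e x)) (r (e x)) \<noteq> 0"
  proof (rule ccontr)
    assume "\<not> ?thesis"
    hence 0: "ip A D (e x) (e x) = (\<Sum>i<k. (ip A D (e x) (q i))\<^sup>2)" if "x \<in> A" for x
      using res(2)[where f = "e x"] that by auto
    have ex: "ip A D (e x) f = D x * f x" if "x \<in> A" for x f
      using ip_delta[OF A that, of D f] by (simp add: e_def ip_commute)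
    have "1 = (\<Sum>i<k. D x * q i x * q i x)" if "x \<in> A" for x
    proof -
      have "D x * 1 = D x * (\<Sum>i<k. D x * q i x * q i x)"
        using 0[OF that] unfolding ex[OF that] by (simp add: sum_distrib_left power2_eq_square algebra_simps e_def)
      thus ?thesis using D[OF that] by simp
    qed
    hence "(\<Sum>x\<in>A. 1) = (\<Sum>x\<in>A. \<Sum>i<k. D x * q i x * q i x)" by (intro sum.cong refl)
    hence "real (card A) = (\<Sum>x\<in>A. \<Sum>i<k. D x * q i x * q i x)" by simp
    also have "\<dots> = (\<Sum>i<k. ip A D (q i) (q i))" by (subst sum.swap) (simp add: ip_def)
    also have "\<dots> = k" by (simp add: q)
    finally show False using Suc.prems by linarith
  qed
  then obtain x where x: "ip A D (r (e x)) (r (e x)) \<noteq> 0" by blast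
  have "\<exists>f. ip A D f f = 1 \<and> (\<forall>i<k. ip A D f (q i) = 0) \<and>
    (\<forall>g. (\<forall>i<k. ip A D g (q i) = 0) \<longrightarrow> bil A B g g \<le> bil A B f f * ip A D g g)"
    by (rule rayleigh_maximizer[where ?g0.0 = "r (e x)"]) (use A D res(1) x in simp_all)
  then obtain f where f: "ip A D f f = 1" "\<forall>i<k. ip A D f (q i) = 0"
    "\<forall>g. (\<forall>i<k. ip A D g (q i) = 0) \<longrightarrow> bil A B g g \<le> bil A B f f * ip A D g g"
    by (elim exE conjE)
  have fq: "ip A D f (q i) = 0" "ip A D (q i) f = 0" if "i < k" for i
    using f(2) that by (simp_all add: ip_commute[of A D "q i" f])
  define \<rho> where "\<rho> = bil A B f f"
  have orthog: "bil A B f g = \<rho> * ip A D f g" if g: "\<And>i. i < k \<Longrightarrow> ip A D g (q i) = 0" for g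
  proof -
    have "2 * t * (bil A B f g - \<rho> * ip A D f g) \<le> t\<^sup>2 * (\<rho> * ip A D g g - bil A B g g)" for t
    proof -
      let ?h = "\<lambda>x. f x + t * g x"
      have "bil A B ?h ?h \<le> \<rho> * ip A D ?h ?h"
        unfolding \<rho>_def using f(2) g
        by (intro f(3)[rule_format]) (simp add: ip_add_left ip_scale_left)
      moreover have "bil A B ?h ?h = \<rho> + 2 * t * bil A B f g + t\<^sup>2 * bil A B g g"
        using bil_commute[of A B g f, OF sym]
        by (simp add: bil_add_left bil_add_right bil_scale_left bil_scale_right \<rho>_def
          power2_eq_square algebra_simps)
      moreover have "ip A D ?h ?h = 1 + 2 * t * ip A D f g + t\<^sup>2 * ip A D g g"
        using ip_commute[of A D g f] f(1)
        by (simp add: ip_add_left ip_add_right ip_scale_left ip_scale_right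
          power2_eq_square algebra_simps)
      ultimately show ?thesis by (simp add: algebra_simps)
    qed
    moreover have "\<rho> * ip A D g g - bil A B g g \<ge> 0" using f(3) g by (simp add: \<rho>_def)
    ultimately have "bil A B f g - \<rho> * ip A D f g = 0" by (rule real_quadratic_linear_coeff_zero)
    thus ?thesis by simp
  qed
  have orthog': "bil A B f (q i) = 0" if "i < k" for i
    using bil_eq_ip[of A B "q i" "d i" D f] d[OF that] f(2) that by simp
  \<comment> \<open>The variation identity is available only for test functions orthogonal to the
    \<open>q i\<close>. But \<open>e x\<close> is its residual plus a combination of the
    \<open>q i\<close>, to which \<open>f\<close> is orthogonal for both forms, so it may be used as
    a test function too.\<close>
  have eig: "(\<Sum>y\<in>A. B x y * f y) = \<rho> * (D x * f x)" if x: "x \<in> A" for x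
  proof -
    have e: "(\<lambda>z. r (e x) z + (\<Sum>i<k. ip A D (e x) (q i) * q i z)) = e x" by (simp add: r_def)
    have "bil A B (\<lambda>z. r (e x) z + (\<Sum>i<k. ip A D (e x) (q i) * q i z)) f
        = bil A B (r (e x)) f + (\<Sum>i<k. ip A D (e x) (q i) * bil A B (q i) f)"
      by (simp only: bil_add_left bil_sum_left bil_scale_left finite_lessThan)
    hence 1: "bil A B (e x) f = bil A B f (r (e x))"
      unfolding e by (simp add: orthog' bil_commute[OF sym, where f = "q _" and g = f]
        bil_commute[OF sym, where f = "r (e x)" and g = f])
    have "ip A D (\<lambda>z. r (e x) z + (\<Sum>i<k. ip A D (e x) (q i) * q i z)) f
        = ip A D (r (e x)) f + (\<Sum>i<k. ip A D (e x) (q i) * ip A D (q i) f)"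
      by (simp only: ip_add_left ip_sum_left ip_scale_left)
    hence 2: "ip A D (e x) f = ip A D f (r (e x))"
      unfolding e by (simp add: fq ip_commute[of A D "r (e x)" f])
    have "(\<Sum>y\<in>A. B x y * f y) = bil A B f (e x)" unfolding e_def using bil_delta[OF A x sym] by simp
    also have "\<dots> = bil A B f (r (e x))" using 1 bil_commute[OF sym, where f = "e x" and g = f] by simp
    also have "\<dots> = \<rho> * ip A D f (r (e x))" by (rule orthog) (rule res(1))
    also have "\<dots> = \<rho> * ip A D f (e x)" using 2 by (simp add: ip_commute)
    also have "ip A D f (e x) = D x * f x" using ip_delta[OF A x] by (simp add: e_def)
    finally show ?thesis .
  qed
  have "\<forall>i<Suc k. \<forall>j<Suc k. ip A D ((q(k := f)) i) ((q(k := f)) j) = (if i = j then 1 else 0)"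
    using f(1) fq q by (auto simp: less_Suc_eq)
  moreover have "\<forall>i<Suc k. \<forall>x\<in>A. (\<Sum>y\<in>A. B x y * (q(k := f)) i y) = (d(k := \<rho>)) i * (D x * (q(k := f)) i x)"
    using eig d by (auto simp: less_Suc_eq)
  ultimately show ?case by (intro exI[of _ "q(k := f)"] exI[of _ "d(k := \<rho>)"] conjI)
qed auto

lemma bil_sum_right: "finite I \<Longrightarrow> bil A B h (\<lambda>x. \<Sum>i\<in>I. f i x) = (\<Sum>i\<in>I. bil A B h (f i))"
  by (induction I rule: finite_induct) (simp_all add: bil_add_right, simp add: bil_def)

lemma ip_sum_right: "ip A D h (\<lambda>x. \<Sum>i\<in>I. f i x) = (\<Sum>i\<in>I. ip A D h (f i))"
  by (simp add: ip_commute[of A D h] ip_sum_left)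

lemma ip_cong: "(\<And>x. x \<in> A \<Longrightarrow> f x = f' x) \<Longrightarrow> (\<And>x. x \<in> A \<Longrightarrow> g x = g' x) \<Longrightarrow> ip A D f g = ip A D f' g'"
  by (simp add: ip_def)

lemma bil_cong: "(\<And>x. x \<in> A \<Longrightarrow> f x = f' x) \<Longrightarrow> (\<And>x. x \<in> A \<Longrightarrow> g x = g' x) \<Longrightarrow> bil A B f g = bil A B f' g'"
  by (simp add: bil_def)

text \<open>A trace argument: the defects \<open>1 - (\<Sum>i<card A. D x * q i x * q i x)\<close>
  are nonnegative by Bessel's inequality and add up to \<open>card A - card A = 0\<close>. So each
  vanishes, and every indicator lies in the span.\<close>

lemma orthonormal_complete:
  fixes q :: "nat \<Rightarrow> 'a \<Rightarrow> real"
  assumes A: "finite A" and D: "\<And>x. x \<in> A \<Longrightarrow> D x > 0"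
    and orth: "\<And>i j. i < card A \<Longrightarrow> j < card A \<Longrightarrow> ip A D (q i) (q j) = (if i = j then 1 else 0)"
    and x: "x \<in> A"
  shows "f x = (\<Sum>i<card A. ip A D f (q i) * q i x)"
proof -
  let ?n = "card A"
  define r where "r f x = f x - (\<Sum>i<?n. ip A D f (q i) * q i x)" for f x
  note res = orthonormal_residual[where k = ?n and q = q, OF A D orth, folded r_def]
  define e where "e x = (\<lambda>z. if z = x then 1 else (0::real))" for x :: 'a
  have ex: "ip A D f (e x) = D x * f x" "ip A D (e x) f = D x * f x" if "x \<in> A" for x f
    using ip_delta[OF A that, of D f] by (simp_all add: e_def ip_commute)
  have rr: "ip A D (r (e x)) (r (e x)) = D x * (1 - (\<Sum>i<?n. D x * q i x * q i x))" if "x \<in> A" for x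
    using res(2)[of "e x"] unfolding ex[OF that]
    by (simp add: e_def algebra_simps power2_eq_square sum_distrib_left)
  have nonneg: "1 - (\<Sum>i<?n. D x * q i x * q i x) \<ge> 0" if "x \<in> A" for x
    using rr[OF that] D[OF that] ip_nonneg[of A D "r (e x)"] D
    by (simp add: zero_le_mult_iff less_imp_le)
  have "(\<Sum>x\<in>A. 1 - (\<Sum>i<?n. D x * q i x * q i x)) = real ?n - (\<Sum>i<?n. ip A D (q i) (q i))"
    unfolding sum_subtractf by (subst sum.swap) (simp add: ip_def)
  also have "\<dots> = 0" by (simp add: orth)
  finally have "\<forall>x\<in>A. 1 - (\<Sum>i<?n. D x * q i x * q i x) = 0"
    using nonneg A by (subst (asm) sum_nonneg_eq_0_iff) auto
  hence "ip A D (r (e x)) (r (e x)) = 0" using rr x by simp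
  hence r0: "r (e x) z = 0" if "z \<in> A" for z
    using ip_eq_0_iff[where D = D, OF A D] that by blast
  have "D x * r f x = ip A D (r f) (e x)" using ex x by simp
  also have "\<dots> = ip A D (r f) (\<lambda>z. \<Sum>i<?n. ip A D (e x) (q i) * q i z)"
    using r0 by (intro ip_cong) (auto simp: r_def)
  also have "\<dots> = 0" by (simp add: ip_sum_right ip_scale_right res(1))
  finally show ?thesis using D[OF x] by (simp add: r_def)
qed

section \<open>Expansion in an eigenbasis and the characteristic polynomial of a pencil\<close>

definition eigenbasis ::
  "'a set \<Rightarrow> ('a \<Rightarrow> real) \<Rightarrow> ('a \<Rightarrow> 'a \<Rightarrow> real) \<Rightarrow> (nat \<Rightarrow> 'a \<Rightarrow> real) \<Rightarrow> (nat \<Rightarrow> real) \<Rightarrow> bool" where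
  "eigenbasis A D B q d \<longleftrightarrow>
    (\<forall>i<card A. \<forall>j<card A. ip A D (q i) (q j) = (if i = j then 1 else 0)) \<and>
    (\<forall>i<card A. \<forall>x\<in>A. (\<Sum>y\<in>A. B x y * q i y) = d i * (D x * q i x))"

locale symmetric_pencil =
  fixes A :: "'a set" and D :: "'a \<Rightarrow> real" and B :: "'a \<Rightarrow> 'a \<Rightarrow> real"
  assumes finite_index: "finite A"
    and D_pos: "\<And>x. x \<in> A \<Longrightarrow> D x > 0"
    and B_sym: "\<And>x y. x \<in> A \<Longrightarrow> y \<in> A \<Longrightarrow> B x y = B y x"
begin

lemma eigenbasis_exists: "\<exists>q d. eigenbasis A D B q d"
  using orthonormal_eigenfamily[OF finite_index D_pos B_sym order_refl] unfolding eigenbasis_def .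

context
  fixes q d
  assumes qd: "eigenbasis A D B q d"
begin

lemma eigen_orth: "i < card A \<Longrightarrow> j < card A \<Longrightarrow> ip A D (q i) (q j) = (if i = j then 1 else 0)"
  using qd by (auto simp: eigenbasis_def)

lemma eigen_eq: "i < card A \<Longrightarrow> x \<in> A \<Longrightarrow> (\<Sum>y\<in>A. B x y * q i y) = d i * (D x * q i x)"
  using qd by (auto simp: eigenbasis_def)

lemma eigen_expand: "x \<in> A \<Longrightarrow> f x = (\<Sum>i<card A. ip A D f (q i) * q i x)"
  using finite_index D_pos eigen_orth by (rule orthonormal_complete) auto

lemma ip_expand: "ip A D f g = (\<Sum>i<card A. ip A D f (q i) * ip A D g (q i))"
proof -
  have "ip A D f g = ip A D (\<lambda>x. \<Sum>i<card A. ip A D f (q i) * q i x) g"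
    by (intro ip_cong eigen_expand refl)
  thus ?thesis by (simp add: ip_sum_left ip_scale_left ip_commute[of A D "q _" g])
qed

lemma bil_eigen: "i < card A \<Longrightarrow> bil A B f (q i) = d i * ip A D f (q i)"
  by (rule bil_eq_ip) (rule eigen_eq)

lemma bil_expand: "bil A B f f = (\<Sum>i<card A. d i * (ip A D f (q i))\<^sup>2)"
proof -
  have "bil A B f f = bil A B f (\<lambda>x. \<Sum>i<card A. ip A D f (q i) * q i x)"
    by (intro bil_cong eigen_expand refl)
  also have "\<dots> = (\<Sum>i<card A. ip A D f (q i) * bil A B f (q i))"
    by (simp only: bil_sum_right[OF finite_lessThan] bil_scale_right)
  finally show ?thesis by (simp add: bil_eigen power2_eq_square algebra_simps)
qed

lemma char_poly_pencil:
  "char_poly (mat_on A (\<lambda>x y. B x y / D x)) = (\<Prod>a\<leftarrow>map d [0..<card A]. [:- a, 1:])"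
proof -
  define n where "n = card A"
  define a where "a = from_nat_into A"
  have bij: "bij_betw a {0..<n} A"
    unfolding n_def a_def using bij_betw_from_nat_into_finite[OF finite_index]
    by (simp add: atLeast0LessThan)
  have aA: "a i \<in> A" if "i < n" for i using bij that by (auto simp: bij_betw_def)
  have reindex: "(\<Sum>k = 0..<n. F (a k)) = (\<Sum>x\<in>A. F x)" for F :: "'a \<Rightarrow> real"
    using sum.reindex_bij_betw[OF bij] .
  define T where "T = mat_on A (\<lambda>x y. B x y / D x)"
  \<comment> \<open>The columns of \<open>R\<close> are the eigenvectors. Orthonormality for the
    weight \<open>D\<close> says that \<open>L\<close>, the transpose of \<open>R\<close> with
    columns scaled by \<open>D\<close>, is its inverse.\<close>
  define R where "R = mat n n (\<lambda>(i, j). q j (a i))"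
  define L where "L = mat n n (\<lambda>(i, j). D (a j) * q i (a j))"
  define E where "E = mat n n (\<lambda>(i, j). if i = j then d i else 0)"
  have T: "T = mat n n (\<lambda>(i, j). B (a i) (a j) / D (a i))"
    by (simp add: T_def mat_on_def n_def a_def)
  have carrier: "T \<in> carrier_mat n n" "R \<in> carrier_mat n n" "L \<in> carrier_mat n n" "E \<in> carrier_mat n n"
    by (auto simp: T R_def L_def E_def)
  have LR: "L * R = 1\<^sub>m n"
  proof (rule eq_matI)
    fix i j assume "i < dim_row (1\<^sub>m n :: real mat)" "j < dim_col (1\<^sub>m n :: real mat)"
    hence ij: "i < n" "j < n" by auto
    have "(L * R) $$ (i, j) = (\<Sum>k = 0..<n. D (a k) * q i (a k) * q j (a k))"
      using ij by (simp add: L_def R_def scalar_prod_def)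
    also have "\<dots> = ip A D (q i) (q j)" unfolding ip_def by (rule reindex)
    finally show "(L * R) $$ (i, j) = 1\<^sub>m n $$ (i, j)" using ij eigen_orth by (simp add: n_def)
  qed (auto simp: L_def R_def)
  hence RL: "R * L = 1\<^sub>m n" using mat_mult_left_right_inverse carrier by blast
  have TR: "T * R = R * E"
  proof (rule eq_matI)
    fix i j assume "i < dim_row (R * E)" "j < dim_col (R * E)"
    hence ij: "i < n" "j < n" by (auto simp: R_def E_def)
    have "(T * R) $$ (i, j) = (\<Sum>k = 0..<n. B (a i) (a k) / D (a i) * q j (a k))"
      using ij by (simp add: T R_def scalar_prod_def)
    also have "\<dots> = (\<Sum>x\<in>A. B (a i) x * q j x) / D (a i)"
      unfolding reindex[of "\<lambda>x. B (a i) x / D (a i) * q j x"] by (simp add: sum_divide_distrib)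
    also have "\<dots> = q j (a i) * d j"
      using eigen_eq[of j "a i"] ij aA[OF ij(1)] D_pos[OF aA[OF ij(1)]] by (simp add: n_def)
    also have "\<dots> = (R * E) $$ (i, j)"
      using ij by (simp add: R_def E_def scalar_prod_def if_distrib[of "\<lambda>t. _ * t"] cong: if_cong)
    finally show "(T * R) $$ (i, j) = (R * E) $$ (i, j)" .
  qed (auto simp: T R_def E_def)
  have "T = T * (R * L)" using carrier by (simp add: RL)
  also have "\<dots> = R * E * L" unfolding TR[symmetric] using carrier by (simp add: assoc_mult_mat)
  finally have "similar_mat T E"
    using similar_mat_witI[OF RL LR _ carrier(1,4,2,3)] unfolding similar_mat_def by blast
  hence "char_poly T = char_poly E" by (rule char_poly_similar)
  also have "\<dots> = (\<Prod>a\<leftarrow>diag_mat E. [:- a, 1:])"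
    using carrier(4) by (rule char_poly_upper_triangular) (auto simp: E_def upper_triangular_def)
  also have "diag_mat E = map d [0..<n]" by (auto simp: diag_mat_def E_def)
  finally show ?thesis by (simp add: T_def n_def)
qed

lemma eigenvalues_desc_pencil:
  "eigenvalues_desc (mat_on A (\<lambda>x y. B x y / D x)) = rev (sort (map d [0..<card A]))"
proof -
  have "proots (\<Prod>a\<leftarrow>xs. [:- a, 1:]) = mset xs" for xs :: "real list"
  proof (induction xs)
    case (Cons x xs)
    have "(\<Prod>a\<leftarrow>xs. [:- a, 1:]) \<noteq> 0" by (auto simp: prod_list_zero_iff)
    hence "proots ([:- x, 1:] * (\<Prod>a\<leftarrow>xs. [:- a, 1:])) = proots [:- x, 1:] + proots (\<Prod>a\<leftarrow>xs. [:- a, 1:])"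
      by (intro proots_mult) auto
    thus ?case using Cons by (simp only: list.map prod_list.Cons proots_linear_factor) simp
  qed simp
  thus ?thesis by (simp only: eigenvalues_desc_def char_poly_pencil sorted_list_of_multiset_mset)
qed

lemma eigenvalue_pencil_iff:
  "eigenvalue (mat_on A (\<lambda>x y. B x y / D x)) c \<longleftrightarrow> c \<in> d ` {..<card A}"
proof -
  have *: "poly (\<Prod>a\<leftarrow>xs. [:- a, 1:]) c = 0 \<longleftrightarrow> c \<in> set xs" for xs :: "real list"
    by (induction xs) auto
  have "mat_on A (\<lambda>x y. B x y / D x) \<in> carrier_mat (card A) (card A)" by (simp add: mat_on_def)
  thus ?thesis
    by (simp only: eigenvalue_root_char_poly char_poly_pencil *) (simp add: atLeast0LessThan)
qed

end

end

text \<open>Counting the indices above a threshold respects multiplicities and frees later arguments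
  from the order of the sorted list.\<close>

lemma second_in_rev_sort:
  fixes d :: "nat \<Rightarrow> real"
  assumes "2 \<le> n"
  defines "s \<equiv> rev (sort (map d [0..<n])) ! 1"
  shows second_le: "card {i. i < n \<and> d i > c} \<le> 1 \<Longrightarrow> s \<le> c"
    and second_ge: "card {i. i < n \<and> d i > s} \<le> 1"
proof -
  define L where "L = rev (sort (map d [0..<n]))"
  have "length L = n" by (simp add: L_def)
  then obtain a b r where L: "L = a # b # r" using assms(1)
    by (metis One_nat_def Suc_1 Suc_le_length_iff)
  have "sorted_wrt (\<ge>) L" unfolding L_def using sorted_sort[of "map d [0..<n]"]
    by (simp add: sorted_wrt_rev)
  hence ord: "b \<le> a" "\<And>x. x \<in> set r \<Longrightarrow> x \<le> b" by (auto simp: L)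
  have "mset L = mset (map d [0..<n])" by (simp add: L_def)
  hence "size (filter_mset (\<lambda>x. x > t) (mset L)) = size (filter_mset (\<lambda>x. x > t) (mset (map d [0..<n])))" for t
    by simp
  hence *: "length (filter (\<lambda>x. x > t) L) = length (filter (\<lambda>x. x > t) (map d [0..<n]))" for t
    by (simp only: mset_filter[symmetric] size_mset)
  have card: "card {i. i < n \<and> d i > t} = length (filter (\<lambda>x. x > t) L)" for t
    unfolding * by (simp add: length_filter_conv_card cong: conj_cong)
  have s: "s = b" using L by (simp add: s_def L_def)
  show "s \<le> c" if "card {i. i < n \<and> d i > c} \<le> 1"
    using that ord(1) unfolding card s by (auto simp: L split: if_splits)
  have "filter (\<lambda>x. x > b) r = []" using ord(2) by (auto simp: filter_empty_conv not_less)
  thus "card {i. i < n \<and> d i > s} \<le> 1" unfolding card s by (simp add: L)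
qed

lemma rayleigh_le_lambda_max:
  assumes A: "finite A" and sym: "\<And>x y. x \<in> A \<Longrightarrow> y \<in> A \<Longrightarrow> M x y = M y x"
  shows "(\<Sum>x\<in>A. \<Sum>y\<in>A. M x y * f x * f y) \<le> lambda_max (mat_on A M) * (\<Sum>x\<in>A. (f x)\<^sup>2)"
proof -
  interpret symmetric_pencil A "\<lambda>_. 1" M by unfold_locales (use assms in auto)
  obtain q d where qd: "eigenbasis A (\<lambda>_. 1) M q d" using eigenbasis_exists by blast
  have spec: "spectrum (mat_on A M) = d ` {..<card A}"
    using eigenvalue_pencil_iff[OF qd] by (auto simp: spectrum_def)
  have "d i \<le> lambda_max (mat_on A M)" if "i < card A" for i
    unfolding lambda_max_def spec using that by (intro Max_ge) auto
  hence "bil A M f f \<le> (\<Sum>i<card A. lambda_max (mat_on A M) * (ip A (\<lambda>_. 1) f (q i))\<^sup>2)"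
    unfolding bil_expand[OF qd] by (intro sum_mono mult_right_mono) auto
  also have "\<dots> = lambda_max (mat_on A M) * ip A (\<lambda>_. 1) f f"
    by (simp add: ip_expand[OF qd, of f f] sum_distrib_left power2_eq_square)
  finally show ?thesis by (simp add: bil_def ip_def power2_eq_square)
qed

section \<open>Rayleigh quotients and the second eigenvalue of a random walk\<close>

locale weighted_graph =
  fixes A :: "'a set" and w :: "'a \<Rightarrow> 'a \<Rightarrow> real" and deg :: "'a \<Rightarrow> real"
  assumes finite_vertices: "finite A"
    and w_sym: "\<And>x y. x \<in> A \<Longrightarrow> y \<in> A \<Longrightarrow> w x y = w y x"
    and w_nonneg: "\<And>x y. x \<in> A \<Longrightarrow> y \<in> A \<Longrightarrow> w x y \<ge> 0"
    and deg_eq: "\<And>x. x \<in> A \<Longrightarrow> deg x = (\<Sum>y\<in>A. w x y)"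
    and deg_pos: "\<And>x. x \<in> A \<Longrightarrow> deg x > 0"
    and card_vertices: "card A \<ge> 2"
begin

sublocale symmetric_pencil A deg w
  by unfold_locales (use finite_vertices w_sym deg_pos in auto)

text \<open>The Dirichlet form is nonnegative and equals twice the difference of the two
  sides.\<close>

lemma bil_le_ip: "bil A w f f \<le> ip A deg f f"
proof -
  have "0 \<le> (\<Sum>x\<in>A. \<Sum>y\<in>A. w x y * (f x - f y)\<^sup>2)"
    using w_nonneg by (intro sum_nonneg) auto
  also have "\<dots> = (\<Sum>x\<in>A. \<Sum>y\<in>A. w x y * f x * f x) + (\<Sum>x\<in>A. \<Sum>y\<in>A. w x y * f y * f y) - 2 * bil A w f f"
    unfolding bil_def by (simp add: power2_eq_square algebra_simps sum.distrib sum_subtractf sum_distrib_left)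
  also have "(\<Sum>x\<in>A. \<Sum>y\<in>A. w x y * f y * f y) = (\<Sum>x\<in>A. \<Sum>y\<in>A. w x y * f x * f x)"
    by (subst sum.swap) (intro sum.cong refl, simp add: w_sym)
  also have "(\<Sum>x\<in>A. \<Sum>y\<in>A. w x y * f x * f x) = ip A deg f f"
    unfolding ip_def by (simp add: deg_eq sum_distrib_right)
  finally show ?thesis by simp
qed

lemma bil_one: "bil A w f (\<lambda>_. 1) = ip A deg f (\<lambda>_. 1)"
  using bil_eq_ip[of A w "\<lambda>_. 1" 1 deg f] by (simp add: deg_eq)

abbreviation walk :: "real mat" where "walk \<equiv> mat_on A (\<lambda>x y. w x y / deg x)"

text \<open>If the second eigenvalue is below 1, the constants are a multiple of a single basis
  vector, to which \<open>f\<close> is then orthogonal, and all other eigenvalues are at most the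
  second one. If it is at least 1, \<open>bil_le_ip\<close> already suffices.\<close>

lemma lambda2_ge_rayleigh:
  assumes f: "ip A deg f (\<lambda>_. 1) = 0"
  shows "bil A w f f \<le> lambda2 walk * ip A deg f f"
proof -
  obtain q d where qd: "eigenbasis A deg w q d" using eigenbasis_exists by blast
  let ?s = "lambda2 walk" and ?n = "card A" and ?one = "\<lambda>_. 1 :: real"
  have card1: "card {i. i < ?n \<and> d i > ?s} \<le> 1"
    unfolding lambda2_def eigenvalues_desc_pencil[OF qd] by (rule second_ge[OF card_vertices])
  show ?thesis
  proof (cases "?s \<ge> 1")
    case True
    have "bil A w f f \<le> 1 * ip A deg f f" using bil_le_ip by simp
    also have "\<dots> \<le> ?s * ip A deg f f"
      using True deg_pos by (intro mult_right_mono ip_nonneg) (auto simp: less_imp_le)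
    finally show ?thesis .
  next
    case False
    have coeff: "(1 - d i) * ip A deg ?one (q i) = 0" if "i < ?n" for i
      using bil_eigen[OF qd that, of ?one] bil_one[of "q i"] bil_commute[of A w "q i" ?one, OF w_sym]
        ip_commute[of A deg "q i" ?one] by (simp add: algebra_simps)
    have "A \<noteq> {}" using card_vertices by auto
    hence "ip A deg ?one ?one \<noteq> 0" using ip_eq_0_iff[where D = deg and f = ?one, OF finite_vertices deg_pos] by auto
    then obtain k where k: "k < ?n" "ip A deg ?one (q k) \<noteq> 0"
      unfolding ip_expand[OF qd, of ?one ?one] by (auto elim: sum.not_neutral_contains_not_neutral)
    have "d k = 1" using coeff[OF k(1)] k(2) by simp
    hence kmem: "k \<in> {i. i < ?n \<and> d i > ?s}" using False k by simp
    have others: "d i \<le> ?s" if "i < ?n" "i \<noteq> k" for i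
    proof (rule ccontr)
      assume "\<not> d i \<le> ?s"
      hence "{i, k} \<subseteq> {i. i < ?n \<and> d i > ?s}" using that kmem by auto
      hence "card {i, k} \<le> card {i. i < ?n \<and> d i > ?s}" by (intro card_mono) auto
      thus False using card1 that by simp
    qed
    have "(\<Sum>i<?n. ip A deg f (q i) * ip A deg ?one (q i))
        = (\<Sum>i\<in>{k}. ip A deg f (q i) * ip A deg ?one (q i))"
    proof (rule sum.mono_neutral_right)
      show "\<forall>i\<in>{..<?n} - {k}. ip A deg f (q i) * ip A deg ?one (q i) = 0"
        using coeff others False by fastforce
    qed (use k in auto)
    hence "ip A deg f ?one = ip A deg f (q k) * ip A deg ?one (q k)"
      by (simp add: ip_expand[OF qd, of f ?one])
    hence fk: "ip A deg f (q k) = 0" using f k by simp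
    have "bil A w f f \<le> (\<Sum>i<?n. ?s * (ip A deg f (q i))\<^sup>2)"
      unfolding bil_expand[OF qd]
    proof (rule sum_mono)
      fix i assume "i \<in> {..<?n}"
      thus "d i * (ip A deg f (q i))\<^sup>2 \<le> ?s * (ip A deg f (q i))\<^sup>2"
        using others[of i] fk by (cases "i = k") (auto intro: mult_right_mono)
    qed
    also have "\<dots> = ?s * ip A deg f f"
      by (simp add: ip_expand[OF qd, of f f] sum_distrib_left power2_eq_square)
    finally show ?thesis .
  qed
qed

text \<open>Two eigenvalues above \<open>c\<close> would span a plane on which the form exceeds
  \<open>c * ip A deg f f\<close>, and some nonzero vector of this plane is orthogonal to the
  constants.\<close>

lemma lambda2_le_rayleigh:
  assumes le: "\<And>f. ip A deg f (\<lambda>_. 1) = 0 \<Longrightarrow> bil A w f f \<le> c * ip A deg f f"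
  shows "lambda2 walk \<le> c"
proof -
  obtain q d where qd: "eigenbasis A deg w q d" using eigenbasis_exists by blast
  let ?n = "card A" and ?one = "\<lambda>_. 1 :: real"
  have "card {i. i < ?n \<and> d i > c} \<le> 1"
  proof (rule ccontr)
    assume "\<not> ?thesis"
    hence "2 \<le> card {i. i < ?n \<and> d i > c}" by simp
    then obtain i j where ij: "i < ?n" "j < ?n" "i \<noteq> j" "d i > c" "d j > c"
      by (auto simp: card_le_Suc_iff numeral_2_eq_2)
    \<comment> \<open>The coefficients cancel the inner products of \<open>q i\<close> and
      \<open>q j\<close> with the constants. If both products vanish, this choice would give the
      zero vector, so \<open>\<alpha>\<close> is set to 1.\<close>
    define \<alpha> \<beta> where "\<alpha> = (if ip A deg (q i) ?one = 0 \<and> ip A deg (q j) ?one = 0 then 1 else ip A deg (q j) ?one)"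
      and "\<beta> = - ip A deg (q i) ?one"
    have nz: "\<alpha> \<noteq> 0 \<or> \<beta> \<noteq> 0" by (auto simp: \<alpha>_def \<beta>_def)
    define f where "f = (\<lambda>x. \<alpha> * q i x + \<beta> * q j x)"
    have "ip A deg f ?one = 0"
      by (simp only: f_def ip_add_left ip_scale_left) (simp add: \<alpha>_def \<beta>_def)
    hence "bil A w f f \<le> c * ip A deg f f" by (rule le)
    moreover have fi: "ip A deg f (q l) = (if l = i then \<alpha> else 0) + (if l = j then \<beta> else 0)" if "l < ?n" for l
      using ij that by (simp add: f_def ip_add_left ip_scale_left eigen_orth[OF qd])
    have "bil A w f f = \<alpha> * bil A w f (q i) + \<beta> * bil A w f (q j)"
      by (simp add: f_def bil_add_right bil_scale_right)
    hence "bil A w f f = d i * \<alpha>\<^sup>2 + d j * \<beta>\<^sup>2"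
      using ij by (simp add: bil_eigen[OF qd] fi power2_eq_square)
    moreover have "ip A deg f f = \<alpha> * ip A deg f (q i) + \<beta> * ip A deg f (q j)"
      by (simp add: f_def ip_add_right ip_scale_right)
    hence "ip A deg f f = \<alpha>\<^sup>2 + \<beta>\<^sup>2" using ij by (simp add: fi power2_eq_square)
    ultimately have "(d i - c) * \<alpha>\<^sup>2 + (d j - c) * \<beta>\<^sup>2 \<le> 0" by (simp add: algebra_simps)
    moreover have "(d i - c) * \<alpha>\<^sup>2 + (d j - c) * \<beta>\<^sup>2 > 0"
      using ij nz by (auto intro: add_pos_nonneg add_nonneg_pos)
    ultimately show False by simp
  qed
  thus ?thesis unfolding lambda2_def eigenvalues_desc_pencil[OF qd] by (rule second_le[OF card_vertices])
qed

end

text \<open>The inequality forces every eigenvalue \<open>d\<close> to satisfy \<open>d \<le> d\<^sup>2\<close>, while by Perron-Frobenius all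
  eigenvalues are at most 1 and 1 is simple: apart from \<open>h\<close> there are no positive eigenvalues.\<close>

lemma (in symmetric_pencil) bochner:
  assumes h: "\<And>x. x \<in> A \<Longrightarrow> h x > 0"
    and Bh: "\<And>x. x \<in> A \<Longrightarrow> (\<Sum>y\<in>A. B x y * h y) = D x * h x"
    and offdiag: "\<And>x y. x \<in> A \<Longrightarrow> y \<in> A \<Longrightarrow> x \<noteq> y \<Longrightarrow> B x y \<ge> 0"
    and ineq: "\<And>f. bil A B f f \<le> (\<Sum>x\<in>A. (\<Sum>y\<in>A. B x y * f y)\<^sup>2 / D x)"
    and conn: "\<And>\<phi> :: 'a \<Rightarrow> real.
      (\<And>x y. x \<in> A \<Longrightarrow> y \<in> A \<Longrightarrow> x \<noteq> y \<Longrightarrow> B x y > 0 \<Longrightarrow> \<phi> x = \<phi> y) \<Longrightarrow> \<exists>c. \<forall>x\<in>A. \<phi> x = c"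
    and f: "ip A D f h = 0"
  shows "bil A B f f \<le> 0"
proof -
  obtain q d where qd: "eigenbasis A D B q d" using eigenbasis_exists by blast
  have "d i * (ip A D f (q i))\<^sup>2 \<le> 0" if i: "i < card A" for i
  proof (cases "d i > 0")
    case True
    let ?g = "q i" and ?\<phi> = "\<lambda>x. q i x / h x"
    have one: "ip A D ?g ?g = 1" using eigen_orth[OF qd i i] by simp
    hence bg: "bil A B ?g ?g = d i" using bil_eigen[OF qd i, of ?g] by simp
    have "(\<Sum>x\<in>A. (\<Sum>y\<in>A. B x y * ?g y)\<^sup>2 / D x) = (\<Sum>x\<in>A. (d i)\<^sup>2 * (D x * ?g x * ?g x))"
      using D_pos by (intro sum.cong refl) (simp add: eigen_eq[OF qd i] power2_eq_square field_simps less_imp_neq[symmetric])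
    also have "\<dots> = (d i)\<^sup>2" using one by (simp add: ip_def flip: sum_distrib_left)
    finally have "d i \<le> (d i)\<^sup>2" using ineq[of ?g] bg by simp
    hence d1: "d i \<ge> 1" using True by (simp add: power2_eq_square)
    have diag: "(\<Sum>x\<in>A. \<Sum>y\<in>A. B x y * h x * h y * (?\<phi> x)\<^sup>2) = ip A D ?g ?g"
    proof -
      have "(\<Sum>x\<in>A. \<Sum>y\<in>A. B x y * h x * h y * (?\<phi> x)\<^sup>2) = (\<Sum>x\<in>A. (?\<phi> x)\<^sup>2 * h x * (\<Sum>y\<in>A. B x y * h y))"
        unfolding sum_distrib_left by (intro sum.cong refl) (simp add: mult_ac)
      also have "\<dots> = ip A D ?g ?g" unfolding ip_def
      proof (intro sum.cong refl)
        fix x assume x: "x \<in> A"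
        show "(?\<phi> x)\<^sup>2 * h x * (\<Sum>y\<in>A. B x y * h y) = D x * ?g x * ?g x"
          unfolding Bh[OF x] using h[OF x] by (simp add: power2_eq_square field_simps)
      qed
      finally show ?thesis .
    qed
    have off: "(\<Sum>x\<in>A. \<Sum>y\<in>A. B x y * h x * h y * (?\<phi> x * ?\<phi> y)) = bil A B ?g ?g"
      unfolding bil_def using h by (intro sum.cong refl) (simp add: less_imp_neq[symmetric])
    have diag': "(\<Sum>x\<in>A. \<Sum>y\<in>A. B x y * h x * h y * (?\<phi> y)\<^sup>2) = ip A D ?g ?g"
      unfolding diag[symmetric] by (subst sum.swap) (intro sum.cong refl, simp add: B_sym mult.commute mult.left_commute)
    \<comment> \<open>Ground-state transform: writing the eigenvector as \<open>h\<close> times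
      \<open>\<phi>\<close> turns \<open>ip - bil\<close> into squared differences with weights
      \<open>B x y * h x * h y\<close>. Diagonal terms drop out, so nonnegative entries off the
      diagonal make every summand nonnegative.\<close>
    have expand: "(\<Sum>x\<in>A. \<Sum>y\<in>A. B x y * h x * h y * (?\<phi> x - ?\<phi> y)\<^sup>2) = 2 * (1 - d i)"
    proof -
      have "(\<Sum>x\<in>A. \<Sum>y\<in>A. B x y * h x * h y * (?\<phi> x - ?\<phi> y)\<^sup>2)
        = (\<Sum>x\<in>A. \<Sum>y\<in>A. B x y * h x * h y * (?\<phi> x)\<^sup>2) + (\<Sum>x\<in>A. \<Sum>y\<in>A. B x y * h x * h y * (?\<phi> y)\<^sup>2)
          - 2 * (\<Sum>x\<in>A. \<Sum>y\<in>A. B x y * h x * h y * (?\<phi> x * ?\<phi> y))"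
        by (simp only: power2_diff sum.distrib[symmetric] sum_subtractf[symmetric] sum_distrib_left)
           (intro sum.cong refl, simp add: algebra_simps)
      thus ?thesis unfolding diag diag' off one bg by simp
    qed
    have nonneg: "B x y * h x * h y * (?\<phi> x - ?\<phi> y)\<^sup>2 \<ge> 0" if "x \<in> A" "y \<in> A" for x y
      using offdiag[OF that] h[OF that(1)] h[OF that(2)] by (cases "x = y") auto
    have "(\<Sum>x\<in>A. \<Sum>y\<in>A. B x y * h x * h y * (?\<phi> x - ?\<phi> y)\<^sup>2) = 0"
      using d1 expand nonneg by (intro antisym sum_nonneg) auto
    hence zero: "B x y * h x * h y * (?\<phi> x - ?\<phi> y)\<^sup>2 = 0" if "x \<in> A" "y \<in> A" for x y
      using that nonneg finite_index
      by (simp add: sum_nonneg sum_nonneg_eq_0_iff)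
    have "\<exists>c. \<forall>x\<in>A. ?\<phi> x = c"
    proof (rule conn)
      fix x y assume "x \<in> A" "y \<in> A" "B x y > 0"
      thus "?\<phi> x = ?\<phi> y" using zero[of x y] h[of x] h[of y] by auto
    qed
    then obtain c where c: "\<And>x. x \<in> A \<Longrightarrow> ?\<phi> x = c" by blast
    have "ip A D f (q i) = ip A D f (\<lambda>x. c * h x)"
      using h by (intro ip_cong refl) (simp add: c[symmetric] less_imp_neq[symmetric])
    thus ?thesis using f by (simp add: ip_scale_right)
  qed (simp add: mult_nonpos_nonneg)
  thus ?thesis unfolding bil_expand[OF qd] by (intro sum_nonpos) auto
qed


section \<open>Maximal correlation\<close>

text \<open>For \<open>\<kappa> \<ge> 0\<close> this is maximal correlation at most
  \<open>\<kappa>\<close>: rescaling \<open>f\<close> and \<open>g\<close> turns the arithmetic mean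
  of the variances into the geometric one. The inequality is quadratic in the pair of functions and
  homogeneous in \<open>\<mu>\<close>, so slices of \<open>\<Omega>\<close> can be used without
  normalising them.\<close>

definition corr_le :: "'w set \<Rightarrow> ('w \<Rightarrow> real) \<Rightarrow> ('w \<Rightarrow> 's) \<Rightarrow> ('w \<Rightarrow> 's) \<Rightarrow> real \<Rightarrow> bool" where
  "corr_le \<Omega> \<mu> X Y \<kappa> \<longleftrightarrow> (\<forall>f g.
     (\<Sum>\<omega>\<in>\<Omega>. \<mu> \<omega> * f (X \<omega>)) = 0 \<longrightarrow> (\<Sum>\<omega>\<in>\<Omega>. \<mu> \<omega> * g (Y \<omega>)) = 0 \<longrightarrow>
     2 * (\<Sum>\<omega>\<in>\<Omega>. \<mu> \<omega> * f (X \<omega>) * g (Y \<omega>))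
       \<le> \<kappa> * ((\<Sum>\<omega>\<in>\<Omega>. \<mu> \<omega> * (f (X \<omega>))\<^sup>2) + (\<Sum>\<omega>\<in>\<Omega>. \<mu> \<omega> * (g (Y \<omega>))\<^sup>2)))"

text \<open>The quadratic form splits into that of the centred functions, which is nonpositive by
  the correlation bound, and that of the means.\<close>

lemma corr_le_uncentered:
  assumes "corr_le \<Omega> \<mu> X Y \<kappa>" "(\<Sum>\<omega>\<in>\<Omega>. \<mu> \<omega>) = P" "P > 0"
  defines "a \<equiv> \<lambda>f. \<Sum>\<omega>\<in>\<Omega>. \<mu> \<omega> * f \<omega>"
  shows "2 * a (\<lambda>\<omega>. f (X \<omega>) * g (Y \<omega>)) - \<kappa> * (a (\<lambda>\<omega>. (f (X \<omega>))\<^sup>2) + a (\<lambda>\<omega>. (g (Y \<omega>))\<^sup>2))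
    \<le> (2 * a (\<lambda>\<omega>. f (X \<omega>)) * a (\<lambda>\<omega>. g (Y \<omega>))
        - \<kappa> * ((a (\<lambda>\<omega>. f (X \<omega>)))\<^sup>2 + (a (\<lambda>\<omega>. g (Y \<omega>)))\<^sup>2)) / P"
proof -
  define F where "F = a (\<lambda>\<omega>. f (X \<omega>)) / P"
  define G where "G = a (\<lambda>\<omega>. g (Y \<omega>)) / P"
  have aF: "a (\<lambda>\<omega>. f (X \<omega>)) = P * F" and aG: "a (\<lambda>\<omega>. g (Y \<omega>)) = P * G"
    using assms(3) by (simp_all add: F_def G_def)
  have lin: "a (\<lambda>\<omega>. (u \<omega> - c) * (v \<omega> - c')) = a (\<lambda>\<omega>. u \<omega> * v \<omega>) - c' * a u - c * a v + c * c' * P" for u v c c'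
    unfolding a_def assms(2)[symmetric]
    by (simp add: algebra_simps sum.distrib sum_subtractf sum_distrib_left)
  have "a (\<lambda>\<omega>. f (X \<omega>) - F) = 0" "a (\<lambda>\<omega>. g (Y \<omega>) - G) = 0"
    using aF aG assms(2) by (simp_all add: a_def algebra_simps sum_subtractf flip: sum_distrib_left)
  hence "2 * a (\<lambda>\<omega>. (f (X \<omega>) - F) * (g (Y \<omega>) - G))
    \<le> \<kappa> * (a (\<lambda>\<omega>. (f (X \<omega>) - F)\<^sup>2) + a (\<lambda>\<omega>. (g (Y \<omega>) - G)\<^sup>2))"
    using assms(1)[unfolded corr_le_def, rule_format, of "\<lambda>x. f x - F" "\<lambda>x. g x - G"]
    by (simp add: a_def mult.assoc)
  hence "2 * a (\<lambda>\<omega>. f (X \<omega>) * g (Y \<omega>)) - \<kappa> * (a (\<lambda>\<omega>. (f (X \<omega>))\<^sup>2) + a (\<lambda>\<omega>. (g (Y \<omega>))\<^sup>2))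
    \<le> P * (2 * F * G - \<kappa> * (F\<^sup>2 + G\<^sup>2))"
    unfolding power2_eq_square lin aF aG by (simp add: algebra_simps)
  also have "\<dots> = (2 * (P * F) * (P * G) - \<kappa> * ((P * F)\<^sup>2 + (P * G)\<^sup>2)) / P"
    using assms(3) by (simp add: field_simps power2_eq_square)
  finally show ?thesis unfolding aF aG .
qed

lemma corr_le_mono:
  assumes "corr_le \<Omega> \<mu> X Y \<kappa>" "\<kappa> \<le> \<kappa>'" "\<And>\<omega>. \<omega> \<in> \<Omega> \<Longrightarrow> \<mu> \<omega> \<ge> 0"
  shows "corr_le \<Omega> \<mu> X Y \<kappa>'"
  unfolding corr_le_def
proof (intro allI impI)
  fix f g
  let ?S = "(\<Sum>\<omega>\<in>\<Omega>. \<mu> \<omega> * (f (X \<omega>))\<^sup>2) + (\<Sum>\<omega>\<in>\<Omega>. \<mu> \<omega> * (g (Y \<omega>))\<^sup>2)"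
  assume "(\<Sum>\<omega>\<in>\<Omega>. \<mu> \<omega> * f (X \<omega>)) = 0" "(\<Sum>\<omega>\<in>\<Omega>. \<mu> \<omega> * g (Y \<omega>)) = 0"
  hence "2 * (\<Sum>\<omega>\<in>\<Omega>. \<mu> \<omega> * f (X \<omega>) * g (Y \<omega>)) \<le> \<kappa> * ?S"
    using assms(1) by (auto simp: corr_le_def)
  also have "\<dots> \<le> \<kappa>' * ?S"
    using assms(2,3) by (intro mult_right_mono add_nonneg_nonneg sum_nonneg) auto
  finally show "2 * (\<Sum>\<omega>\<in>\<Omega>. \<mu> \<omega> * f (X \<omega>) * g (Y \<omega>)) \<le> \<kappa>' * ?S" .
qed

lemma corr_le_empty [simp]: "corr_le {} \<mu> X Y \<kappa>"
  by (simp add: corr_le_def)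

text \<open>At unit norms the arithmetic and the geometric mean coincide, so both functions are
  rescaled; if one norm is 0, both sides vanish.\<close>

lemma corr_le_cauchy_schwarz:
  assumes corr: "corr_le \<Omega> \<mu> X Y \<kappa>" and fin: "finite \<Omega>" and pos: "\<And>\<omega>. \<omega> \<in> \<Omega> \<Longrightarrow> \<mu> \<omega> > 0"
    and f: "(\<Sum>\<omega>\<in>\<Omega>. \<mu> \<omega> * f (X \<omega>)) = 0" and g: "(\<Sum>\<omega>\<in>\<Omega>. \<mu> \<omega> * g (Y \<omega>)) = 0"
  shows "(\<Sum>\<omega>\<in>\<Omega>. \<mu> \<omega> * f (X \<omega>) * g (Y \<omega>))
    \<le> \<kappa> * (sqrt (\<Sum>\<omega>\<in>\<Omega>. \<mu> \<omega> * (f (X \<omega>))\<^sup>2) * sqrt (\<Sum>\<omega>\<in>\<Omega>. \<mu> \<omega> * (g (Y \<omega>))\<^sup>2))"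
proof -
  define F G where "F = (\<Sum>\<omega>\<in>\<Omega>. \<mu> \<omega> * (f (X \<omega>))\<^sup>2)" and "G = (\<Sum>\<omega>\<in>\<Omega>. \<mu> \<omega> * (g (Y \<omega>))\<^sup>2)"
  have nn: "F \<ge> 0" "G \<ge> 0" unfolding F_def G_def using pos by (auto intro!: sum_nonneg simp: less_imp_le)
  have zero: "k (Z \<omega>) = 0" if "(\<Sum>\<omega>\<in>\<Omega>. \<mu> \<omega> * (k (Z \<omega>))\<^sup>2) = 0" "\<omega> \<in> \<Omega>" for k :: "'c \<Rightarrow> real" and Z \<omega>
  proof -
    have "\<forall>\<omega>\<in>\<Omega>. \<mu> \<omega> * (k (Z \<omega>))\<^sup>2 = 0"
      using that(1) pos fin by (subst (asm) sum_nonneg_eq_0_iff) (auto simp: less_imp_le)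
    thus ?thesis using pos[OF that(2)] that(2) by fastforce
  qed
  show ?thesis
  proof (cases "F = 0 \<or> G = 0")
    case True
    hence "f (X \<omega>) = 0 \<or> g (Y \<omega>) = 0" if "\<omega> \<in> \<Omega>" for \<omega>
      using zero[of f X \<omega>] zero[of g Y \<omega>] that unfolding F_def G_def by blast
    hence "(\<Sum>\<omega>\<in>\<Omega>. \<mu> \<omega> * f (X \<omega>) * g (Y \<omega>)) = 0"
      by (intro sum.neutral ballI) (metis mult_eq_0_iff)
    thus ?thesis using True unfolding F_def[symmetric] G_def[symmetric] by auto
  next
    case False
    hence p: "F > 0" "G > 0" using nn by auto
    define s t where "s = 1 / sqrt F" and "t = 1 / sqrt G"
    have st: "s\<^sup>2 * F = 1" "t\<^sup>2 * G = 1" "s > 0" "t > 0" using p by (simp_all add: s_def t_def power_divide)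
    have scale: "(\<Sum>\<omega>\<in>\<Omega>. \<mu> \<omega> * (c * k \<omega>)) = c * (\<Sum>\<omega>\<in>\<Omega>. \<mu> \<omega> * k \<omega>)" for c k
      by (simp add: sum_distrib_left algebra_simps)
    have "2 * (\<Sum>\<omega>\<in>\<Omega>. \<mu> \<omega> * (s * f (X \<omega>)) * (t * g (Y \<omega>)))
      \<le> \<kappa> * ((\<Sum>\<omega>\<in>\<Omega>. \<mu> \<omega> * (s * f (X \<omega>))\<^sup>2) + (\<Sum>\<omega>\<in>\<Omega>. \<mu> \<omega> * (t * g (Y \<omega>))\<^sup>2))"
      using corr[unfolded corr_le_def, rule_format, of "\<lambda>x. s * f x" "\<lambda>x. t * g x"] f g by (simp add: scale)
    also have "(\<Sum>\<omega>\<in>\<Omega>. \<mu> \<omega> * (s * f (X \<omega>)) * (t * g (Y \<omega>))) = s * t * (\<Sum>\<omega>\<in>\<Omega>. \<mu> \<omega> * f (X \<omega>) * g (Y \<omega>))"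
      by (simp add: sum_distrib_left algebra_simps)
    also have "(\<Sum>\<omega>\<in>\<Omega>. \<mu> \<omega> * (s * f (X \<omega>))\<^sup>2) + (\<Sum>\<omega>\<in>\<Omega>. \<mu> \<omega> * (t * g (Y \<omega>))\<^sup>2) = 2"
      using st unfolding power_mult_distrib scale F_def[symmetric] G_def[symmetric] by simp
    finally have "s * t * (\<Sum>\<omega>\<in>\<Omega>. \<mu> \<omega> * f (X \<omega>) * g (Y \<omega>)) \<le> \<kappa>" by simp
    thus ?thesis using p unfolding F_def[symmetric] G_def[symmetric]
      by (simp add: s_def t_def field_simps)
  qed
qed

text \<open>The common value, once centred, has correlation 1 with itself, so
  \<open>\<kappa> < 1\<close> forces its variance to be 0. This serves to transfer connectivity
  through sites outside a chosen triple.\<close>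

lemma corr_le_common_function_const:
  assumes corr: "corr_le \<Omega> \<mu> X Y \<kappa>" "\<kappa> < 1" and fin: "finite \<Omega>" and pos: "\<And>\<omega>. \<omega> \<in> \<Omega> \<Longrightarrow> \<mu> \<omega> > 0"
    and eq: "\<And>\<omega>. \<omega> \<in> \<Omega> \<Longrightarrow> f (X \<omega>) = g (Y \<omega>)"
  shows "\<exists>c :: real. \<forall>\<omega>\<in>\<Omega>. f (X \<omega>) = c"
proof (cases "\<Omega> = {}")
  case False
  define P where "P = (\<Sum>\<omega>\<in>\<Omega>. \<mu> \<omega>)"
  have P: "P > 0" unfolding P_def using fin False pos by (intro sum_pos) auto
  define c where "c = (\<Sum>\<omega>\<in>\<Omega>. \<mu> \<omega> * f (X \<omega>)) / P"
  define T where "T = (\<Sum>\<omega>\<in>\<Omega>. \<mu> \<omega> * (f (X \<omega>) - c)\<^sup>2)"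
  have "(\<Sum>\<omega>\<in>\<Omega>. \<mu> \<omega> * (f (X \<omega>) - c)) = (\<Sum>\<omega>\<in>\<Omega>. \<mu> \<omega> * f (X \<omega>)) - P * c"
    by (simp add: right_diff_distrib sum_subtractf P_def sum_distrib_right)
  hence f0: "(\<Sum>\<omega>\<in>\<Omega>. \<mu> \<omega> * (f (X \<omega>) - c)) = 0" using P by (simp add: c_def)
  have g0: "(\<Sum>\<omega>\<in>\<Omega>. \<mu> \<omega> * (g (Y \<omega>) - c)) = 0"
    unfolding f0[symmetric] by (intro sum.cong refl) (simp add: eq)
  have "2 * (\<Sum>\<omega>\<in>\<Omega>. \<mu> \<omega> * (f (X \<omega>) - c) * (g (Y \<omega>) - c))
    \<le> \<kappa> * ((\<Sum>\<omega>\<in>\<Omega>. \<mu> \<omega> * (f (X \<omega>) - c)\<^sup>2) + (\<Sum>\<omega>\<in>\<Omega>. \<mu> \<omega> * (g (Y \<omega>) - c)\<^sup>2))"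
    using corr(1)[unfolded corr_le_def, rule_format, OF f0 g0] .
  also have "(\<Sum>\<omega>\<in>\<Omega>. \<mu> \<omega> * (g (Y \<omega>) - c)\<^sup>2) = T" unfolding T_def by (intro sum.cong refl) (simp add: eq)
  also have "(\<Sum>\<omega>\<in>\<Omega>. \<mu> \<omega> * (f (X \<omega>) - c) * (g (Y \<omega>) - c)) = T"
    unfolding T_def by (intro sum.cong refl) (simp add: eq power2_eq_square)
  finally have "(1 - \<kappa>) * T \<le> 0" unfolding T_def[symmetric] by (simp add: algebra_simps)
  hence "T \<le> 0" using corr(2) by (simp add: mult_le_0_iff)
  moreover have nn: "\<mu> \<omega> * (f (X \<omega>) - c)\<^sup>2 \<ge> 0" if "\<omega> \<in> \<Omega>" for \<omega> using pos[OF that] by simp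
  hence "T \<ge> 0" unfolding T_def by (rule sum_nonneg)
  ultimately have "T = 0" by simp
  hence "\<forall>\<omega>\<in>\<Omega>. \<mu> \<omega> * (f (X \<omega>) - c)\<^sup>2 = 0"
    unfolding T_def using sum_nonneg_eq_0_iff[OF fin nn] by simp
  hence "\<forall>\<omega>\<in>\<Omega>. f (X \<omega>) = c" using pos by fastforce
  thus ?thesis by blast
qed simp


section \<open>Trickling down for three sites\<close>

text \<open>Reverse Cauchy-Schwarz for the form
  \<open>2 * x * y - \<kappa> * (x\<^sup>2 + y\<^sup>2)\<close>, which has one positive and one
  negative direction: \<open>Z\<close> is its value at \<open>(ku, kv)\<close>, and
  \<open>ev * x + eu * y\<close> is the polar pairing of \<open>(x, y)\<close> with
  \<open>(ku, kv)\<close>. The terms with \<open>f\<close> come from shifting \<open>(a, b)\<close>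
  by \<open>P * f\<close> times \<open>(nu, nv)\<close>.\<close>

lemma conditional_step:
  fixes a b P f \<kappa> \<kappa>u \<kappa>v nu nv eu ev ku kv Z dd :: real
  assumes "P > 0" "Z > 0" "0 \<le> \<kappa>" "\<kappa> < 1"
    and n: "nu = \<kappa>v + \<kappa> * nv" "nv = \<kappa>u + \<kappa> * nu"
    and k: "eu = ku - \<kappa> * kv" "ev = kv - \<kappa> * ku"
    and Z: "Z = ku * ev + kv * eu" and dd: "dd = eu * nv + ev * nu"
  shows "(2 * a * b - \<kappa> * (a\<^sup>2 + b\<^sup>2)) / P
    \<le> (ev * a + eu * b - dd * P * f)\<^sup>2 / (P * Z) + 2 * f * (\<kappa>u * a + \<kappa>v * b) - P * f\<^sup>2 * (nu * \<kappa>u + nv * \<kappa>v)"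
proof -
  define x y where "x = a - nu * P * f" and "y = b - nv * P * f"
  have \<kappa>uv: "\<kappa>v = nu - \<kappa> * nv" "\<kappa>u = nv - \<kappa> * nu" using n by simp_all
  have lin: "ev * a + eu * b - dd * P * f = ev * x + eu * y"
    by (simp add: x_def y_def dd algebra_simps)
  \<comment> \<open>The gap in the reverse inequality is \<open>1 - \<kappa>\<^sup>2\<close>, minus
    the determinant of the form, times the squared area spanned by \<open>(x, y)\<close> and
    \<open>(ku, kv)\<close>.\<close>
  have "(ev * x + eu * y)\<^sup>2 - (2 * x * y - \<kappa> * (x\<^sup>2 + y\<^sup>2)) * Z = (1 - \<kappa>\<^sup>2) * (x * kv - y * ku)\<^sup>2"
    unfolding Z k by (simp add: power2_eq_square algebra_simps)
  moreover have "(1 - \<kappa>\<^sup>2) * (x * kv - y * ku)\<^sup>2 \<ge> 0"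
    using assms by (simp add: abs_square_le_1)
  ultimately have "2 * x * y - \<kappa> * (x\<^sup>2 + y\<^sup>2) \<le> (ev * x + eu * y)\<^sup>2 / Z"
    using \<open>Z > 0\<close> by (simp add: field_simps)
  hence "(2 * x * y - \<kappa> * (x\<^sup>2 + y\<^sup>2)) / P \<le> (ev * x + eu * y)\<^sup>2 / Z / P"
    using \<open>P > 0\<close> by (intro divide_right_mono) auto
  hence "(2 * x * y - \<kappa> * (x\<^sup>2 + y\<^sup>2)) / P \<le> (ev * x + eu * y)\<^sup>2 / (P * Z)"
    by (simp add: mult.commute)
  moreover have "(2 * x * y - \<kappa> * (x\<^sup>2 + y\<^sup>2)) / P = (2 * a * b - \<kappa> * (a\<^sup>2 + b\<^sup>2)) / P
      - 2 * f * (\<kappa>u * a + \<kappa>v * b) + P * f\<^sup>2 * (nu * \<kappa>u + nv * \<kappa>v)"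
  proof -
    have "2 * x * y - \<kappa> * (x\<^sup>2 + y\<^sup>2) = (2 * a * b - \<kappa> * (a\<^sup>2 + b\<^sup>2))
      - P * (2 * f * (\<kappa>u * a + \<kappa>v * b)) + P * (P * f\<^sup>2 * (nu * \<kappa>u + nv * \<kappa>v))"
      unfolding x_def y_def \<kappa>uv by (simp add: power2_eq_square algebra_simps)
    thus ?thesis using \<open>P > 0\<close> by (simp add: field_simps)
  qed
  ultimately show ?thesis unfolding lin by simp
qed

text \<open>The sites are 0, 1 and 2, which add up to 3; for distinct indices the truncated
  subtraction loses nothing.\<close>

definition third :: "nat \<Rightarrow> nat \<Rightarrow> nat" where
  "third s u = 3 - s - u"

lemma third_numeral:
  "third 0 1 = 2" "third 1 2 = 0" "third 2 0 = 1" "third 1 0 = 2" "third 2 1 = 0" "third 0 2 = 1"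
  by (simp_all add: third_def)

lemma sum_lessThan_3: "(\<Sum>s<3. F s) = F 0 + F 1 + F (2::nat)" for F :: "nat \<Rightarrow> real"
  by (simp add: numeral_3_eq_3 numeral_2_eq_2)

lemma prod_lessThan_3: "(\<Prod>s<3. F s) = F 0 * F 1 * F (2::nat)" for F :: "nat \<Rightarrow> real"
  by (simp add: numeral_3_eq_3 numeral_2_eq_2)

lemma third_commute: "third s u = third u s"
  by (simp add: third_def)

lemma third_props:
  assumes "s < 3" "u < 3" "s \<noteq> u"
  shows "third s u < 3" "third s u \<noteq> s" "third s u \<noteq> u" "{..<3} = {s, u, third s u}"
    "third s (third s u) = u" "third u (third s u) = s" "third (third s u) s = u" "third (third s u) u = s"
proof -
  have s: "s = 0 \<or> s = 1 \<or> s = 2" and u: "u = 0 \<or> u = 1 \<or> u = 2" using assms by auto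
  show "third s u < 3" "third s u \<noteq> s" "third s u \<noteq> u" "{..<3} = {s, u, third s u}"
    "third s (third s u) = u" "third u (third s u) = s" "third (third s u) s = u" "third (third s u) u = s"
    using s u assms(3) by (elim disjE; auto simp: third_def)+
qed

text \<open>Both \<open>\<kappa>\<close> and the weights \<open>e\<close> below carry the index of the site opposite to the pair they
  belong to: \<open>\<kappa> s\<close> bounds the correlation of the two sites other than \<open>s\<close> once \<open>s\<close> is pinned.\<close>

locale three_sites =
  fixes \<Omega> :: "'w set" and \<mu> :: "'w \<Rightarrow> real" and X :: "nat \<Rightarrow> 'w \<Rightarrow> 's" and \<kappa> :: "nat \<Rightarrow> real"
  assumes finite_\<Omega>: "finite \<Omega>"
    and \<mu>_pos: "\<And>\<omega>. \<omega> \<in> \<Omega> \<Longrightarrow> \<mu> \<omega> > 0"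
    and \<kappa>_nonneg: "\<And>s. s < 3 \<Longrightarrow> 0 \<le> \<kappa> s"
    and \<kappa>_less_1: "\<And>s. s < 3 \<Longrightarrow> \<kappa> s < 1"
    and \<kappa>_det: "(\<kappa> 0)\<^sup>2 + (\<kappa> 1)\<^sup>2 + (\<kappa> 2)\<^sup>2 + 2 * \<kappa> 0 * \<kappa> 1 * \<kappa> 2 < 1"
    and conditional: "\<And>s u x. s < 3 \<Longrightarrow> u < 3 \<Longrightarrow> s \<noteq> u \<Longrightarrow>
      corr_le {\<omega> \<in> \<Omega>. X s \<omega> = x} \<mu> (X u) (X (third s u)) (\<kappa> s)"
    and connected: "\<And>\<phi> :: nat \<Rightarrow> 's \<Rightarrow> real.
      (\<And>\<omega> s t. \<omega> \<in> \<Omega> \<Longrightarrow> s < 3 \<Longrightarrow> t < 3 \<Longrightarrow> \<phi> s (X s \<omega>) = \<phi> t (X t \<omega>)) \<Longrightarrow>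
      \<exists>c. \<forall>\<omega>\<in>\<Omega>. \<phi> 0 (X 0 \<omega>) = c"
begin

text \<open>The probability of reaching \<open>s\<close> from \<open>u\<close> for the killed walk on three sites that moves
  between two sites with probability \<open>\<kappa>\<close> of the opposite site.\<close>

definition hit :: "nat \<Rightarrow> nat \<Rightarrow> real" where
  "hit s u = (\<kappa> (third s u) + \<kappa> s * \<kappa> u) / (1 - (\<kappa> s)\<^sup>2)"

lemma \<kappa>_sq_less_1: "s < 3 \<Longrightarrow> (\<kappa> s)\<^sup>2 < 1"
  using \<kappa>_nonneg \<kappa>_less_1 by (simp add: abs_square_less_1)

lemma hit_rec:
  assumes "s < 3" "u < 3" "s \<noteq> u"
  shows "hit s u = \<kappa> (third s u) + \<kappa> s * hit s (third s u)"
proof -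
  have "1 - (\<kappa> s)\<^sup>2 \<noteq> 0" using \<kappa>_sq_less_1 assms(1) by fastforce
  moreover have "third s (third s u) = u" using third_props[OF assms] by simp
  ultimately show ?thesis unfolding hit_def by (simp add: field_simps power2_eq_square)
qed

lemma hit_nonneg: "s < 3 \<Longrightarrow> u < 3 \<Longrightarrow> s \<noteq> u \<Longrightarrow> 0 \<le> hit s u"
  unfolding hit_def using \<kappa>_sq_less_1[of s] \<kappa>_nonneg third_props(1)[of s u]
  by (intro divide_nonneg_pos add_nonneg_nonneg mult_nonneg_nonneg) auto

context
  fixes e :: "nat \<Rightarrow> real"
  assumes e_pos: "\<And>s. s < 3 \<Longrightarrow> e s > 0"
begin

definition det where "det = 1 - (\<kappa> 0)\<^sup>2 - (\<kappa> 1)\<^sup>2 - (\<kappa> 2)\<^sup>2 - 2 * \<kappa> 0 * \<kappa> 1 * \<kappa> 2"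

text \<open>Cramer's rule for \<open>height_eq\<close>: \<open>e\<close> is the image of \<open>height\<close> under the identity minus the
  transition matrix of that walk.\<close>

definition height :: "nat \<Rightarrow> real" where
  "height s = ((1 - (\<kappa> s)\<^sup>2) * e s + (\<Sum>u\<in>{..<3}-{s}. (\<kappa> (third s u) + \<kappa> s * \<kappa> u) * e u)) / det"

lemma det_pos: "det > 0" using \<kappa>_det by (simp add: det_def)

lemma sum_other:
  assumes "s < 3" "u < 3" "s \<noteq> u"
  shows "(\<Sum>t\<in>{..<3}-{s}. F t) = F u + F (third s u)"
proof -
  have "{..<3} - {s} = {u, third s u}" using third_props[OF assms] assms by auto
  thus ?thesis using third_props[OF assms] by simp
qed

lemma height_pos:
  assumes "s < 3" shows "height s > 0"
proof -
  have "0 \<le> (\<Sum>u\<in>{..<3}-{s}. (\<kappa> (third s u) + \<kappa> s * \<kappa> u) * e u)"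
    using assms \<kappa>_nonneg e_pos third_props(1)[of s]
    by (intro sum_nonneg mult_nonneg_nonneg add_nonneg_nonneg) (auto simp: less_imp_le)
  moreover have "(1 - (\<kappa> s)\<^sup>2) * e s > 0" using assms \<kappa>_sq_less_1 e_pos by simp
  ultimately show ?thesis unfolding height_def using det_pos by (intro divide_pos_pos) auto
qed

lemma height_eq:
  assumes "s < 3" "u < 3" "s \<noteq> u"
  shows "e s = height s - \<kappa> (third s u) * height u - \<kappa> u * height (third s u)"
proof -
  define v where "v = third s u"
  have uv: "v < 3" "v \<noteq> s" "v \<noteq> u" using third_props[OF assms] by (auto simp: v_def)
  have o: "third s v = u" "third u v = s" "third v u = s" "third u s = v" "third v s = u"
    unfolding v_def using third_props(5-8)[OF assms(1-3)] third_commute[of u s] by blast+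
  have dt: "det = 1 - (\<kappa> s)\<^sup>2 - (\<kappa> u)\<^sup>2 - (\<kappa> v)\<^sup>2 - 2 * \<kappa> s * \<kappa> u * \<kappa> v"
  proof -
    have "det = 1 - (\<Sum>t<3. (\<kappa> t)\<^sup>2) - 2 * (\<Prod>t<3. \<kappa> t)"
      by (simp add: det_def sum_lessThan_3 prod_lessThan_3)
    thus ?thesis unfolding third_props(4)[OF assms, folded v_def] using assms(3) uv by simp
  qed
  have hs: "det * height s = (1 - (\<kappa> s)\<^sup>2) * e s + (\<kappa> v + \<kappa> s * \<kappa> u) * e u + (\<kappa> u + \<kappa> s * \<kappa> v) * e v"
    using det_pos unfolding height_def sum_other[OF assms] by (simp add: v_def[symmetric] o)
  have hu: "det * height u = (1 - (\<kappa> u)\<^sup>2) * e u + (\<kappa> v + \<kappa> u * \<kappa> s) * e s + (\<kappa> s + \<kappa> u * \<kappa> v) * e v"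
    using det_pos unfolding height_def sum_other[OF assms(2,1) assms(3)[symmetric]] by (simp add: o)
  have hv: "det * height v = (1 - (\<kappa> v)\<^sup>2) * e v + (\<kappa> u + \<kappa> v * \<kappa> s) * e s + (\<kappa> s + \<kappa> v * \<kappa> u) * e u"
    using det_pos unfolding height_def sum_other[OF uv(1) assms(1) uv(2)] by (simp add: o)
  have "det * (height s - \<kappa> v * height u - \<kappa> u * height v)
      = det * height s - \<kappa> v * (det * height u) - \<kappa> u * (det * height v)" by (simp add: algebra_simps)
  also have "\<dots> = det * e s" unfolding hs hu hv by (simp add: dt power2_eq_square algebra_simps)
  finally show ?thesis using det_pos by (simp add: v_def)
qed

section \<open>The pencil of a three-site system\<close>

definition mass :: "nat \<Rightarrow> 's \<Rightarrow> real" where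
  "mass s x = (\<Sum>\<omega> | \<omega> \<in> \<Omega> \<and> X s \<omega> = x. \<mu> \<omega>)"

definition dd :: "nat \<Rightarrow> real" where
  "dd s = (\<Sum>u\<in>{..<3}-{s}. e u * hit s (third s u))"

definition Z :: "nat \<Rightarrow> real" where
  "Z s = (\<Sum>u\<in>{..<3}-{s}. (height u - hit s u * height s) * e (third s u))"

definition I :: "(nat \<times> 's) set" where "I = (SIGMA s:{..<3}. X s ` \<Omega>)"

text \<open>\<open>Q\<close> is the Hessian at \<open>height\<close> of the cubic polynomial whose derivative in the direction of a spin
  \<open>x\<close> of \<open>s\<close> is the conditional quadratic form \<open>2 E(g\<^sub>u g\<^sub>v | x) - \<kappa>\<^sub>s E(g\<^sub>u\<^sup>2 + g\<^sub>v\<^sup>2 | x)\<close>, evaluated at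
  \<open>g\<^sub>t = f\<^sub>t - hit s t * f\<^sub>s(x)\<close>. With \<open>D\<close> chosen so that \<open>height\<close> is an eigenvector of the pencil for
  the eigenvalue 1, the reverse Cauchy-Schwarz inequality for these forms gives the hypothesis of
  \<open>bochner\<close>.\<close>

fun Q :: "nat \<times> 's \<Rightarrow> nat \<times> 's \<Rightarrow> real" where
  "Q (s, x) (t, y) = (if s = t then (if x = y then - dd s * mass s x else 0)
     else e (third s t) * (\<Sum>\<omega> | \<omega> \<in> \<Omega> \<and> X s \<omega> = x \<and> X t \<omega> = y. \<mu> \<omega>))"

fun D :: "nat \<times> 's \<Rightarrow> real" where
  "D (s, x) = mass s x * Z s / height s"

lemma mass_pos: "x \<in> X s ` \<Omega> \<Longrightarrow> mass s x > 0"
  unfolding mass_def using finite_\<Omega> \<mu>_pos by (intro sum_pos) auto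

text \<open>Splitting walks from \<open>u\<close> at their first visit to \<open>s\<close> leaves
  \<open>height u - hit s u * height s\<close> as the part collected before \<open>s\<close>. It is
  the height for the walk on the other two sites with \<open>s\<close> pinned: it solves their
  two-by-two system with source \<open>e\<close>, hence is positive.\<close>

lemma pinned_height:
  assumes "s < 3" "u < 3" "s \<noteq> u"
  defines "v \<equiv> third s u"
  shows "e u = (height u - hit s u * height s) - \<kappa> s * (height v - hit s v * height s)"
    and "height u - hit s u * height s > 0"
proof -
  have uv: "v < 3" "v \<noteq> s" "v \<noteq> u" using third_props[OF assms(1-3)] by (auto simp: v_def)
  have o: "third s v = u" "third u v = s" "third v u = s" "third u s = v" "third v s = u"
    unfolding v_def using third_props(5-8)[OF assms(1-3)] third_commute[of u s] by blast+
  have *: "e u = (height u - hit s u * height s) - \<kappa> s * (height v - hit s v * height s)"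
    using height_eq[OF assms(2,1) assms(3)[symmetric]] hit_rec[OF assms(1-3)] unfolding o v_def[symmetric]
    by (simp add: algebra_simps)
  have **: "e v = (height v - hit s v * height s) - \<kappa> s * (height u - hit s u * height s)"
    using height_eq[OF uv(1) assms(1) uv(2)] hit_rec[OF assms(1) uv(1) uv(2)[symmetric]] unfolding o
    by (simp add: algebra_simps)
  have "e u + \<kappa> s * e v = (1 - (\<kappa> s)\<^sup>2) * (height u - hit s u * height s)"
    unfolding * ** by (simp add: algebra_simps power2_eq_square)
  moreover have "e u + \<kappa> s * e v > 0" using e_pos assms uv \<kappa>_nonneg by (intro add_pos_nonneg) (auto simp: less_imp_le)
  ultimately show "height u - hit s u * height s > 0" using \<kappa>_sq_less_1[OF assms(1)]
    by (metis diff_gt_0_iff_gt zero_less_mult_pos)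
  show "e u = (height u - hit s u * height s) - \<kappa> s * (height v - hit s v * height s)" by fact
qed

lemma Z_pos: "s < 3 \<Longrightarrow> Z s > 0"
proof -
  assume s: "s < 3"
  have "{..<3} - {s} \<noteq> {}"
  proof -
    have "(if s = 0 then 1 else 0) \<in> {..<3} - {s}" by auto
    thus ?thesis by blast
  qed
  thus ?thesis unfolding Z_def using s pinned_height(2)[OF s] third_props(1)[OF s] e_pos
    by (intro sum_pos mult_pos_pos) auto
qed

lemma sum_image: "(\<Sum>x\<in>X s ` \<Omega>. \<Sum>\<omega> | \<omega> \<in> \<Omega> \<and> X s \<omega> = x. F \<omega>) = (\<Sum>\<omega>\<in>\<Omega>. F \<omega>)" for F :: "'w \<Rightarrow> real"
  using sum.image_gen[OF finite_\<Omega>, of F "X s"] by simp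

lemma sum_I: "(\<Sum>i\<in>I. F i) = (\<Sum>s<3. \<Sum>x\<in>X s ` \<Omega>. F (s, x))" for F :: "nat \<times> 's \<Rightarrow> real"
  unfolding I_def using finite_\<Omega> by (subst sum.Sigma) auto

text \<open>The conditional expectation given \<open>X s = x\<close> times \<open>mass s x\<close>;
  the division is postponed.\<close>

definition cond :: "nat \<Rightarrow> 's \<Rightarrow> (nat \<times> 's \<Rightarrow> real) \<Rightarrow> nat \<Rightarrow> real" where
  "cond s x f t = (\<Sum>\<omega> | \<omega> \<in> \<Omega> \<and> X s \<omega> = x. \<mu> \<omega> * f (t, X t \<omega>))"

definition inn :: "(nat \<times> 's \<Rightarrow> real) \<Rightarrow> nat \<Rightarrow> nat \<Rightarrow> real" where
  "inn f s t = (\<Sum>\<omega>\<in>\<Omega>. \<mu> \<omega> * (f (s, X s \<omega>) * f (t, X t \<omega>)))"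

lemma inn_commute: "inn f s t = inn f t s" by (simp add: inn_def mult.commute)

lemma Q_apply:
  assumes "s < 3" "u < 3" "s \<noteq> u" "x \<in> X s ` \<Omega>"
  defines "v \<equiv> third s u"
  shows "(\<Sum>j\<in>I. Q (s, x) j * f j) = e v * cond s x f u + e u * cond s x f v - dd s * mass s x * f (s, x)"
proof -
  have uv: "v < 3" "v \<noteq> s" "v \<noteq> u" using third_props[OF assms(1-3)] by (auto simp: v_def)
  have o: "third s v = u" "third s u = v" using third_props[OF assms(1-3)] by (auto simp: v_def)
  have off: "(\<Sum>y\<in>X t ` \<Omega>. Q (s, x) (t, y) * f (t, y)) = e (third s t) * cond s x f t" if "t \<noteq> s" for t
  proof -
    have "(\<Sum>y\<in>X t ` \<Omega>. Q (s, x) (t, y) * f (t, y))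
      = e (third s t) * (\<Sum>y\<in>X t ` \<Omega>. \<Sum>\<omega> | \<omega> \<in> \<Omega> \<and> X t \<omega> = y. if X s \<omega> = x then \<mu> \<omega> * f (t, X t \<omega>) else 0)"
      unfolding sum_distrib_left
    proof (intro sum.cong refl)
      fix y assume "y \<in> X t ` \<Omega>"
      have "(\<Sum>\<omega> | \<omega> \<in> \<Omega> \<and> X s \<omega> = x \<and> X t \<omega> = y. \<mu> \<omega>) * f (t, y)
        = (\<Sum>\<omega> | \<omega> \<in> \<Omega> \<and> X t \<omega> = y. if X s \<omega> = x then \<mu> \<omega> * f (t, X t \<omega>) else 0)"
        unfolding sum_distrib_right using finite_\<Omega>
        by (intro sum.mono_neutral_cong_left) auto
      thus "Q (s, x) (t, y) * f (t, y) = (\<Sum>\<omega> | \<omega> \<in> \<Omega> \<and> X t \<omega> = y. e (third s t) * (if X s \<omega> = x then \<mu> \<omega> * f (t, X t \<omega>) else 0))"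
        using that by (simp add: mult.assoc sum_distrib_left[symmetric])
    qed
    also have "(\<Sum>y\<in>X t ` \<Omega>. \<Sum>\<omega> | \<omega> \<in> \<Omega> \<and> X t \<omega> = y. if X s \<omega> = x then \<mu> \<omega> * f (t, X t \<omega>) else 0) = cond s x f t"
      unfolding sum_image cond_def using finite_\<Omega> by (simp add: sum.inter_filter)
    finally show ?thesis .
  qed
  have diag: "(\<Sum>y\<in>X s ` \<Omega>. Q (s, x) (s, y) * f (s, y)) = - dd s * mass s x * f (s, x)"
    using finite_\<Omega> assms(4) by (simp add: if_distrib[of "\<lambda>t. t * _"] cong: if_cong)
  have "(\<Sum>j\<in>I. Q (s, x) j * f j) = (\<Sum>t\<in>{..<3}. \<Sum>y\<in>X t ` \<Omega>. Q (s, x) (t, y) * f (t, y))"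
    by (rule sum_I)
  also have "\<dots> = (\<Sum>y\<in>X s ` \<Omega>. Q (s, x) (s, y) * f (s, y)) + (\<Sum>y\<in>X u ` \<Omega>. Q (s, x) (u, y) * f (u, y))
      + (\<Sum>y\<in>X v ` \<Omega>. Q (s, x) (v, y) * f (v, y))"
    unfolding third_props(4)[OF assms(1-3), folded v_def] using uv assms(3) by simp
  also have "\<dots> = e v * cond s x f u + e u * cond s x f v - dd s * mass s x * f (s, x)"
    using off[of u] off[of v] diag uv assms(3) by (simp add: o)
  finally show ?thesis .
qed

lemma sum_cond: "(\<Sum>x\<in>X s ` \<Omega>. f (s, x) * cond s x f t) = inn f s t"
proof -
  have "(\<Sum>x\<in>X s ` \<Omega>. f (s, x) * cond s x f t)
    = (\<Sum>x\<in>X s ` \<Omega>. \<Sum>\<omega> | \<omega> \<in> \<Omega> \<and> X s \<omega> = x. \<mu> \<omega> * (f (s, X s \<omega>) * f (t, X t \<omega>)))"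
    unfolding cond_def sum_distrib_left by (intro sum.cong refl) auto
  thus ?thesis unfolding sum_image inn_def .
qed

lemma sum_mass: "(\<Sum>x\<in>X s ` \<Omega>. mass s x * (f (s, x))\<^sup>2) = inn f s s"
proof -
  have "(\<Sum>x\<in>X s ` \<Omega>. mass s x * (f (s, x))\<^sup>2)
    = (\<Sum>x\<in>X s ` \<Omega>. \<Sum>\<omega> | \<omega> \<in> \<Omega> \<and> X s \<omega> = x. \<mu> \<omega> * (f (s, X s \<omega>) * f (s, X s \<omega>)))"
    unfolding mass_def sum_distrib_right by (intro sum.cong refl) (auto simp: power2_eq_square)
  thus ?thesis unfolding sum_image inn_def .
qed

lemma dd_eq:
  assumes "s < 3" "u < 3" "s \<noteq> u"
  shows "dd s = e u * hit s (third s u) + e (third s u) * hit s u"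
  unfolding dd_def sum_other[OF assms] third_props(5)[OF assms] ..

lemma Z_eq:
  assumes "s < 3" "u < 3" "s \<noteq> u"
  shows "Z s = (height u - hit s u * height s) * e (third s u)
    + (height (third s u) - hit s (third s u) * height s) * e u"
  unfolding Z_def sum_other[OF assms] third_props(5)[OF assms] ..

text \<open>Given \<open>X s = x\<close>, the correlation bound discards the fluctuations of the
  other two sites. Their conditional means remain, and \<open>conditional_step\<close> applies to
  them with the hitting probabilities of \<open>s\<close> as shift and the pinned heights as
  reference vector. The linear form squared there is exactly the entry of \<open>Q f\<close> at
  \<open>(s, x)\<close>, which explains the diagonal of \<open>Q\<close>.\<close>

lemma site_step:
  assumes "s < 3" "u < 3" "s \<noteq> u"
  defines "v \<equiv> third s u"
  shows "2 * inn f u v - \<kappa> s * (inn f u u + inn f v v)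
    \<le> (\<Sum>x\<in>X s ` \<Omega>. (\<Sum>j\<in>I. Q (s, x) j * f j)\<^sup>2 / (mass s x * Z s))
      + 2 * (\<kappa> u * inn f s u + \<kappa> v * inn f s v) - inn f s s * (hit s u * \<kappa> u + hit s v * \<kappa> v)"
proof -
  have uv: "v < 3" "v \<noteq> s" "v \<noteq> u" using third_props[OF assms(1-3)] by (auto simp: v_def)
  have o: "third s v = u" "third s u = v" using third_props[OF assms(1-3)] by (auto simp: v_def)
  let ?S = "\<lambda>x F. \<Sum>\<omega> | \<omega> \<in> \<Omega> \<and> X s \<omega> = x. \<mu> \<omega> * F \<omega>"
  let ?a = "\<lambda>x. cond s x f u" and ?b = "\<lambda>x. cond s x f v"
  have pointwise: "2 * ?S x (\<lambda>\<omega>. f (u, X u \<omega>) * f (v, X v \<omega>)) - \<kappa> s * (?S x (\<lambda>\<omega>. (f (u, X u \<omega>))\<^sup>2) + ?S x (\<lambda>\<omega>. (f (v, X v \<omega>))\<^sup>2))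
    \<le> (\<Sum>j\<in>I. Q (s, x) j * f j)\<^sup>2 / (mass s x * Z s) + 2 * f (s, x) * (\<kappa> u * ?a x + \<kappa> v * ?b x)
      - mass s x * (f (s, x))\<^sup>2 * (hit s u * \<kappa> u + hit s v * \<kappa> v)" if x: "x \<in> X s ` \<Omega>" for x
  proof -
    have "2 * ?S x (\<lambda>\<omega>. f (u, X u \<omega>) * f (v, X v \<omega>)) - \<kappa> s * (?S x (\<lambda>\<omega>. (f (u, X u \<omega>))\<^sup>2) + ?S x (\<lambda>\<omega>. (f (v, X v \<omega>))\<^sup>2))
      \<le> (2 * ?a x * ?b x - \<kappa> s * ((?a x)\<^sup>2 + (?b x)\<^sup>2)) / mass s x"
      unfolding cond_def
      by (rule corr_le_uncentered[where f = "\<lambda>z. f (u, z)" and g = "\<lambda>z. f (v, z)"])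
        (use conditional[OF assms(1-3)] mass_pos[OF x] in \<open>auto simp: mass_def v_def\<close>)
    also have "\<dots> \<le> (e v * ?a x + e u * ?b x - dd s * mass s x * f (s, x))\<^sup>2 / (mass s x * Z s)
      + 2 * f (s, x) * (\<kappa> u * ?a x + \<kappa> v * ?b x)
      - mass s x * (f (s, x))\<^sup>2 * (hit s u * \<kappa> u + hit s v * \<kappa> v)"
    proof (rule conditional_step)
      show "mass s x > 0" "Z s > 0" "0 \<le> \<kappa> s" "\<kappa> s < 1"
        using mass_pos[OF x] Z_pos \<kappa>_nonneg \<kappa>_less_1 assms(1) by auto
      show "hit s u = \<kappa> v + \<kappa> s * hit s v" using hit_rec[OF assms(1-3)] by (simp add: o)
      show "hit s v = \<kappa> u + \<kappa> s * hit s u" using hit_rec[OF assms(1) uv(1) uv(2)[symmetric]] by (simp add: o)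
      show "e u = (height u - hit s u * height s) - \<kappa> s * (height v - hit s v * height s)"
        using pinned_height(1)[OF assms(1-3)] by (simp add: o)
      show "e v = (height v - hit s v * height s) - \<kappa> s * (height u - hit s u * height s)"
        using pinned_height(1)[OF assms(1) uv(1) uv(2)[symmetric]] by (simp add: o)
      show "Z s = (height u - hit s u * height s) * e v + (height v - hit s v * height s) * e u"
        using Z_eq[OF assms(1-3)] by (simp add: o)
      show "dd s = e u * hit s v + e v * hit s u" using dd_eq[OF assms(1-3)] by (simp add: o)
    qed
    finally show ?thesis unfolding Q_apply[OF assms(1-3) x] o .
  qed
  have S: "(\<Sum>x\<in>X s ` \<Omega>. ?S x F) = (\<Sum>\<omega>\<in>\<Omega>. \<mu> \<omega> * F \<omega>)" for F by (rule sum_image)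
  have "2 * inn f u v - \<kappa> s * (inn f u u + inn f v v) = (\<Sum>x\<in>X s ` \<Omega>.
      2 * ?S x (\<lambda>\<omega>. f (u, X u \<omega>) * f (v, X v \<omega>)) - \<kappa> s * (?S x (\<lambda>\<omega>. (f (u, X u \<omega>))\<^sup>2) + ?S x (\<lambda>\<omega>. (f (v, X v \<omega>))\<^sup>2)))"
    unfolding sum_subtractf sum.distrib sum_distrib_left[symmetric] S
    by (simp add: inn_def power2_eq_square)
  also have "\<dots> \<le> (\<Sum>x\<in>X s ` \<Omega>. (\<Sum>j\<in>I. Q (s, x) j * f j)\<^sup>2 / (mass s x * Z s) + 2 * f (s, x) * (\<kappa> u * ?a x + \<kappa> v * ?b x)
      - mass s x * (f (s, x))\<^sup>2 * (hit s u * \<kappa> u + hit s v * \<kappa> v))"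
    by (rule sum_mono) (rule pointwise)
  also have "\<dots> = (\<Sum>x\<in>X s ` \<Omega>. (\<Sum>j\<in>I. Q (s, x) j * f j)\<^sup>2 / (mass s x * Z s))
    + 2 * (\<kappa> u * (\<Sum>x\<in>X s ` \<Omega>. f (s, x) * ?a x) + \<kappa> v * (\<Sum>x\<in>X s ` \<Omega>. f (s, x) * ?b x))
    - (\<Sum>x\<in>X s ` \<Omega>. mass s x * (f (s, x))\<^sup>2) * (hit s u * \<kappa> u + hit s v * \<kappa> v)"
    by (simp add: sum_subtractf sum.distrib sum_distrib_left sum_distrib_right algebra_simps)
  finally show ?thesis unfolding sum_cond sum_mass .
qed

lemma bil_Q: "bil I Q f f = 2 * (e 2 * inn f 0 1 + e 0 * inn f 1 2 + e 1 * inn f 0 2)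
  - (dd 0 * inn f 0 0 + dd 1 * inn f 1 1 + dd 2 * inn f 2 2)"
proof -
  have site: "(\<Sum>x\<in>X s ` \<Omega>. f (s, x) * (\<Sum>j\<in>I. Q (s, x) j * f j))
      = e (third s u) * inn f s u + e u * inn f s (third s u) - dd s * inn f s s"
    if su: "s < 3" "u < 3" "s \<noteq> u" for s u
  proof -
    have "(\<Sum>x\<in>X s ` \<Omega>. f (s, x) * (\<Sum>j\<in>I. Q (s, x) j * f j)) = (\<Sum>x\<in>X s ` \<Omega>. f (s, x) *
      (e (third s u) * cond s x f u + e u * cond s x f (third s u) - dd s * mass s x * f (s, x)))"
      by (intro sum.cong refl arg_cong[where f = "\<lambda>t. _ * t"] Q_apply[OF su])
    also have "\<dots> = e (third s u) * (\<Sum>x\<in>X s ` \<Omega>. f (s, x) * cond s x f u) + e u * (\<Sum>x\<in>X s ` \<Omega>. f (s, x) * cond s x f (third s u))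
       - dd s * (\<Sum>x\<in>X s ` \<Omega>. mass s x * (f (s, x))\<^sup>2)"
      by (simp add: sum_distrib_left sum.distrib sum_subtractf algebra_simps power2_eq_square)
    finally show ?thesis unfolding sum_cond sum_mass .
  qed
  have "bil I Q f f = (\<Sum>i\<in>I. f i * (\<Sum>j\<in>I. Q i j * f j))"
    by (simp add: bil_def sum_distrib_left algebra_simps)
  also have "\<dots> = (\<Sum>s<3. \<Sum>x\<in>X s ` \<Omega>. f (s, x) * (\<Sum>j\<in>I. Q (s, x) j * f j))" by (rule sum_I)
  also have "\<dots> = (e 2 * inn f 0 1 + e 1 * inn f 0 2 - dd 0 * inn f 0 0)
     + (e 0 * inn f 1 2 + e 2 * inn f 1 0 - dd 1 * inn f 1 1)
     + (e 1 * inn f 2 0 + e 0 * inn f 2 1 - dd 2 * inn f 2 2)"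
    using site[of 0 1] site[of 1 2] site[of 2 0] by (simp add: sum_lessThan_3 third_numeral third_numeral[unfolded One_nat_def])
  finally show ?thesis using inn_commute[of f 1 0] inn_commute[of f 2 0] inn_commute[of f 2 1]
    by (simp add: algebra_simps)
qed

lemma weighted_bound:
  assumes mean: "(\<Sum>\<omega>\<in>\<Omega>. \<mu> \<omega> * f0 (X 0 \<omega>)) = 0" "(\<Sum>\<omega>\<in>\<Omega>. \<mu> \<omega> * f1 (X 1 \<omega>)) = 0"
  shows "2 * e 2 * (\<Sum>\<omega>\<in>\<Omega>. \<mu> \<omega> * f0 (X 0 \<omega>) * f1 (X 1 \<omega>))
    \<le> dd 0 * (\<Sum>\<omega>\<in>\<Omega>. \<mu> \<omega> * (f0 (X 0 \<omega>))\<^sup>2) + dd 1 * (\<Sum>\<omega>\<in>\<Omega>. \<mu> \<omega> * (f1 (X 1 \<omega>))\<^sup>2)"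
proof -
  interpret symmetric_pencil I D Q
  proof
    show "finite I" unfolding I_def using finite_\<Omega> by auto
    show "D i > 0" if "i \<in> I" for i
      using that mass_pos Z_pos height_pos by (cases i) (auto simp: I_def)
    fix i j assume "i \<in> I" "j \<in> I"
    show "Q i j = Q j i"
      by (cases i; cases j) (auto simp: third_commute intro!: arg_cong[where f = "(*) _"] sum.cong)
  qed
  \<comment> \<open>The test function is 0 on site 2, so of the three cross terms of
    \<open>Q\<close> only the one with weight \<open>e 2\<close> survives.\<close>
  define F :: "nat \<times> 's \<Rightarrow> real"
    where "F = (\<lambda>(s, x). if s = 0 then f0 x else if s = 1 then f1 x else 0)"
  define H :: "nat \<times> 's \<Rightarrow> real" where "H = (\<lambda>(s, x). height s)"
  have other: "(if s = 0 then 1 else 0) < (3::nat)" "s \<noteq> (if s = 0 then 1 else 0)" for s :: nat by auto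
  have "bil I Q F F \<le> 0"
  proof (rule bochner[where h = H])
    show "H i > 0" if "i \<in> I" for i using that height_pos by (auto simp: H_def I_def)
    show "(\<Sum>j\<in>I. Q i j * H j) = D i * H i" if i: "i \<in> I" for i
    proof -
      obtain s x where sx: "i = (s, x)" "s < 3" "x \<in> X s ` \<Omega>" using i by (auto simp: I_def)
      define u where "u = (if s = 0 then 1 else (0::nat))"
      have su: "s < 3" "u < 3" "s \<noteq> u" using sx(2) other[of s] by (simp_all add: u_def)
      have c: "cond s x H t = mass s x * height t" for t
        by (simp add: cond_def H_def mass_def sum_distrib_right)
      have "(\<Sum>j\<in>I. Q (s, x) j * H j) = mass s x * Z s"
        unfolding Q_apply[OF su sx(3)] c dd_eq[OF su] Z_eq[OF su] by (simp add: H_def algebra_simps)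
      thus ?thesis using height_pos[OF sx(2)] unfolding sx(1) by (simp add: H_def)
    qed
    show "Q i j \<ge> 0" if "i \<in> I" "j \<in> I" "i \<noteq> j" for i j
    proof -
      obtain s x t y where st: "i = (s, x)" "j = (t, y)" by (cases i; cases j)
      show ?thesis using that e_pos[of "third s t"] third_props(1)[of s t] \<mu>_pos
        by (auto simp: st I_def less_imp_le intro!: mult_nonneg_nonneg sum_nonneg)
    qed
    show "bil I Q f f \<le> (\<Sum>i\<in>I. (\<Sum>j\<in>I. Q i j * f j)\<^sup>2 / D i)" for f
    proof -
      have step: "height s * (2 * inn f u (third s u) - \<kappa> s * (inn f u u + inn f (third s u) (third s u))
          - 2 * (\<kappa> u * inn f s u + \<kappa> (third s u) * inn f s (third s u)))
          + (\<kappa> u * height u + \<kappa> (third s u) * height (third s u) - dd s) * inn f s s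
        \<le> (\<Sum>x\<in>X s ` \<Omega>. (\<Sum>j\<in>I. Q (s, x) j * f j)\<^sup>2 / D (s, x))" if su: "s < 3" "u < 3" "s \<noteq> u" for s u
      proof -
        define v where "v = third s u"
        have uv: "v < 3" "v \<noteq> s" "v \<noteq> u" using third_props[OF su] by (auto simp: v_def)
        have o: "third s v = u" "third s u = v" using third_props[OF su] by (auto simp: v_def)
        have eu: "e u = height u - hit s u * height s - \<kappa> s * (height v - hit s v * height s)"
          using pinned_height(1)[OF su] by (simp add: o)
        have ev: "e v = height v - hit s v * height s - \<kappa> s * (height u - hit s u * height s)"
          using pinned_height(1)[OF su(1) uv(1) uv(2)[symmetric]] by (simp add: o)
        have ku: "\<kappa> v = hit s u - \<kappa> s * hit s v" using hit_rec[OF su] by (simp add: o)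
        have kv: "\<kappa> u = hit s v - \<kappa> s * hit s u"
          using hit_rec[OF su(1) uv(1) uv(2)[symmetric]] by (simp add: o)
        have dd: "\<kappa> u * height u + \<kappa> v * height v - dd s = height s * (hit s u * \<kappa> u + hit s v * \<kappa> v)"
          unfolding dd_eq[OF su] o eu ev ku kv by (simp add: algebra_simps)
        have "height s * (2 * inn f u v - \<kappa> s * (inn f u u + inn f v v)
          - 2 * (\<kappa> u * inn f s u + \<kappa> v * inn f s v) + inn f s s * (hit s u * \<kappa> u + hit s v * \<kappa> v))
          \<le> height s * (\<Sum>x\<in>X s ` \<Omega>. (\<Sum>j\<in>I. Q (s, x) j * f j)\<^sup>2 / (mass s x * Z s))"
          using site_step[OF su, of f] height_pos[OF su(1)] unfolding o by (intro mult_left_mono) auto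
        also have "\<dots> = (\<Sum>x\<in>X s ` \<Omega>. (\<Sum>j\<in>I. Q (s, x) j * f j)\<^sup>2 / D (s, x))"
          by (simp add: sum_distrib_left mult.commute)
        finally show ?thesis unfolding o dd by (simp add: algebra_simps)
      qed
      have e2: "e 2 = height 2 - \<kappa> 1 * height 0 - \<kappa> 0 * height 1"
        using height_eq[of 2 0] by (simp add: third_numeral)
      have e0: "e 0 = height 0 - \<kappa> 2 * height 1 - \<kappa> 1 * height 2"
        using height_eq[of 0 1] by (simp add: third_numeral third_numeral[unfolded One_nat_def])
      have e1: "e 1 = height 1 - \<kappa> 0 * height 2 - \<kappa> 2 * height 0"
        using height_eq[of 1 2] by (simp add: third_numeral third_numeral[unfolded One_nat_def])
      \<comment> \<open>Collecting terms over the three sites, the cross term of \<open>u\<close>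
        and \<open>v\<close> receives the coefficient \<open>height s - \<kappa> v * height u -
        \<kappa> u * height v = e s\<close> twice, and the terms
        \<open>\<kappa> u * height u\<close> cancel between sites, leaving \<open>- dd s\<close> on
        the diagonal.\<close>
      have "bil I Q f f = (\<Sum>s<3. let u = (if s = 2 then 0 else Suc s) in
         height s * (2 * inn f u (third s u) - \<kappa> s * (inn f u u + inn f (third s u) (third s u))
          - 2 * (\<kappa> u * inn f s u + \<kappa> (third s u) * inn f s (third s u)))
          + (\<kappa> u * height u + \<kappa> (third s u) * height (third s u) - dd s) * inn f s s)"
        unfolding bil_Q e0 e1 e2 sum_lessThan_3 Let_def
        by (simp add: third_numeral third_numeral[unfolded One_nat_def] algebra_simps
            inn_commute[of f 1 0] inn_commute[of f 2 0] inn_commute[of f 2 1] flip: One_nat_def numeral_2_eq_2)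
      also have "\<dots> \<le> (\<Sum>s<3. \<Sum>x\<in>X s ` \<Omega>. (\<Sum>j\<in>I. Q (s, x) j * f j)\<^sup>2 / D (s, x))"
        unfolding Let_def by (rule sum_mono) (rule step, auto)
      also have "\<dots> = (\<Sum>i\<in>I. (\<Sum>j\<in>I. Q i j * f j)\<^sup>2 / D i)" by (rule sum_I[symmetric])
      finally show ?thesis .
    qed
    show "\<exists>c. \<forall>i\<in>I. \<phi> i = c"
      if \<phi>: "\<And>i j. i \<in> I \<Longrightarrow> j \<in> I \<Longrightarrow> i \<noteq> j \<Longrightarrow> Q i j > 0 \<Longrightarrow> \<phi> i = \<phi> j" for \<phi> :: "nat \<times> 's \<Rightarrow> real"
    proof -
      \<comment> \<open>Spins of one sample point are joined by positive entries of
        \<open>Q\<close>, so the restrictions of \<open>\<phi>\<close> to the sites agree at every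
        sample point, as \<open>connected\<close> requires.\<close>
      have eq: "\<phi> (s, X s \<omega>) = \<phi> (t, X t \<omega>)" if "\<omega> \<in> \<Omega>" "s < 3" "t < 3" for \<omega> s t
      proof (cases "s = t")
        case False
        have "(\<Sum>\<omega>' | \<omega>' \<in> \<Omega> \<and> X s \<omega>' = X s \<omega> \<and> X t \<omega>' = X t \<omega>. \<mu> \<omega>') > 0"
          using that finite_\<Omega> \<mu>_pos by (intro sum_pos) auto
        hence "Q (s, X s \<omega>) (t, X t \<omega>) > 0" using False e_pos third_props(1)[OF that(2,3) False] by simp
        thus ?thesis using that False by (intro \<phi>) (auto simp: I_def)
      qed simp
      then obtain c where "\<forall>\<omega>\<in>\<Omega>. \<phi> (0, X 0 \<omega>) = c"
        using connected[of "\<lambda>s x. \<phi> (s, x)"] by blast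
      hence "\<phi> (s, X s \<omega>) = c" if "\<omega> \<in> \<Omega>" "s < 3" for s \<omega> using eq[of \<omega> s 0] that by simp
      thus ?thesis by (intro exI[of _ c]) (auto simp: I_def)
    qed
    \<comment> \<open>The factor \<open>height s\<close> cancels against \<open>D\<close>, so
      orthogonality to \<open>H\<close> reduces to the zero means, site by site.\<close>
    show "ip I D F H = 0"
    proof -
      have "(\<Sum>x\<in>X s ` \<Omega>. D (s, x) * F (s, x) * H (s, x)) = 0" if "s < 3" for s
      proof -
        have "(\<Sum>x\<in>X s ` \<Omega>. D (s, x) * F (s, x) * H (s, x)) = Z s * (\<Sum>x\<in>X s ` \<Omega>. mass s x * F (s, x))"
          unfolding sum_distrib_left using height_pos[OF that] by (intro sum.cong refl) (simp add: H_def)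
        also have "(\<Sum>x\<in>X s ` \<Omega>. mass s x * F (s, x))
          = (\<Sum>x\<in>X s ` \<Omega>. \<Sum>\<omega> | \<omega> \<in> \<Omega> \<and> X s \<omega> = x. \<mu> \<omega> * F (s, X s \<omega>))"
          unfolding mass_def sum_distrib_right by (intro sum.cong refl) auto
        also have "\<dots> = 0" unfolding sum_image using mean
          by (cases "s = 0"; cases "s = 1") (auto simp: F_def)
        finally show ?thesis by simp
      qed
      thus ?thesis unfolding ip_def sum_I by simp
    qed
  qed
  thus ?thesis unfolding bil_Q by (simp add: inn_def F_def power2_eq_square mult.assoc)
qed

end

text \<open>As the weights concentrate on the pair of sites 0 and 1, the coefficients
  \<open>dd 0\<close> and \<open>dd 1\<close> tend to \<open>hit 0 1\<close> and
  \<open>hit 1 0\<close>; the claimed constant is the geometric mean of these two.\<close>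

lemma corr_le_0_1:
  "corr_le \<Omega> \<mu> (X 0) (X 1) ((\<kappa> 2 + \<kappa> 0 * \<kappa> 1) / sqrt ((1 - (\<kappa> 0)\<^sup>2) * (1 - (\<kappa> 1)\<^sup>2)))"
  unfolding corr_le_def
proof (intro allI impI)
  fix f0 f1 :: "'s \<Rightarrow> real"
  assume mean: "(\<Sum>\<omega>\<in>\<Omega>. \<mu> \<omega> * f0 (X 0 \<omega>)) = 0" "(\<Sum>\<omega>\<in>\<Omega>. \<mu> \<omega> * f1 (X 1 \<omega>)) = 0"
  have unweighted: "2 * (\<Sum>\<omega>\<in>\<Omega>. \<mu> \<omega> * g0 (X 0 \<omega>) * g1 (X 1 \<omega>))
      \<le> hit 0 1 * (\<Sum>\<omega>\<in>\<Omega>. \<mu> \<omega> * (g0 (X 0 \<omega>))\<^sup>2) + hit 1 0 * (\<Sum>\<omega>\<in>\<Omega>. \<mu> \<omega> * (g1 (X 1 \<omega>))\<^sup>2)"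
    if g: "(\<Sum>\<omega>\<in>\<Omega>. \<mu> \<omega> * g0 (X 0 \<omega>)) = 0" "(\<Sum>\<omega>\<in>\<Omega>. \<mu> \<omega> * g1 (X 1 \<omega>)) = 0" for g0 g1 :: "'s \<Rightarrow> real"
  proof -
    define S0 S1 where "S0 = (\<Sum>\<omega>\<in>\<Omega>. \<mu> \<omega> * (g0 (X 0 \<omega>))\<^sup>2)" and "S1 = (\<Sum>\<omega>\<in>\<Omega>. \<mu> \<omega> * (g1 (X 1 \<omega>))\<^sup>2)"
    define C where "C = hit 0 2 * S0 + hit 1 2 * S1"
    have "S0 \<ge> 0" "S1 \<ge> 0" unfolding S0_def S1_def using \<mu>_pos by (auto intro!: sum_nonneg simp: less_imp_le)
    hence "C \<ge> 0" unfolding C_def using hit_nonneg[of 0 2] hit_nonneg[of 1 2] by simp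
    \<comment> \<open>The weights are \<open>(\<epsilon>, \<epsilon>, 1)\<close> because \<open>\<epsilon> = 0\<close> would make the form degenerate.\<close>
    have "2 * (\<Sum>\<omega>\<in>\<Omega>. \<mu> \<omega> * g0 (X 0 \<omega>) * g1 (X 1 \<omega>)) \<le> hit 0 1 * S0 + hit 1 0 * S1 + \<delta>" if "\<delta> > 0" for \<delta>
    proof -
      define \<epsilon> where "\<epsilon> = \<delta> / (C + 1)"
      have \<epsilon>: "\<epsilon> > 0" "\<epsilon> * C \<le> \<delta>" using that \<open>C \<ge> 0\<close> by (auto simp: \<epsilon>_def field_simps)
      define e :: "nat \<Rightarrow> real" where "e = (\<lambda>s. if s = 2 then 1 else \<epsilon>)"
      have e: "\<And>s. s < 3 \<Longrightarrow> e s > 0" using \<epsilon> by (simp add: e_def)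
      have "dd e 0 = \<epsilon> * hit 0 2 + hit 0 1" "dd e 1 = hit 1 0 + \<epsilon> * hit 1 2"
        using dd_eq[where e = e and s = 0 and u = 1] dd_eq[where e = e and s = 1 and u = 2] e
        by (simp_all add: e_def third_numeral third_numeral[unfolded One_nat_def])
      moreover have "2 * e 2 * (\<Sum>\<omega>\<in>\<Omega>. \<mu> \<omega> * g0 (X 0 \<omega>) * g1 (X 1 \<omega>)) \<le> dd e 0 * S0 + dd e 1 * S1"
        unfolding S0_def S1_def by (rule weighted_bound[where e = e, OF e g])
      moreover have "e 2 = 1" by (simp add: e_def)
      ultimately show ?thesis using \<epsilon> by (simp add: C_def algebra_simps)
    qed
    thus ?thesis unfolding S0_def S1_def by (rule field_le_epsilon)
  qed
  define k \<alpha> \<beta> where "k = \<kappa> 2 + \<kappa> 0 * \<kappa> 1" and "\<alpha> = 1 - (\<kappa> 0)\<^sup>2" and "\<beta> = 1 - (\<kappa> 1)\<^sup>2"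
  have pos: "\<alpha> > 0" "\<beta> > 0" using \<kappa>_sq_less_1[of 0] \<kappa>_sq_less_1[of 1] by (simp_all add: \<alpha>_def \<beta>_def)
  \<comment> \<open>Scaling \<open>f0\<close> by \<open>t\<close> and \<open>f1\<close> by
    \<open>1 / t\<close> must equalise the two coefficients \<open>k / \<alpha> * t\<^sup>2\<close>
    and \<open>k / \<beta> / t\<^sup>2\<close>; the fourth root of \<open>\<alpha> / \<beta>\<close>
    does this.\<close>
  define t where "t = sqrt (sqrt (\<alpha> / \<beta>))"
  have t: "t > 0" "t\<^sup>2 = sqrt \<alpha> / sqrt \<beta>" using pos by (simp_all add: t_def real_sqrt_divide power_divide)
  have hits: "hit 0 1 = k / \<alpha>" "hit 1 0 = k / \<beta>"
    by (simp_all add: hit_def k_def \<alpha>_def \<beta>_def third_numeral third_numeral[unfolded One_nat_def] mult.commute)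
  have "2 * (\<Sum>\<omega>\<in>\<Omega>. \<mu> \<omega> * (t * f0 (X 0 \<omega>)) * (f1 (X 1 \<omega>) / t))
    \<le> hit 0 1 * (\<Sum>\<omega>\<in>\<Omega>. \<mu> \<omega> * (t * f0 (X 0 \<omega>))\<^sup>2) + hit 1 0 * (\<Sum>\<omega>\<in>\<Omega>. \<mu> \<omega> * (f1 (X 1 \<omega>) / t)\<^sup>2)"
  proof (rule unweighted)
    have "(\<Sum>\<omega>\<in>\<Omega>. \<mu> \<omega> * (t * f0 (X 0 \<omega>))) = t * (\<Sum>\<omega>\<in>\<Omega>. \<mu> \<omega> * f0 (X 0 \<omega>))"
      unfolding sum_distrib_left by (intro sum.cong refl) simp
    thus "(\<Sum>\<omega>\<in>\<Omega>. \<mu> \<omega> * (t * f0 (X 0 \<omega>))) = 0" using mean by simp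
    have "(\<Sum>\<omega>\<in>\<Omega>. \<mu> \<omega> * (f1 (X 1 \<omega>) / t)) = (\<Sum>\<omega>\<in>\<Omega>. \<mu> \<omega> * f1 (X 1 \<omega>)) / t"
      unfolding sum_divide_distrib by (intro sum.cong refl) simp
    thus "(\<Sum>\<omega>\<in>\<Omega>. \<mu> \<omega> * (f1 (X 1 \<omega>) / t)) = 0" using mean by simp
  qed
  also have "(\<Sum>\<omega>\<in>\<Omega>. \<mu> \<omega> * (t * f0 (X 0 \<omega>)) * (f1 (X 1 \<omega>) / t)) = (\<Sum>\<omega>\<in>\<Omega>. \<mu> \<omega> * f0 (X 0 \<omega>) * f1 (X 1 \<omega>))"
    using t by (simp add: mult.assoc)
  also have "(\<Sum>\<omega>\<in>\<Omega>. \<mu> \<omega> * (t * f0 (X 0 \<omega>))\<^sup>2) = t\<^sup>2 * (\<Sum>\<omega>\<in>\<Omega>. \<mu> \<omega> * (f0 (X 0 \<omega>))\<^sup>2)"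
    unfolding sum_distrib_left by (intro sum.cong refl) (simp add: power_mult_distrib)
  also have "(\<Sum>\<omega>\<in>\<Omega>. \<mu> \<omega> * (f1 (X 1 \<omega>) / t)\<^sup>2) = (\<Sum>\<omega>\<in>\<Omega>. \<mu> \<omega> * (f1 (X 1 \<omega>))\<^sup>2) / t\<^sup>2"
    unfolding sum_divide_distrib by (intro sum.cong refl) (simp add: power_divide)
  finally have main: "2 * (\<Sum>\<omega>\<in>\<Omega>. \<mu> \<omega> * f0 (X 0 \<omega>) * f1 (X 1 \<omega>))
    \<le> hit 0 1 * t\<^sup>2 * (\<Sum>\<omega>\<in>\<Omega>. \<mu> \<omega> * (f0 (X 0 \<omega>))\<^sup>2) + hit 1 0 / t\<^sup>2 * (\<Sum>\<omega>\<in>\<Omega>. \<mu> \<omega> * (f1 (X 1 \<omega>))\<^sup>2)"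
    by (simp add: mult.assoc)
  define a b where "a = sqrt \<alpha>" and "b = sqrt \<beta>"
  have ab: "a > 0" "b > 0" "\<alpha> = a * a" "\<beta> = b * b" using pos by (simp_all add: a_def b_def)
  have eqs: "hit 0 1 * t\<^sup>2 = k / sqrt (\<alpha> * \<beta>)" "hit 1 0 / t\<^sup>2 = k / sqrt (\<alpha> * \<beta>)"
    unfolding hits t(2) real_sqrt_mult a_def[symmetric] b_def[symmetric] ab(3,4)
    using ab(1,2) by (simp_all add: field_simps)
  show "2 * (\<Sum>\<omega>\<in>\<Omega>. \<mu> \<omega> * f0 (X 0 \<omega>) * f1 (X 1 \<omega>))
    \<le> (\<kappa> 2 + \<kappa> 0 * \<kappa> 1) / sqrt ((1 - (\<kappa> 0)\<^sup>2) * (1 - (\<kappa> 1)\<^sup>2))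
      * ((\<Sum>\<omega>\<in>\<Omega>. \<mu> \<omega> * (f0 (X 0 \<omega>))\<^sup>2) + (\<Sum>\<omega>\<in>\<Omega>. \<mu> \<omega> * (f1 (X 1 \<omega>))\<^sup>2))"
    using main unfolding eqs by (simp add: k_def \<alpha>_def \<beta>_def distrib_left)
qed

end


section \<open>Hitting probabilities of absorbing walks\<close>

lemma has_sum_disjoint_UN:
  fixes f :: "'a \<Rightarrow> real"
  assumes "finite Y" "\<And>y. y \<in> Y \<Longrightarrow> (f has_sum s y) (T y)" "disjoint_family_on T Y"
  shows "(f has_sum (\<Sum>y\<in>Y. s y)) (\<Union>y\<in>Y. T y)"
  using assms
proof (induction Y rule: finite_induct)
  case (insert y Y)
  have "disjoint_family_on T Y" using insert.prems(2) by (auto simp: disjoint_family_on_def)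
  moreover have "T y \<inter> (\<Union>y\<in>Y. T y) = {}"
    using insert.prems(2) insert.hyps(2) by (auto simp: disjoint_family_on_def)
  ultimately have "(f has_sum (s y + (\<Sum>y\<in>Y. s y))) (T y \<union> (\<Union>y\<in>Y. T y))"
    using insert by (intro has_sum_Un_disjoint) auto
  thus ?case using insert.hyps by simp
qed simp

lemma walk_weight_Cons: "walk_weight W (x # y # zs) = W x y * walk_weight W (y # zs)"
  unfolding walk_weight_def
  by (simp add: prod.atLeast_Suc_atMost prod.shift_bounds_cl_Suc_ivl del: prod.cl_ivl_Suc)

lemma walk_weight_singleton [simp]: "walk_weight W [x] = 1"
  by (simp add: walk_weight_def)

lemma walk_weight_pair [simp]: "walk_weight W [x, y] = W x y"
  by (simp add: walk_weight_Cons)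

text \<open>First-step decomposition. Only inner vertices avoid \<open>B \<union> U\<close>, so
  \<open>u\<close> is unrestricted, while \<open>v\<close> cannot be an inner vertex and the direct
  step \<open>[u, v]\<close> forms a case of its own.\<close>

lemma walks_Cons_iff:
  assumes "u \<in> V \<union> B" "v \<in> V \<union> B" "v \<in> B \<union> U" "u \<noteq> v"
  shows "walks V B U u v = insert [u, v] (\<Union>y\<in>V - U - B. (#) u ` walks V B U y v)"
proof (intro equalityI subsetI)
  fix xs assume xs: "xs \<in> walks V B U u v"
  then obtain ys where ys: "xs = u # ys" by (cases xs) (auto simp: walks_def)
  hence "ys \<noteq> []" using xs assms(4) by (auto simp: walks_def)
  then obtain y zs where yz: "ys = y # zs" by (cases ys) auto
  show "xs \<in> insert [u, v] (\<Union>y\<in>V - U - B. (#) u ` walks V B U y v)"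
  proof (cases "zs = []")
    case True thus ?thesis using xs by (auto simp: ys yz walks_def)
  next
    case False
    have int: "xs ! i \<notin> B \<union> U" if "1 \<le> i" "i < length xs - 1" for i
      using xs that by (auto simp: walks_def)
    have "y \<notin> B \<union> U" using int[of 1] False by (simp add: ys yz)
    moreover have "ys ! i \<notin> B \<union> U" if "i \<in> {1..<length ys - 1}" for i
      using int[of "Suc i"] that by (simp add: ys less_diff_conv)
    hence "ys \<in> walks V B U y v"
      using xs False by (auto simp: ys yz walks_def)
    moreover have "y \<in> V" using xs \<open>y \<notin> B \<union> U\<close> by (auto simp: ys yz walks_def)
    ultimately show ?thesis unfolding ys by blast
  qed
next
  fix xs assume "xs \<in> insert [u, v] (\<Union>y\<in>V - U - B. (#) u ` walks V B U y v)"
  then consider "xs = [u, v]" | y ys where "y \<in> V - U - B" "ys \<in> walks V B U y v" "xs = u # ys" by blast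
  thus "xs \<in> walks V B U u v"
  proof cases
    case 1 thus ?thesis using assms by (auto simp: walks_def)
  next
    case 2
    have "(u # ys) ! i \<notin> B \<union> U" if i: "i \<in> {1..<length (u # ys) - 1}" for i
    proof (cases "i = 1")
      case True thus ?thesis using 2 by (auto simp: walks_def hd_conv_nth)
    next
      case False
      obtain j where j: "i = Suc j" using i by (cases i) simp_all
      have "j \<in> {1..<length ys - 1}" using i False unfolding j by auto
      thus ?thesis using 2 unfolding j by (auto simp: walks_def)
    qed
    thus ?thesis using 2 assms by (auto simp: walks_def)
  qed
qed

context absorbing_walk
begin

abbreviation h :: "'v set \<Rightarrow> 'v \<Rightarrow> 'v \<Rightarrow> real" where "h \<equiv> hit_weight V B W"

lemma walk_weight_nonneg: "set xs \<subseteq> V \<union> B \<Longrightarrow> walk_weight W xs \<ge> 0"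
  unfolding walk_weight_def
proof (intro prod_nonneg ballI W_nonneg)
  fix i assume "set xs \<subseteq> V \<union> B" "i \<in> {1..length xs - 1}"
  hence "i - 1 < length xs" "i < length xs" "set xs \<subseteq> V \<union> B" by auto
  thus "xs ! (i - 1) \<in> V \<union> B" "xs ! i \<in> V \<union> B" using nth_mem by blast+
qed

lemma finite_bounded_walks: "finite {xs \<in> walks V B U u v. length xs \<le> n}"
proof (rule finite_subset)
  show "{xs \<in> walks V B U u v. length xs \<le> n} \<subseteq> {xs. set xs \<subseteq> V \<union> B \<and> length xs \<le> n}"
    by (auto simp: walks_def)
  show "finite {xs. set xs \<subseteq> V \<union> B \<and> length xs \<le> n}"
    using finite_interior finite_boundary by (intro finite_lists_length_le) auto
qed

lemma sub_row_sum: "x \<in> V \<union> B \<Longrightarrow> Y \<subseteq> V \<union> B \<Longrightarrow> (\<Sum>y\<in>Y. W x y) \<le> 1"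
  unfolding W_row_sum[of x, symmetric]
  using W_nonneg finite_interior finite_boundary by (intro sum_mono2) auto

text \<open>Bounding the length keeps the sums finite, and the first-step decomposition bounds them
  inductively by a partial row sum of \<open>W\<close>. This uniform bound makes the infinite sum
  converge.\<close>

lemma bounded_walks_le_1:
  assumes v: "v \<in> V \<union> B" "v \<in> B \<union> U"
  shows "u \<in> V \<union> B \<Longrightarrow> u \<noteq> v \<Longrightarrow> (\<Sum>xs | xs \<in> walks V B U u v \<and> length xs \<le> n. walk_weight W xs) \<le> 1"
proof (induction n arbitrary: u)
  case 0
  have "{xs. xs \<in> walks V B U u v \<and> length xs \<le> 0} = {}" by (auto simp: walks_def)
  thus ?case by (metis sum.empty zero_le_one)
next
  case (Suc n)
  let ?Y = "V - U - B"
  let ?T = "\<lambda>y. (#) u ` {xs \<in> walks V B U y v. length xs \<le> n}"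
  have vY: "v \<notin> ?Y" using v by auto
  have nn: "walk_weight W xs \<ge> 0" if "xs \<in> walks V B U y v" for xs y
    using that by (intro walk_weight_nonneg) (auto simp: walks_def)
  have sub: "{xs. xs \<in> walks V B U u v \<and> length xs \<le> Suc n} \<subseteq> insert [u, v] (\<Union>y\<in>?Y. ?T y)"
    unfolding walks_Cons_iff[OF Suc.prems(1) v Suc.prems(2)] by auto
  have W_T: "(\<Sum>xs\<in>?T y. walk_weight W xs) = W u y * (\<Sum>xs | xs \<in> walks V B U y v \<and> length xs \<le> n. walk_weight W xs)" for y
  proof -
    have "walk_weight W (u # xs) = W u y * walk_weight W xs" if "xs \<in> walks V B U y v" for xs
      using that by (cases xs) (auto simp: walks_def walk_weight_Cons)
    thus ?thesis by (simp add: sum.reindex sum_distrib_left)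
  qed
  have pos: "walk_weight W xs \<ge> 0" if "xs \<in> insert [u, v] (\<Union>y\<in>?Y. ?T y)" for xs
    using that Suc.prems(1) v by (intro walk_weight_nonneg) (auto simp: walks_def)
  have fin: "finite (\<Union>y\<in>?Y. ?T y)" using finite_interior finite_bounded_walks by auto
  have "(\<Sum>xs | xs \<in> walks V B U u v \<and> length xs \<le> Suc n. walk_weight W xs)
      \<le> (\<Sum>xs\<in>insert [u, v] (\<Union>y\<in>?Y. ?T y). walk_weight W xs)"
    using fin sub pos by (intro sum_mono2) auto
  also have "\<dots> \<le> W u v + (\<Sum>xs\<in>(\<Union>y\<in>?Y. ?T y). walk_weight W xs)"
    using fin pos[of "[u, v]"] by (simp add: sum.insert_if)
  also have "(\<Sum>xs\<in>(\<Union>y\<in>?Y. ?T y). walk_weight W xs) = (\<Sum>y\<in>?Y. \<Sum>xs\<in>?T y. walk_weight W xs)"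
    using finite_interior finite_bounded_walks
    by (intro sum.UNION_disjoint) (auto simp: walks_def)
  also have "\<dots> \<le> (\<Sum>y\<in>?Y. W u y * 1)"
    unfolding W_T using Suc.prems(1) vY by (intro sum_mono mult_left_mono Suc.IH W_nonneg) auto
  also have "W u v + (\<Sum>y\<in>?Y. W u y * 1) = (\<Sum>y\<in>insert v ?Y. W u y)"
    using vY finite_interior by simp
  also have "\<dots> \<le> 1" using Suc.prems(1) v by (intro sub_row_sum) auto
  finally show ?case by simp
qed

lemma walks_summable:
  assumes "u \<in> V \<union> B" "v \<in> V \<union> B" "v \<in> B \<union> U" "u \<noteq> v"
  shows "walk_weight W summable_on walks V B U u v"
proof (rule nonneg_bdd_above_summable_on)
  show nn: "walk_weight W xs \<ge> 0" if "xs \<in> walks V B U u v" for xs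
    using that by (intro walk_weight_nonneg) (auto simp: walks_def)
  show "bdd_above (sum (walk_weight W) ` {F. F \<subseteq> walks V B U u v \<and> finite F})"
  proof (rule bdd_aboveI2[where M = 1])
    fix F assume F: "F \<in> {F. F \<subseteq> walks V B U u v \<and> finite F}"
    define n where "n = Max (length ` F)"
    have "sum (walk_weight W) F \<le> (\<Sum>xs | xs \<in> walks V B U u v \<and> length xs \<le> n. walk_weight W xs)"
      using F nn finite_bounded_walks by (intro sum_mono2) (auto simp: n_def)
    also have "\<dots> \<le> 1" using assms by (intro bounded_walks_le_1)
    finally show "sum (walk_weight W) F \<le> 1" .
  qed
qed

lemma hit_nonneg: "h U u v \<ge> 0"
  unfolding hit_weight_def by (intro infsum_nonneg walk_weight_nonneg) (auto simp: walks_def)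

text \<open>From here on, hitting probabilities are handled through this linear system and a maximum
  principle instead of through walks.\<close>

lemma hit_step:
  assumes "u \<in> V \<union> B" "v \<in> V \<union> B" "v \<in> B \<union> U" "u \<noteq> v"
  shows "h U u v = W u v + (\<Sum>y\<in>V - U. W u y * h U y v)"
proof -
  have VU: "V - U - B = V - U" using disjoint_boundary by auto
  have part: "(walk_weight W has_sum W u y * h U y v) ((#) u ` walks V B U y v)" if y: "y \<in> V - U - B" for y
  proof -
    have "y \<noteq> v" "y \<in> V \<union> B" using y assms(3) by auto
    hence "walk_weight W summable_on walks V B U y v" using assms by (intro walks_summable) auto
    hence "((\<lambda>xs. W u y * walk_weight W xs) has_sum W u y * h U y v) (walks V B U y v)"
      unfolding hit_weight_def by (intro has_sum_cmult_right has_sum_infsum)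
    moreover have "walk_weight W (u # xs) = W u y * walk_weight W xs" if "xs \<in> walks V B U y v" for xs
      using that by (cases xs) (auto simp: walks_def walk_weight_Cons)
    ultimately have "((walk_weight W \<circ> (#) u) has_sum W u y * h U y v) (walks V B U y v)"
      by (subst has_sum_cong[where g = "\<lambda>xs. W u y * walk_weight W xs"]) auto
    thus ?thesis by (subst has_sum_reindex) auto
  qed
  have "(walk_weight W has_sum (\<Sum>y\<in>V - U - B. W u y * h U y v)) (\<Union>y\<in>V - U - B. (#) u ` walks V B U y v)"
    using finite_interior part
    by (intro has_sum_disjoint_UN) (auto simp: disjoint_family_on_def walks_def)
  moreover have "[u, v] \<notin> (\<Union>y\<in>V - U - B. (#) u ` walks V B U y v)"
    using assms(3) by (auto simp: walks_def)
  ultimately have "(walk_weight W has_sum (W u v + (\<Sum>y\<in>V - U - B. W u y * h U y v))) (walks V B U u v)"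
    unfolding walks_Cons_iff[OF assms]
    using has_sum_insert[of "[u, v]" "\<Union>y\<in>V - U - B. (#) u ` walks V B U y v" "walk_weight W"] by simp
  thus ?thesis unfolding hit_weight_def VU by (rule infsumI)
qed

text \<open>Such a function serves twice: as a barrier in the maximum principle, and as a weight
  that makes hitting probabilities strictly substochastic.\<close>

lemma superharmonic_exists:
  "\<exists>\<psi>. (\<forall>x\<in>V \<union> B. 0 < \<psi> x) \<and> (\<forall>x\<in>V. (\<Sum>y\<in>V \<union> B. W x y * \<psi> y) < \<psi> x)"
proof -
  define R where "R = {(x, y). x \<in> V \<union> B \<and> y \<in> V \<union> B \<and> W x y > 0}"
  define dist where "dist x = (LEAST n. \<exists>b\<in>B. (x, b) \<in> R ^^ n)" for x
  define P where "P = (\<lambda>(x, y). W x y) ` R"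
  \<comment> \<open>Halving the smallest positive transition probability gives
    \<open>\<delta> < W x y\<close> strictly; the extra entry 1 keeps the minimum defined and
    \<open>\<delta>\<close> below 1.\<close>
  define \<delta> where "\<delta> = Min (insert 1 P) / 2"
  have finP: "finite P"
  proof -
    have "R \<subseteq> (V \<union> B) \<times> (V \<union> B)" by (auto simp: R_def)
    hence "finite R" using finite_interior finite_boundary by (meson finite_SigmaI finite_UnI finite_subset)
    thus ?thesis by (simp add: P_def)
  qed
  have Min_pos: "Min (insert 1 P) > 0" using finP by (subst Min_gr_iff) (auto simp: P_def R_def)
  have "Min (insert 1 P) \<le> 1" using finP by simp
  hence \<delta>: "0 < \<delta>" "\<delta> < 1" using Min_pos by (auto simp: \<delta>_def)
  have \<delta>W: "\<delta> < W x y" if "(x, y) \<in> R" for x y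
  proof -
    have "W x y \<in> P" using that by (auto simp: P_def)
    hence "Min (insert 1 P) \<le> W x y" using finP by simp
    thus ?thesis using Min_pos by (simp add: \<delta>_def)
  qed
  \<comment> \<open>A step that decreases the distance to \<open>B\<close> has probability above
    \<open>\<delta>\<close> and enlarges \<open>\<delta> ^ Suc (dist x)\<close> by a factor of at
    least \<open>1 / \<delta>\<close>, so the average of this power over one step exceeds its value
    at \<open>x\<close>. The \<open>Suc\<close> keeps \<open>\<psi>\<close> positive on
    \<open>B\<close>, where the distance is 0.\<close>
  define \<psi> where "\<psi> x = 1 - \<delta> ^ Suc (dist x)" for x
  have pow: "\<delta> ^ Suc n < 1" for n using \<delta> by (intro power_Suc_less_one)
  have "(\<Sum>y\<in>V \<union> B. W x y * \<psi> y) < \<psi> x" if x: "x \<in> V" for x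
  proof -
    obtain b where "b \<in> B" "(x, b) \<in> R\<^sup>*" using absorbing[OF x] unfolding R_def by blast
    then obtain n where "\<exists>b\<in>B. (x, b) \<in> R ^^ n" using rtrancl_power by blast
    hence "\<exists>b\<in>B. (x, b) \<in> R ^^ dist x" unfolding dist_def by (rule LeastI)
    then obtain b where b: "b \<in> B" "(x, b) \<in> R ^^ dist x" by blast
    have "dist x \<noteq> 0" using b x disjoint_boundary by (auto intro: ccontr)
    then obtain n where n: "dist x = Suc n" using not0_implies_Suc by blast
    then obtain y where y: "(x, y) \<in> R" "(y, b) \<in> R ^^ n" using b by (metis relpow_Suc_D2)
    have "dist y \<le> n" unfolding dist_def using y(2) b(1) by (intro Least_le) auto
    hence "\<delta> ^ Suc n \<le> \<delta> ^ Suc (dist y)" using \<delta> by (intro power_decreasing) auto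
    moreover have "\<delta> * \<delta> ^ Suc n < W x y * \<delta> ^ Suc n" using \<delta>W[OF y(1)] \<delta> by simp
    ultimately have lt: "\<delta> ^ Suc (dist x) < W x y * \<delta> ^ Suc (dist y)"
      using \<delta>W[OF y(1)] \<delta> unfolding n power_Suc[of \<delta> "Suc n"]
      by (smt (verit) mult_left_mono)
    have yVB: "y \<in> V \<union> B" using y(1) by (auto simp: R_def)
    have "W x y * \<delta> ^ Suc (dist y) \<le> (\<Sum>y\<in>V \<union> B. W x y * \<delta> ^ Suc (dist y))"
      using yVB x W_nonneg \<delta> finite_interior finite_boundary
      by (intro member_le_sum[where f = "\<lambda>y. W x y * \<delta> ^ Suc (dist y)"]) (auto simp: less_imp_le)
    moreover have "(\<Sum>y\<in>V \<union> B. W x y * \<psi> y) = 1 - (\<Sum>y\<in>V \<union> B. W x y * \<delta> ^ Suc (dist y))"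
      using W_row_sum[of x] x by (simp add: \<psi>_def right_diff_distrib sum_subtractf)
    ultimately show ?thesis using lt by (simp add: \<psi>_def)
  qed
  moreover have "0 < \<psi> x" for x using pow by (simp add: \<psi>_def)
  ultimately show ?thesis by blast
qed

text \<open>At a point \<open>z\<close> maximising \<open>r / \<psi>\<close>, a positive maximum
  \<open>m\<close> would make \<open>r z\<close> at most \<open>m\<close> times the one-step average
  of \<open>\<psi>\<close>, which is strictly below \<open>m * \<psi> z = r z\<close>.\<close>

lemma maximum_principle:
  assumes Y: "Y \<subseteq> V" and r: "\<And>x. x \<in> Y \<Longrightarrow> r x \<le> (\<Sum>y\<in>Y. W x y * r y)" and x: "x \<in> Y"
  shows "r x \<le> 0"
proof (rule ccontr)
  assume "\<not> r x \<le> 0"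
  obtain \<psi> where \<psi>: "\<And>x. x \<in> V \<union> B \<Longrightarrow> 0 < \<psi> x" "\<And>x. x \<in> V \<Longrightarrow> (\<Sum>y\<in>V \<union> B. W x y * \<psi> y) < \<psi> x"
    using superharmonic_exists by blast
  have fin: "finite Y" using Y finite_interior finite_subset by blast
  define m where "m = Max ((\<lambda>y. r y / \<psi> y) ` Y)"
  have le: "r y \<le> m * \<psi> y" if "y \<in> Y" for y
  proof -
    have "r y / \<psi> y \<le> m" unfolding m_def using fin that by (intro Max_ge) auto
    thus ?thesis using \<psi>(1)[of y] that Y by (auto simp: field_simps)
  qed
  have "m \<in> (\<lambda>y. r y / \<psi> y) ` Y" unfolding m_def using fin x by (intro Max_in) auto
  then obtain z where z: "z \<in> Y" "m = r z / \<psi> z" by blast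
  have "0 < m * \<psi> x" using le[OF x] \<open>\<not> r x \<le> 0\<close> by simp
  hence m: "0 < m" using \<psi>(1)[of x] x Y by (auto simp: zero_less_mult_iff)
  have "r z \<le> (\<Sum>y\<in>Y. W z y * (m * \<psi> y))"
    using r[OF z(1)] le W_nonneg z(1) Y by (intro order_trans[OF r[OF z(1)]] sum_mono mult_left_mono) auto
  also have "\<dots> = m * (\<Sum>y\<in>Y. W z y * \<psi> y)" by (simp add: sum_distrib_left algebra_simps)
  also have "\<dots> \<le> m * (\<Sum>y\<in>V \<union> B. W z y * \<psi> y)"
    using m z(1) Y \<psi>(1) W_nonneg finite_interior finite_boundary
    by (intro mult_left_mono sum_mono2 mult_nonneg_nonneg) (auto simp: less_imp_le)
  also have "\<dots> < m * \<psi> z" using m \<psi>(2)[of z] z(1) Y by auto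
  also have "\<dots> = r z" using z \<psi>(1)[of z] Y by auto
  finally show False by simp
qed

text \<open>Optional stopping: the sum is the expectation of \<open>\<psi>\<close> at the first
  visit to \<open>B \<union> U \<union> T\<close>, restricted to \<open>T\<close>. The difference
  \<open>r\<close> of the two sides is at most 0 by the maximum principle, and one further step
  makes this strict.\<close>

lemma hit_below_superharmonic:
  assumes \<psi>: "\<And>x. x \<in> V \<union> B \<Longrightarrow> 0 < \<psi> x" "\<And>x. x \<in> V \<Longrightarrow> (\<Sum>y\<in>V \<union> B. W x y * \<psi> y) < \<psi> x"
    and T: "T \<subseteq> V" and x: "x \<in> V - (U \<union> T)"
  shows "(\<Sum>t\<in>T. h (U \<union> T) x t * \<psi> t) < \<psi> x"
proof -
  define Y where "Y = V - (U \<union> T)"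
  define r where "r x = (\<Sum>t\<in>T. h (U \<union> T) x t * \<psi> t) - \<psi> x" for x
  have finT: "finite T" using T finite_interior finite_subset by blast
  have lt: "r x < (\<Sum>y\<in>Y. W x y * r y)" if x: "x \<in> Y" for x
  proof -
    have "(\<Sum>t\<in>T. h (U \<union> T) x t * \<psi> t) = (\<Sum>t\<in>T. (W x t + (\<Sum>y\<in>Y. W x y * h (U \<union> T) y t)) * \<psi> t)"
    proof (rule sum.cong)
      fix t assume "t \<in> T"
      hence "h (U \<union> T) x t = W x t + (\<Sum>y\<in>V - (U \<union> T). W x y * h (U \<union> T) y t)"
        using x T by (intro hit_step) (auto simp: Y_def)
      thus "h (U \<union> T) x t * \<psi> t = (W x t + (\<Sum>y\<in>Y. W x y * h (U \<union> T) y t)) * \<psi> t" by (simp add: Y_def)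
    qed simp
    also have "\<dots> = (\<Sum>t\<in>T. W x t * \<psi> t) + (\<Sum>y\<in>Y. W x y * (\<Sum>t\<in>T. h (U \<union> T) y t * \<psi> t))"
      by (simp add: distrib_right sum.distrib sum_distrib_left sum_distrib_right sum.swap[of _ T Y] mult.assoc)
    finally have e: "(\<Sum>t\<in>T. h (U \<union> T) x t * \<psi> t)
      = (\<Sum>t\<in>T. W x t * \<psi> t) + (\<Sum>y\<in>Y. W x y * (\<Sum>t\<in>T. h (U \<union> T) y t * \<psi> t))" .
    have "(\<Sum>t\<in>T. W x t * \<psi> t) + (\<Sum>y\<in>Y. W x y * \<psi> y) = (\<Sum>y\<in>T \<union> Y. W x y * \<psi> y)"
      using finT finite_interior by (intro sum.union_disjoint[symmetric]) (auto simp: Y_def)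
    also have "\<dots> \<le> (\<Sum>y\<in>V \<union> B. W x y * \<psi> y)"
      using x T \<psi>(1) W_nonneg finite_interior finite_boundary
      by (intro sum_mono2 mult_nonneg_nonneg) (auto simp: Y_def less_imp_le)
    also have "\<dots> < \<psi> x" using \<psi>(2) x by (auto simp: Y_def)
    finally show ?thesis unfolding r_def e by (simp add: right_diff_distrib sum_subtractf)
  qed
  have "r y \<le> 0" if "y \<in> Y" for y
    using lt that by (intro maximum_principle[of Y r y]) (auto simp: Y_def less_imp_le)
  hence "(\<Sum>y\<in>Y. W x y * r y) \<le> 0"
    using x W_nonneg by (intro sum_nonpos mult_nonneg_nonpos) (auto simp: Y_def)
  thus ?thesis using lt[of x] x by (simp add: Y_def r_def)
qed

text \<open>Strong Markov property at the first visit to \<open>c\<close>. Both sides solve the same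
  first-step system on \<open>Y\<close>, so the maximum principle applied to their difference and to
  its negative shows equality.\<close>

lemma hit_markov:
  assumes abc: "a \<in> V - U" "b \<in> V - U" "c \<in> V - U" "a \<noteq> b" "a \<noteq> c" "b \<noteq> c"
  shows "h (insert b U) a b = h (insert b (insert c U)) a b + h (insert b (insert c U)) a c * h (insert b U) c b"
proof -
  define Y where "Y = V - insert b (insert c U)"
  let ?U = "insert b U" and ?U' = "insert b (insert c U)"
  define r where "r x = h ?U x b - h ?U' x b - h ?U' x c * h ?U c b" for x
  have r: "r x = (\<Sum>y\<in>Y. W x y * r y)" if x: "x \<in> Y" for x
  proof -
    have "V - ?U = insert c Y" "c \<notin> Y" using abc by (auto simp: Y_def)
    hence 1: "h ?U x b = W x b + (W x c * h ?U c b + (\<Sum>y\<in>Y. W x y * h ?U y b))"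
      using hit_step[of x b ?U] x abc finite_interior by (auto simp: Y_def)
    have 2: "h ?U' x b = W x b + (\<Sum>y\<in>Y. W x y * h ?U' y b)" "h ?U' x c = W x c + (\<Sum>y\<in>Y. W x y * h ?U' y c)"
      using hit_step[of x b ?U'] hit_step[of x c ?U'] x abc by (auto simp: Y_def)
    show ?thesis unfolding r_def 1
      by (subst 2, subst 2) (simp add: algebra_simps sum_subtractf sum_distrib_left)
  qed
  have a: "a \<in> Y" using abc by (auto simp: Y_def)
  have YV: "Y \<subseteq> V" by (auto simp: Y_def)
  have "r a \<le> 0" using YV eq_refl[OF r] a by (rule maximum_principle)
  moreover have "- r a \<le> 0"
  proof (rule maximum_principle[of Y "\<lambda>x. - r x" a])
    fix x assume "x \<in> Y"
    from r[OF this] show "- r x \<le> (\<Sum>y\<in>Y. W x y * - r y)" by (simp add: sum_negf)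
  qed (fact YV, fact a)
  ultimately show ?thesis by (simp add: r_def)
qed

text \<open>The off-diagonal entry of \<open>M\<^sub>\<tau>\<close> when \<open>U\<close> is the set
  of sites of \<open>\<tau>\<close>.\<close>

definition infl :: "'v set \<Rightarrow> 'v \<Rightarrow> 'v \<Rightarrow> real" where
  "infl U u v = sqrt (h (insert v U) u v * h (insert u U) v u)"

lemma infl_commute: "infl U u v = infl U v u"
  by (simp add: infl_def mult.commute)

lemma infl_nonneg: "infl U u v \<ge> 0"
  by (simp add: infl_def hit_nonneg)

text \<open>The direct step is one of the walks counted on the right. This connects the eigenvalue
  hypothesis in codimension 2 with hitting probabilities.\<close>

lemma infl_ge:
  assumes "u \<in> V - U" "v \<in> V - U" "u \<noteq> v"
  shows "sqrt (W u v * W v u) \<le> infl U u v"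
proof -
  have "W x y \<le> h (insert y U) x y" if "x \<in> V" "y \<in> V" "x \<noteq> y" for x y
  proof -
    have "h (insert y U) x y = W x y + (\<Sum>z\<in>V - insert y U. W x z * h (insert y U) z y)"
      using that by (intro hit_step) auto
    thus ?thesis using that W_nonneg hit_nonneg by (auto intro!: sum_nonneg mult_nonneg_nonneg)
  qed
  thus ?thesis unfolding infl_def using assms W_nonneg hit_nonneg by (intro real_sqrt_le_mono mult_mono) auto
qed

text \<open>A single hitting probability can be 1, but in the product of both directions the factors
  \<open>\<psi> u / \<psi> v\<close> and \<open>\<psi> v / \<psi> u\<close> cancel, and the strict
  inequality remains.\<close>

lemma infl_less_1:
  assumes "u \<in> V - U" "v \<in> V - U" "u \<noteq> v"
  shows "infl U u v < 1"
proof -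
  obtain \<psi> where \<psi>: "\<And>x. x \<in> V \<union> B \<Longrightarrow> 0 < \<psi> x" "\<And>x. x \<in> V \<Longrightarrow> (\<Sum>y\<in>V \<union> B. W x y * \<psi> y) < \<psi> x"
    using superharmonic_exists by blast
  have "h (insert v U) u v * \<psi> v < \<psi> u" "h (insert u U) v u * \<psi> u < \<psi> v"
    using hit_below_superharmonic[of \<psi> "{v}" u U, OF \<psi>] hit_below_superharmonic[of \<psi> "{u}" v U, OF \<psi>] assms
    by auto
  hence "(h (insert v U) u v * \<psi> v) * (h (insert u U) v u * \<psi> u) < \<psi> u * \<psi> v"
    using \<psi>(1) assms hit_nonneg by (intro mult_strict_mono') (auto simp: less_imp_le)
  hence "(h (insert v U) u v * h (insert u U) v u) * (\<psi> u * \<psi> v) < 1 * (\<psi> u * \<psi> v)"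
    by (simp add: algebra_simps)
  hence "h (insert v U) u v * h (insert u U) v u < 1"
    using \<psi>(1)[of u] \<psi>(1)[of v] assms mult_less_cancel_right_pos[of "\<psi> u * \<psi> v"] by auto
  thus ?thesis unfolding infl_def by simp
qed

end

text \<open>The claim is that the identity minus a matrix with zero diagonal has positive
  determinant. Adding all columns to the first puts the row defects there; expansion along it
  combines them with nonnegative cofactors, the first of which is positive.\<close>

lemma substochastic_det3_pos:
  fixes p12 p13 p21 p23 p31 p32 :: real
  assumes "p12 \<ge> 0" "p13 \<ge> 0" "p21 \<ge> 0" "p23 \<ge> 0" "p31 \<ge> 0" "p32 \<ge> 0"
    and "p12 + p13 < 1" "p21 + p23 < 1" "p31 + p32 < 1"
  shows "p12 * p21 + p13 * p31 + p23 * p32 + p12 * p23 * p31 + p13 * p32 * p21 < 1"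
proof -
  have "p23 * p32 < 1 * 1" using assms by (intro mult_strict_mono') auto
  hence "(1 - p12 - p13) * (1 - p23 * p32) > 0" using assms by (intro mult_pos_pos) auto
  moreover have "(1 - p21 - p23) * (p12 + p13 * p32) \<ge> 0" "(1 - p31 - p32) * (p13 + p12 * p23) \<ge> 0"
    using assms by (auto intro!: mult_nonneg_nonneg add_nonneg_nonneg)
  moreover have "1 - (p12 * p21 + p13 * p31 + p23 * p32 + p12 * p23 * p31 + p13 * p32 * p21)
    = (1 - p12 - p13) * (1 - p23 * p32) + (1 - p21 - p23) * (p12 + p13 * p32) + (1 - p31 - p32) * (p13 + p12 * p23)"
    by (simp add: algebra_simps)
  ultimately show ?thesis by linarith
qed

lemma sqrt_AM_GM: "x \<ge> 0 \<Longrightarrow> y \<ge> 0 \<Longrightarrow> 2 * sqrt (x * y) \<le> x + y"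
  using arith_geo_mean_sqrt[of x y] by simp

context absorbing_walk
begin

text \<open>The squares of \<open>k0\<close>, \<open>k1\<close>, \<open>k2\<close> are exactly the
  two-cycle products of hitting probabilities. Only the three-cycles differ:
  \<open>k0 * k1 * k2\<close> is the geometric mean of the two orientations, where hitting
  probabilities produce their arithmetic mean, and this favours both inequalities.\<close>

lemma infl_three:
  assumes abc: "a \<in> V - U" "b \<in> V - U" "c \<in> V - U" "a \<noteq> b" "a \<noteq> c" "b \<noteq> c"
  defines "k0 \<equiv> infl (insert a U) b c" and "k1 \<equiv> infl (insert b U) a c" and "k2 \<equiv> infl (insert c U) a b"
  shows "k0\<^sup>2 + k1\<^sup>2 + k2\<^sup>2 + 2 * k0 * k1 * k2 < 1"
    and "(k2 + k0 * k1) / sqrt ((1 - k0\<^sup>2) * (1 - k1\<^sup>2)) \<le> infl U a b"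
proof -
  define pab pac pba pbc pca pcb where p:
    "pab = h (insert b (insert c U)) a b" "pac = h (insert b (insert c U)) a c"
    "pba = h (insert a (insert c U)) b a" "pbc = h (insert a (insert c U)) b c"
    "pca = h (insert a (insert b U)) c a" "pcb = h (insert a (insert b U)) c b"
  have nn: "pab \<ge> 0" "pac \<ge> 0" "pba \<ge> 0" "pbc \<ge> 0" "pca \<ge> 0" "pcb \<ge> 0" unfolding p by (rule hit_nonneg)+
  have k: "k0 = sqrt (pbc * pcb)" "k1 = sqrt (pac * pca)" "k2 = sqrt (pab * pba)"
    unfolding k0_def k1_def k2_def infl_def p by (simp_all add: insert_commute)
  have ksq: "k0\<^sup>2 = pbc * pcb" "k1\<^sup>2 = pac * pca" "k2\<^sup>2 = pab * pba" unfolding k using nn by simp_all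
  obtain \<psi> where \<psi>: "\<And>x. x \<in> V \<union> B \<Longrightarrow> 0 < \<psi> x" "\<And>x. x \<in> V \<Longrightarrow> (\<Sum>y\<in>V \<union> B. W x y * \<psi> y) < \<psi> x"
    using superharmonic_exists by blast
  have pos: "\<psi> a > 0" "\<psi> b > 0" "\<psi> c > 0" using \<psi>(1) abc by auto
  have rows: "pab * \<psi> b + pac * \<psi> c < \<psi> a" "pba * \<psi> a + pbc * \<psi> c < \<psi> b" "pca * \<psi> a + pcb * \<psi> b < \<psi> c"
    using hit_below_superharmonic[of \<psi> "{b, c}" a U, OF \<psi>] hit_below_superharmonic[of \<psi> "{a, c}" b U, OF \<psi>]
      hit_below_superharmonic[of \<psi> "{a, b}" c U, OF \<psi>] abc unfolding p by simp_all
  \<comment> \<open>Conjugation by \<open>\<psi>\<close> makes the rows strictly substochastic and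
    leaves every cyclic product unchanged.\<close>
  have "(pab * \<psi> b / \<psi> a) * (pba * \<psi> a / \<psi> b) + (pac * \<psi> c / \<psi> a) * (pca * \<psi> a / \<psi> c)
      + (pbc * \<psi> c / \<psi> b) * (pcb * \<psi> b / \<psi> c)
      + (pab * \<psi> b / \<psi> a) * (pbc * \<psi> c / \<psi> b) * (pca * \<psi> a / \<psi> c)
      + (pac * \<psi> c / \<psi> a) * (pcb * \<psi> b / \<psi> c) * (pba * \<psi> a / \<psi> b) < 1"
    by (rule substochastic_det3_pos) (use nn pos rows in \<open>simp_all add: field_simps\<close>)
  hence det: "pab * pba + pac * pca + pbc * pcb + pab * pbc * pca + pac * pcb * pba < 1"
    using pos by simp
  have "2 * (k0 * k1 * k2) = 2 * sqrt ((pab * pbc * pca) * (pac * pcb * pba))"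
    unfolding k real_sqrt_mult[symmetric] by (simp add: mult_ac)
  also have "\<dots> \<le> pab * pbc * pca + pac * pcb * pba" using nn by (intro sqrt_AM_GM) auto
  finally show "k0\<^sup>2 + k1\<^sup>2 + k2\<^sup>2 + 2 * k0 * k1 * k2 < 1" using det unfolding ksq by simp
  have "pab * pbc * pca + pac * pcb * pba \<ge> 0" "pab * pba \<ge> 0" "pac * pca \<ge> 0" "pbc * pcb \<ge> 0" using nn by simp_all
  hence lt1: "pac * pca < 1" "pbc * pcb < 1" using det by linarith+
  \<comment> \<open>If \<open>c\<close> is visited before \<open>b\<close>, the walk may return from
    \<open>c\<close> to \<open>a\<close>, so the probability reappears on the right. The solution is
    the formula of \<open>hit\<close> with unsymmetric entries.\<close>
  have "h (insert b U) a b = pab + pac * (pcb + pca * h (insert b U) a b)"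
    using hit_markov[of a U b c] hit_markov[of c U b a] abc unfolding p by (simp add: insert_commute)
  hence hab: "h (insert b U) a b = (pab + pac * pcb) / (1 - pac * pca)" using lt1 by (simp add: field_simps)
  have "h (insert a U) b a = pba + pbc * (pca + pcb * h (insert a U) b a)"
    using hit_markov[of b U a c] hit_markov[of c U a b] abc unfolding p by (simp add: insert_commute)
  hence hba: "h (insert a U) b a = (pba + pbc * pca) / (1 - pbc * pcb)" using lt1 by (simp add: field_simps)
  have "(k2 + k0 * k1)\<^sup>2 = pab * pba + (pbc * pcb) * (pac * pca) + 2 * (k0 * k1 * k2)"
    by (simp add: power2_sum power_mult_distrib ksq mult_ac)
  also have "\<dots> \<le> pab * pba + (pbc * pcb) * (pac * pca) + (pab * pbc * pca + pac * pcb * pba)"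
    using \<open>2 * (k0 * k1 * k2) = _\<close> \<open>2 * sqrt _ \<le> _\<close> by simp
  also have "\<dots> = (pab + pac * pcb) * (pba + pbc * pca)" by (simp add: algebra_simps)
  finally have num: "k2 + k0 * k1 \<le> sqrt ((pab + pac * pcb) * (pba + pbc * pca))" by (rule real_le_rsqrt)
  have "(k2 + k0 * k1) / sqrt ((1 - k0\<^sup>2) * (1 - k1\<^sup>2))
    \<le> sqrt ((pab + pac * pcb) * (pba + pbc * pca)) / sqrt ((1 - k0\<^sup>2) * (1 - k1\<^sup>2))"
    using num lt1 by (intro divide_right_mono) (auto simp: ksq)
  also have "\<dots> = infl U a b"
    unfolding infl_def hab hba ksq real_sqrt_divide[symmetric] by (simp add: mult.commute)
  finally show "(k2 + k0 * k1) / sqrt ((1 - k0\<^sup>2) * (1 - k1\<^sup>2)) \<le> infl U a b" .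
qed

end


section \<open>Links of partite complexes\<close>

context partite_complex
begin

text \<open>The random variable \<open>X\<^sub>v\<close> of the overview; it is meaningful for
  facets \<open>\<omega>\<close> and sites \<open>v \<in> V\<close>.\<close>

definition spin :: "'s set \<Rightarrow> 'v \<Rightarrow> 's" where
  "spin \<omega> v = (THE x. x \<in> \<omega> \<inter> S v)"

definition star :: "'s set \<Rightarrow> 's set set" where
  "star \<tau> = {\<omega> \<in> facets X. \<tau> \<subseteq> \<omega>}"

abbreviation free :: "'s set \<Rightarrow> 'v set" where
  "free \<tau> \<equiv> V - sites_of V S \<tau>"

lemma finite_X: "finite X"
proof (rule finite_subset)
  show "X \<subseteq> Pow (\<Union>v\<in>V. S v)" using faces_subset by blast
  show "finite (Pow (\<Union>v\<in>V. S v))" using finite_sites finite_spins by auto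
qed

lemma finite_star: "finite (star \<tau>)"
  using finite_X by (simp add: star_def facets_def)

lemma star_pos: "\<omega> \<in> star \<tau> \<Longrightarrow> \<mu> \<omega> > 0"
  using facet_pos by (simp add: star_def)

lemma spin_eqI: "\<omega> \<in> facets X \<Longrightarrow> v \<in> V \<Longrightarrow> x \<in> \<omega> \<Longrightarrow> x \<in> S v \<Longrightarrow> spin \<omega> v = x"
  unfolding spin_def using facet_spin by (intro the1_equality) auto

lemma spin_mem: "\<omega> \<in> facets X \<Longrightarrow> v \<in> V \<Longrightarrow> spin \<omega> v \<in> \<omega> \<and> spin \<omega> v \<in> S v"
  using theI'[OF facet_spin, of \<omega> v] by (simp add: spin_def)

lemma site_unique: "x \<in> S u \<Longrightarrow> x \<in> S v \<Longrightarrow> u \<in> V \<Longrightarrow> v \<in> V \<Longrightarrow> u = v"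
  using disjoint_spins by (auto simp: disjoint_family_on_def)

lemma star_nonempty:
  assumes "\<tau> \<in> X" shows "star \<tau> \<noteq> {}"
proof -
  obtain \<omega> where \<omega>: "\<omega> \<in> X" "\<tau> \<subseteq> \<omega>" "\<forall>\<rho>\<in>X. \<omega> \<subseteq> \<rho> \<longrightarrow> \<omega> = \<rho>"
    using finite_has_maximal2[OF finite_X assms] by auto
  hence "\<omega> \<in> star \<tau>" by (auto simp: star_def facets_def)
  thus ?thesis by blast
qed

lemma star_diff:
  assumes "\<omega> \<in> star \<tau>"
  shows "bij_betw (spin \<omega>) (free \<tau>) (\<omega> - \<tau>)"
proof (rule bij_betwI')
  have \<omega>: "\<omega> \<in> facets X" "\<tau> \<subseteq> \<omega>" "\<omega> \<in> X" using assms by (auto simp: star_def facets_def)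
  show "spin \<omega> u = spin \<omega> v \<longleftrightarrow> u = v" if "u \<in> free \<tau>" "v \<in> free \<tau>" for u v
    using spin_mem[OF \<omega>(1)] site_unique that by (metis DiffD1)
  show "spin \<omega> v \<in> \<omega> - \<tau>" if "v \<in> free \<tau>" for v
    using spin_mem[OF \<omega>(1), of v] that by (auto simp: sites_of_def)
  show "\<exists>v\<in>free \<tau>. x = spin \<omega> v" if x: "x \<in> \<omega> - \<tau>" for x
  proof -
    obtain v where v: "v \<in> V" "x \<in> S v" using faces_subset[OF \<omega>(3)] x by auto
    have "S v \<inter> \<tau> = {}"
    proof (rule ccontr)
      assume "S v \<inter> \<tau> \<noteq> {}"
      then obtain y where "y \<in> S v" "y \<in> \<tau>" by blast
      hence "x = y" using spin_eqI[OF \<omega>(1) v(1)] v x \<omega>(2) by blast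
      thus False using x \<open>y \<in> \<tau>\<close> by simp
    qed
    hence "v \<in> free \<tau>" using v by (auto simp: sites_of_def)
    moreover have "x = spin \<omega> v" using spin_eqI[OF \<omega>(1) v(1), of x] v x by simp
    ultimately show ?thesis by blast
  qed
qed

lemma card_free:
  assumes "\<tau> \<in> X" shows "card (free \<tau>) = codim V \<tau>"
proof -
  obtain \<omega> where \<omega>: "\<omega> \<in> star \<tau>" using star_nonempty[OF assms] by blast
  hence "\<omega> \<in> star {}" by (auto simp: star_def)
  moreover have "free {} = V" by (auto simp: sites_of_def)
  ultimately have "card \<omega> = card V" using bij_betw_same_card[OF star_diff, of \<omega> "{}"] by simp
  moreover have "finite \<omega>" using \<omega> finite_X faces_subset[of \<omega>] finite_sites finite_spins
    by (auto simp: star_def facets_def intro!: finite_subset[of \<omega> "\<Union>v\<in>V. S v"])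
  moreover have "\<tau> \<subseteq> \<omega>" using \<omega> by (auto simp: star_def)
  ultimately show ?thesis using bij_betw_same_card[OF star_diff[OF \<omega>]]
    by (simp add: codim_def card_Diff_subset finite_subset)
qed

lemma link_vertices_eq: 
  assumes "\<tau> \<in> X"
  shows "link_vertices X \<tau> = (\<Union>\<omega>\<in>star \<tau>. \<omega> - \<tau>)"
proof (intro equalityI subsetI)
  fix x assume "x \<in> link_vertices X \<tau>"
  then obtain \<sigma> where "\<sigma> \<in> X" "\<tau> \<subseteq> \<sigma>" "\<sigma> - \<tau> = {x}"
    by (auto simp: link_vertices_def faces_of_size_def link_def)
  moreover then obtain \<omega> where "\<omega> \<in> star \<sigma>" using star_nonempty by blast
  ultimately show "x \<in> (\<Union>\<omega>\<in>star \<tau>. \<omega> - \<tau>)" by (auto simp: star_def)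
next
  fix x assume "x \<in> (\<Union>\<omega>\<in>star \<tau>. \<omega> - \<tau>)"
  then obtain \<omega> where "\<omega> \<in> X" "\<tau> \<subseteq> \<omega>" "x \<in> \<omega>" "x \<notin> \<tau>" by (auto simp: star_def facets_def)
  hence "insert x \<tau> \<in> X" "insert x \<tau> - \<tau> = {x}" using faces_down_closed[of \<omega> "insert x \<tau>"] by auto
  thus "x \<in> link_vertices X \<tau>"
    by (auto simp: link_vertices_def faces_of_size_def link_def intro!: exI[of _ "insert x \<tau>"])
qed

lemma link_edges_iff:
  assumes "\<tau> \<in> X"
  shows "(x, y) \<in> link_edges X \<tau> \<longleftrightarrow> x \<noteq> y \<and> (\<exists>\<omega>\<in>star \<tau>. x \<in> \<omega> - \<tau> \<and> y \<in> \<omega> - \<tau>)"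
proof
  assume "(x, y) \<in> link_edges X \<tau>"
  then obtain \<sigma> where \<sigma>: "\<sigma> \<in> X" "\<tau> \<subseteq> \<sigma>" "\<sigma> - \<tau> = {x, y}" "card {x, y} = 2"
    by (auto simp: link_edges_def faces_of_size_def link_def)
  then obtain \<omega> where "\<omega> \<in> star \<sigma>" using star_nonempty by blast
  hence "\<omega> \<in> star \<tau>" "x \<in> \<omega> - \<tau>" "y \<in> \<omega> - \<tau>" using \<sigma> by (auto simp: star_def)
  moreover have "x \<noteq> y" using \<sigma>(4) by auto
  ultimately show "x \<noteq> y \<and> (\<exists>\<omega>\<in>star \<tau>. x \<in> \<omega> - \<tau> \<and> y \<in> \<omega> - \<tau>)" by blast
next
  assume "x \<noteq> y \<and> (\<exists>\<omega>\<in>star \<tau>. x \<in> \<omega> - \<tau> \<and> y \<in> \<omega> - \<tau>)"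
  then obtain \<omega> where "x \<noteq> y" "\<omega> \<in> X" "\<tau> \<subseteq> \<omega>" "x \<in> \<omega> - \<tau>" "y \<in> \<omega> - \<tau>" by (auto simp: star_def facets_def)
  moreover hence "insert x (insert y \<tau>) \<in> X" "insert x (insert y \<tau>) - \<tau> = {x, y}"
    using faces_down_closed[of \<omega> "insert x (insert y \<tau>)"] by auto
  ultimately show "(x, y) \<in> link_edges X \<tau>"
    by (auto simp: link_edges_def faces_of_size_def link_def intro!: exI[of _ "insert x (insert y \<tau>)"])
qed

lemma link_weight_eq:
  assumes "\<tau> \<in> X" "x \<notin> \<tau>" "y \<notin> \<tau>"
  shows "link_weight X \<mu> \<tau> x y = (\<Sum>\<omega>\<in>star \<tau>. if x \<in> \<omega> - \<tau> \<and> y \<in> \<omega> - \<tau> \<and> x \<noteq> y then \<mu> \<omega> else 0)"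
proof (cases "(x, y) \<in> link_edges X \<tau>")
  case True
  hence "{\<omega>. \<omega> \<in> facets X \<and> \<tau> \<union> {x, y} \<subseteq> \<omega>} = {\<omega> \<in> star \<tau>. x \<in> \<omega> - \<tau> \<and> y \<in> \<omega> - \<tau> \<and> x \<noteq> y}"
    using assms by (auto simp: link_edges_iff star_def)
  thus ?thesis using True finite_star by (simp add: link_weight_def sum.inter_filter)
next
  case False
  hence "(\<Sum>\<omega>\<in>star \<tau>. if x \<in> \<omega> - \<tau> \<and> y \<in> \<omega> - \<tau> \<and> x \<noteq> y then \<mu> \<omega> else 0) = 0"
    using assms by (intro sum.neutral) (auto simp: link_edges_iff)
  thus ?thesis using False by (simp add: link_weight_def)
qed

lemma finite_link_vertices:
  assumes "\<tau> \<in> X" shows "finite (link_vertices X \<tau>)"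
proof (rule finite_subset)
  have "\<omega> \<subseteq> (\<Union>v\<in>V. S v)" if "\<omega> \<in> star \<tau>" for \<omega>
    using that by (intro faces_subset) (simp add: star_def facets_def)
  thus "link_vertices X \<tau> \<subseteq> (\<Union>v\<in>V. S v)" unfolding link_vertices_eq[OF assms] by blast
  show "finite (\<Union>v\<in>V. S v)" using finite_sites finite_spins by auto
qed

text \<open>Double counting of pairs consisting of a facet and an ordered edge inside it; this
  translates sums over the graph into moments of spins.\<close>

lemma sum_link_weight:
  assumes "\<tau> \<in> X"
  shows "(\<Sum>x\<in>link_vertices X \<tau>. \<Sum>y\<in>link_vertices X \<tau>. link_weight X \<mu> \<tau> x y * F x y)
    = (\<Sum>\<omega>\<in>star \<tau>. \<mu> \<omega> * (\<Sum>u\<in>free \<tau>. \<Sum>v\<in>free \<tau> - {u}. F (spin \<omega> u) (spin \<omega> v)))"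
proof -
  let ?A = "link_vertices X \<tau>"
  have fin: "finite ?A" by (rule finite_link_vertices[OF assms])
  have notin: "x \<notin> \<tau>" if "x \<in> ?A" for x using that by (auto simp: link_vertices_eq[OF assms])
  have "(\<Sum>x\<in>?A. \<Sum>y\<in>?A. link_weight X \<mu> \<tau> x y * F x y)
    = (\<Sum>x\<in>?A. \<Sum>y\<in>?A. \<Sum>\<omega>\<in>star \<tau>. (if x \<in> \<omega> - \<tau> \<and> y \<in> \<omega> - \<tau> \<and> x \<noteq> y then \<mu> \<omega> * F x y else 0))"
    using notin by (intro sum.cong refl)
      (simp add: link_weight_eq[OF assms] sum_distrib_right if_distrib[of "\<lambda>t. t * _"] cong: if_cong)
  also have "\<dots> = (\<Sum>x\<in>?A. \<Sum>\<omega>\<in>star \<tau>. \<Sum>y\<in>?A. (if x \<in> \<omega> - \<tau> \<and> y \<in> \<omega> - \<tau> \<and> x \<noteq> y then \<mu> \<omega> * F x y else 0))"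
    by (intro sum.cong refl sum.swap)
  also have "\<dots> = (\<Sum>\<omega>\<in>star \<tau>. \<Sum>x\<in>?A. \<Sum>y\<in>?A. (if x \<in> \<omega> - \<tau> \<and> y \<in> \<omega> - \<tau> \<and> x \<noteq> y then \<mu> \<omega> * F x y else 0))"
    by (rule sum.swap)
  also have "\<dots> = (\<Sum>\<omega>\<in>star \<tau>. \<mu> \<omega> * (\<Sum>u\<in>free \<tau>. \<Sum>v\<in>free \<tau> - {u}. F (spin \<omega> u) (spin \<omega> v)))"
  proof (intro sum.cong refl)
    fix \<omega> assume \<omega>: "\<omega> \<in> star \<tau>"
    have sub: "\<omega> - \<tau> \<subseteq> ?A" using \<omega> by (auto simp: link_vertices_eq[OF assms])
    have bij: "bij_betw (spin \<omega>) (free \<tau>) (\<omega> - \<tau>)" by (rule star_diff[OF \<omega>])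
    have "(\<Sum>x\<in>?A. \<Sum>y\<in>?A. (if x \<in> \<omega> - \<tau> \<and> y \<in> \<omega> - \<tau> \<and> x \<noteq> y then \<mu> \<omega> * F x y else 0))
      = (\<Sum>x\<in>\<omega> - \<tau>. \<Sum>y\<in>?A. (if x \<in> \<omega> - \<tau> \<and> y \<in> \<omega> - \<tau> \<and> x \<noteq> y then \<mu> \<omega> * F x y else 0))"
      using fin sub by (intro sum.mono_neutral_right ballI sum.neutral) auto
    also have "\<dots> = (\<Sum>x\<in>\<omega> - \<tau>. \<Sum>y\<in>\<omega> - \<tau> - {x}. \<mu> \<omega> * F x y)"
      using fin sub by (intro sum.cong refl sum.mono_neutral_cong_right) auto
    also have "\<dots> = (\<Sum>u\<in>free \<tau>. \<Sum>y\<in>\<omega> - \<tau> - {spin \<omega> u}. \<mu> \<omega> * F (spin \<omega> u) y)"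
      by (rule sum.reindex_bij_betw[OF bij, symmetric])
    also have "\<dots> = (\<Sum>u\<in>free \<tau>. \<Sum>v\<in>free \<tau> - {u}. \<mu> \<omega> * F (spin \<omega> u) (spin \<omega> v))"
    proof (intro sum.cong refl)
      fix u assume "u \<in> free \<tau>"
      hence "bij_betw (spin \<omega>) (free \<tau> - {u}) (\<omega> - \<tau> - {spin \<omega> u})"
        using bij_betw_DiffI[OF bij, of "{u}" "{spin \<omega> u}"] bij by (auto simp: bij_betw_def)
      thus "(\<Sum>y\<in>\<omega> - \<tau> - {spin \<omega> u}. \<mu> \<omega> * F (spin \<omega> u) y) = (\<Sum>v\<in>free \<tau> - {u}. \<mu> \<omega> * F (spin \<omega> u) (spin \<omega> v))"
        by (rule sum.reindex_bij_betw[symmetric])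
    qed
    finally show "(\<Sum>x\<in>?A. \<Sum>y\<in>?A. (if x \<in> \<omega> - \<tau> \<and> y \<in> \<omega> - \<tau> \<and> x \<noteq> y then \<mu> \<omega> * F x y else 0))
      = \<mu> \<omega> * (\<Sum>u\<in>free \<tau>. \<Sum>v\<in>free \<tau> - {u}. F (spin \<omega> u) (spin \<omega> v))"
      by (simp add: sum_distrib_left)
  qed
  finally show ?thesis .
qed

section \<open>Quadratic forms of the link walk as moments of the spins\<close>

definition link_deg :: "'s set \<Rightarrow> 's \<Rightarrow> real" where
  "link_deg \<tau> x = (\<Sum>y\<in>link_vertices X \<tau>. link_weight X \<mu> \<tau> x y)"

lemma bil_link_weight:
  assumes "\<tau> \<in> X"
  shows "bil (link_vertices X \<tau>) (link_weight X \<mu> \<tau>) f f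
    = (\<Sum>u\<in>free \<tau>. \<Sum>v\<in>free \<tau> - {u}. \<Sum>\<omega>\<in>star \<tau>. \<mu> \<omega> * f (spin \<omega> u) * f (spin \<omega> v))"
proof -
  have "bil (link_vertices X \<tau>) (link_weight X \<mu> \<tau>) f f
    = (\<Sum>\<omega>\<in>star \<tau>. \<Sum>u\<in>free \<tau>. \<Sum>v\<in>free \<tau> - {u}. \<mu> \<omega> * f (spin \<omega> u) * f (spin \<omega> v))"
    using sum_link_weight[OF assms, of "\<lambda>x y. f x * f y"] by (simp add: bil_def sum_distrib_left mult.assoc)
  also have "\<dots> = (\<Sum>u\<in>free \<tau>. \<Sum>\<omega>\<in>star \<tau>. \<Sum>v\<in>free \<tau> - {u}. \<mu> \<omega> * f (spin \<omega> u) * f (spin \<omega> v))"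
    by (rule sum.swap)
  also have "\<dots> = (\<Sum>u\<in>free \<tau>. \<Sum>v\<in>free \<tau> - {u}. \<Sum>\<omega>\<in>star \<tau>. \<mu> \<omega> * f (spin \<omega> u) * f (spin \<omega> v))"
    by (intro sum.cong refl sum.swap)
  finally show ?thesis .
qed

text \<open>Each free spin of a facet is joined to the \<open>codim V \<tau> - 1\<close> other ones,
  which is the origin of the denominator in the theorem.\<close>

lemma ip_link_deg:
  assumes "\<tau> \<in> X" "codim V \<tau> \<ge> 1"
  shows "ip (link_vertices X \<tau>) (link_deg \<tau>) f g
    = (real (codim V \<tau>) - 1) * (\<Sum>u\<in>free \<tau>. \<Sum>\<omega>\<in>star \<tau>. \<mu> \<omega> * (f (spin \<omega> u) * g (spin \<omega> u)))"
proof -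
  have "ip (link_vertices X \<tau>) (link_deg \<tau>) f g
    = (\<Sum>x\<in>link_vertices X \<tau>. \<Sum>y\<in>link_vertices X \<tau>. link_weight X \<mu> \<tau> x y * (f x * g x))"
    by (simp add: ip_def link_deg_def sum_distrib_right mult.assoc)
  also have "\<dots> = (\<Sum>\<omega>\<in>star \<tau>. \<mu> \<omega> * (\<Sum>u\<in>free \<tau>. \<Sum>v\<in>free \<tau> - {u}. f (spin \<omega> u) * g (spin \<omega> u)))"
    by (rule sum_link_weight[OF assms(1)])
  also have "\<dots> = (\<Sum>\<omega>\<in>star \<tau>. \<mu> \<omega> * (\<Sum>u\<in>free \<tau>. (real (codim V \<tau>) - 1) * (f (spin \<omega> u) * g (spin \<omega> u))))"
    using assms card_free[OF assms(1)] finite_sites by (simp add: of_nat_diff)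
  also have "\<dots> = (real (codim V \<tau>) - 1) * (\<Sum>\<omega>\<in>star \<tau>. \<Sum>u\<in>free \<tau>. \<mu> \<omega> * (f (spin \<omega> u) * g (spin \<omega> u)))"
    by (simp add: sum_distrib_left mult.left_commute)
  finally show ?thesis by (subst sum.swap)
qed

lemma weighted_graph_link:
  assumes "\<tau> \<in> X" "codim V \<tau> \<ge> 2"
  shows "weighted_graph (link_vertices X \<tau>) (link_weight X \<mu> \<tau>) (link_deg \<tau>)"
proof
  let ?A = "link_vertices X \<tau>"
  show fin: "finite ?A" by (rule finite_link_vertices[OF assms(1)])
  have notin: "x \<notin> \<tau>" if "x \<in> ?A" for x using that by (auto simp: link_vertices_eq[OF assms(1)])
  show "link_weight X \<mu> \<tau> x y = link_weight X \<mu> \<tau> y x" if "x \<in> ?A" "y \<in> ?A" for x y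
    using that notin by (simp add: link_weight_eq[OF assms(1)]) (intro sum.cong refl, auto)
  show nonneg: "link_weight X \<mu> \<tau> x y \<ge> 0" if "x \<in> ?A" "y \<in> ?A" for x y
    using that notin star_pos[THEN less_imp_le] by (simp add: link_weight_eq[OF assms(1)]) (intro sum_nonneg, auto)
  show "link_deg \<tau> x = (\<Sum>y\<in>?A. link_weight X \<mu> \<tau> x y)" for x by (simp add: link_deg_def)
  have card: "card (\<omega> - \<tau>) \<ge> 2" if "\<omega> \<in> star \<tau>" for \<omega>
    using bij_betw_same_card[OF star_diff[OF that]] card_free[OF assms(1)] assms(2) by simp
  obtain \<omega> where \<omega>: "\<omega> \<in> star \<tau>" using star_nonempty[OF assms(1)] by blast
  have "\<omega> - \<tau> \<subseteq> ?A" using \<omega> by (auto simp: link_vertices_eq[OF assms(1)])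
  thus "card ?A \<ge> 2" using card[OF \<omega>] card_mono[OF fin] by (meson le_trans)
  show "link_deg \<tau> x > 0" if x: "x \<in> ?A" for x
  proof -
    obtain \<omega> where \<omega>: "\<omega> \<in> star \<tau>" "x \<in> \<omega> - \<tau>" using x by (auto simp: link_vertices_eq[OF assms(1)])
    have "\<not> \<omega> - \<tau> \<subseteq> {x}" using card[OF \<omega>(1)] card_mono[of "{x}" "\<omega> - \<tau>"] by auto
    then obtain y where y: "y \<in> \<omega> - \<tau>" "y \<noteq> x" by blast
    have yA: "y \<in> ?A" using \<omega> y by (auto simp: link_vertices_eq[OF assms(1)])
    have "0 < (\<Sum>\<omega>\<in>star \<tau>. if x \<in> \<omega> - \<tau> \<and> y \<in> \<omega> - \<tau> \<and> x \<noteq> y then \<mu> \<omega> else 0)"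
      using \<omega> y finite_star star_pos by (intro sum_pos2[of _ \<omega>]) (auto intro: less_imp_le)
    hence "0 < link_weight X \<mu> \<tau> x y" using \<omega> y by (simp add: link_weight_eq[OF assms(1)])
    thus ?thesis unfolding link_deg_def using fin yA nonneg x by (intro sum_pos2[of _ y]) auto
  qed
qed

lemma link_walk_eq:
  "link_walk X \<mu> \<tau> = mat_on (link_vertices X \<tau>) (\<lambda>x y. link_weight X \<mu> \<tau> x y / link_deg \<tau> x)"
  by (simp add: link_walk_def link_deg_def)

text \<open>The link is bipartite, so \<open>f\<close> and \<open>g\<close> glue to one function
  \<open>F\<close> on its vertices. The form at \<open>F\<close> is twice the covariance and its
  norm is the sum of the variances, so the Rayleigh bound becomes the correlation bound.\<close>

lemma codim2_corr_le:
  assumes \<tau>: "\<tau> \<in> X" and uv: "free \<tau> = {u, v}" "u \<noteq> v"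
  shows "corr_le (star \<tau>) \<mu> (\<lambda>\<omega>. spin \<omega> u) (\<lambda>\<omega>. spin \<omega> v) (lambda2 (link_walk X \<mu> \<tau>))"
  unfolding corr_le_def
proof (intro allI impI)
  fix f g :: "'s \<Rightarrow> real"
  assume mean: "(\<Sum>\<omega>\<in>star \<tau>. \<mu> \<omega> * f (spin \<omega> u)) = 0" "(\<Sum>\<omega>\<in>star \<tau>. \<mu> \<omega> * g (spin \<omega> v)) = 0"
  have codim: "codim V \<tau> = 2" using card_free[OF \<tau>] uv by simp
  interpret weighted_graph "link_vertices X \<tau>" "link_weight X \<mu> \<tau>" "link_deg \<tau>"
    using codim by (intro weighted_graph_link[OF \<tau>]) simp
  define F where "F x = (if x \<in> S u then f x else g x)" for x
  have uvV: "u \<in> V" "v \<in> V" using uv by auto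
  have Fu: "F (spin \<omega> u) = f (spin \<omega> u)" if "\<omega> \<in> star \<tau>" for \<omega>
    using spin_mem[of \<omega> u] that uvV by (simp add: F_def star_def)
  have Fv: "F (spin \<omega> v) = g (spin \<omega> v)" if "\<omega> \<in> star \<tau>" for \<omega>
    using spin_mem[of \<omega> v] site_unique[of "spin \<omega> v" u v] that uvV uv(2) by (auto simp: F_def star_def)
  have diff: "free \<tau> - {u} = {v}" "free \<tau> - {v} = {u}" using uv by auto
  have ipF: "ip (link_vertices X \<tau>) (link_deg \<tau>) F k
      = (\<Sum>\<omega>\<in>star \<tau>. \<mu> \<omega> * (f (spin \<omega> u) * k (spin \<omega> u))) + (\<Sum>\<omega>\<in>star \<tau>. \<mu> \<omega> * (g (spin \<omega> v) * k (spin \<omega> v)))" for k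
  proof -
    have "(\<Sum>\<omega>\<in>star \<tau>. \<mu> \<omega> * (F (spin \<omega> u) * k (spin \<omega> u))) = (\<Sum>\<omega>\<in>star \<tau>. \<mu> \<omega> * (f (spin \<omega> u) * k (spin \<omega> u)))"
      "(\<Sum>\<omega>\<in>star \<tau>. \<mu> \<omega> * (F (spin \<omega> v) * k (spin \<omega> v))) = (\<Sum>\<omega>\<in>star \<tau>. \<mu> \<omega> * (g (spin \<omega> v) * k (spin \<omega> v)))"
      by (intro sum.cong refl, simp add: Fu Fv)+
    thus ?thesis using ip_link_deg[OF \<tau>, of F k] codim uv by simp
  qed
  have "bil (link_vertices X \<tau>) (link_weight X \<mu> \<tau>) F F
      \<le> lambda2 (link_walk X \<mu> \<tau>) * ip (link_vertices X \<tau>) (link_deg \<tau>) F F"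
    unfolding link_walk_eq by (rule lambda2_ge_rayleigh) (simp add: ipF mean)
  also have "bil (link_vertices X \<tau>) (link_weight X \<mu> \<tau>) F F
      = (\<Sum>\<omega>\<in>star \<tau>. \<mu> \<omega> * F (spin \<omega> u) * F (spin \<omega> v)) + (\<Sum>\<omega>\<in>star \<tau>. \<mu> \<omega> * F (spin \<omega> v) * F (spin \<omega> u))"
    unfolding bil_link_weight[OF \<tau>] using uv diff by simp
  also have "\<dots> = 2 * (\<Sum>\<omega>\<in>star \<tau>. \<mu> \<omega> * f (spin \<omega> u) * g (spin \<omega> v))"
    unfolding sum_distrib_left sum.distrib[symmetric] by (intro sum.cong refl) (simp add: Fu Fv)
  also have "ip (link_vertices X \<tau>) (link_deg \<tau>) F F
      = (\<Sum>\<omega>\<in>star \<tau>. \<mu> \<omega> * (f (spin \<omega> u))\<^sup>2) + (\<Sum>\<omega>\<in>star \<tau>. \<mu> \<omega> * (g (spin \<omega> v))\<^sup>2)"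
    unfolding ipF by (intro arg_cong2[where f = "(+)"] sum.cong refl) (simp_all add: Fu Fv power2_eq_square)
  finally show "2 * (\<Sum>\<omega>\<in>star \<tau>. \<mu> \<omega> * f (spin \<omega> u) * g (spin \<omega> v))
      \<le> lambda2 (link_walk X \<mu> \<tau>) * ((\<Sum>\<omega>\<in>star \<tau>. \<mu> \<omega> * (f (spin \<omega> u))\<^sup>2) + (\<Sum>\<omega>\<in>star \<tau>. \<mu> \<omega> * (g (spin \<omega> v))\<^sup>2))" .
qed

text \<open>A slice of the sample space by one spin is the star of a larger face, which lets the
  induction descend.\<close>

lemma pin_spin:
  assumes \<tau>: "\<tau> \<in> X" and v: "v \<in> free \<tau>" and \<omega>: "\<omega> \<in> star \<tau>" "spin \<omega> v = x"
  shows "insert x \<tau> \<in> X" "sites_of V S (insert x \<tau>) = insert v (sites_of V S \<tau>)"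
    "{\<omega> \<in> star \<tau>. spin \<omega> v = x} = star (insert x \<tau>)" "x \<notin> \<tau>"
proof -
  have \<omega>': "\<omega> \<in> facets X" "\<omega> \<in> X" "\<tau> \<subseteq> \<omega>" using \<omega> by (auto simp: star_def facets_def)
  have x: "x \<in> \<omega>" "x \<in> S v" using spin_mem[OF \<omega>'(1), of v] v \<omega>(2) by auto
  show "insert x \<tau> \<in> X" using faces_down_closed[OF \<omega>'(2)] x \<omega>'(3) by simp
  have "x \<in> S u \<longleftrightarrow> u = v" if "u \<in> V" for u
    using site_unique[OF _ x(2) that] x(2) v by blast
  thus "sites_of V S (insert x \<tau>) = insert v (sites_of V S \<tau>)"
    using v by (auto simp: sites_of_def)
  have "spin \<omega>' v = x \<longleftrightarrow> x \<in> \<omega>'" if "\<omega>' \<in> facets X" for \<omega>'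
    using spin_mem[OF that, of v] spin_eqI[OF that, of v x] v x(2) by blast
  thus "{\<omega> \<in> star \<tau>. spin \<omega> v = x} = star (insert x \<tau>)"
    unfolding star_def by blast
  show "x \<notin> \<tau>" using x(2) v by (auto simp: sites_of_def)
qed

lemma lambda2_le_corr_le:
  assumes \<tau>: "\<tau> \<in> X" "2 \<le> codim V \<tau>"
    and corr: "\<And>u v. u \<in> free \<tau> \<Longrightarrow> v \<in> free \<tau> \<Longrightarrow> u \<noteq> v \<Longrightarrow>
      corr_le (star \<tau>) \<mu> (\<lambda>\<omega>. spin \<omega> u) (\<lambda>\<omega>. spin \<omega> v) (m u v)"
    and m_sym: "\<And>u v. m u v = m v u"
  shows "lambda2 (link_walk X \<mu> \<tau>)
    \<le> lambda_max (mat_on (free \<tau>) (\<lambda>u v. if u = v then 0 else m u v)) / (real (codim V \<tau>) - 1)"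
proof -
  interpret weighted_graph "link_vertices X \<tau>" "link_weight X \<mu> \<tau>" "link_deg \<tau>"
    by (rule weighted_graph_link[OF \<tau>])
  let ?M = "\<lambda>u v. if u = v then 0 else m u v" and ?R = "free \<tau>"
  define L where "L = lambda_max (mat_on ?R ?M)"
  have finR: "finite ?R" using finite_sites by simp
  have rayleigh: "(\<Sum>u\<in>?R. \<Sum>v\<in>?R. ?M u v * a u * a v) \<le> L * (\<Sum>u\<in>?R. (a u)\<^sup>2)" for a
    unfolding L_def using finR by (intro rayleigh_le_lambda_max) (auto simp: m_sym)
  have k: "real (codim V \<tau>) - 1 > 0" using \<tau>(2) by simp
  have "card ?R \<noteq> 0" using card_free[OF \<tau>(1)] \<tau>(2) by simp
  hence "?R \<noteq> {}" by (metis card.empty)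
  then obtain u0 where u0: "u0 \<in> ?R" by blast
  \<comment> \<open>An indicator tests a diagonal entry, which is 0. The sign is used below to
    replace the centred norms by the larger norm of \<open>f\<close>.\<close>
  have L: "L \<ge> 0"
  proof -
    define a where "a u = (if u = u0 then 1 else (0::real))" for u
    have "(\<Sum>u\<in>?R. \<Sum>v\<in>?R. ?M u v * a u * a v) = 0" by (intro sum.neutral ballI) (auto simp: a_def)
    moreover have "(\<Sum>u\<in>?R. (a u)\<^sup>2) = 1" using u0 finR by (simp add: a_def if_distrib[of "\<lambda>t. t\<^sup>2"] cong: if_cong)
    ultimately show ?thesis using rayleigh[of a] by simp
  qed
  define Z where "Z = (\<Sum>\<omega>\<in>star \<tau>. \<mu> \<omega>)"
  have Z: "Z > 0" unfolding Z_def using star_nonempty[OF \<tau>(1)] finite_star star_pos by (intro sum_pos) auto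
  show ?thesis unfolding link_walk_eq L_def[symmetric]
  proof (rule lambda2_le_rayleigh)
    fix f assume f: "ip (link_vertices X \<tau>) (link_deg \<tau>) f (\<lambda>_. 1) = 0"
    define c where "c u = (\<Sum>\<omega>\<in>star \<tau>. \<mu> \<omega> * f (spin \<omega> u)) / Z" for u
    define g where "g u x = f x - c u" for u x
    define a where "a u = sqrt (\<Sum>\<omega>\<in>star \<tau>. \<mu> \<omega> * (g u (spin \<omega> u))\<^sup>2)" for u
    have mean: "(\<Sum>\<omega>\<in>star \<tau>. \<mu> \<omega> * f (spin \<omega> u)) = Z * c u" for u using Z by (simp add: c_def)
    have prod: "(\<Sum>\<omega>\<in>star \<tau>. \<mu> \<omega> * f (spin \<omega> u) * f (spin \<omega> v))
      = (\<Sum>\<omega>\<in>star \<tau>. \<mu> \<omega> * g u (spin \<omega> u) * g v (spin \<omega> v)) + Z * (c u * c v)" for u v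
    proof -
      have "(\<Sum>\<omega>\<in>star \<tau>. \<mu> \<omega> * g u (spin \<omega> u) * g v (spin \<omega> v)) = (\<Sum>\<omega>\<in>star \<tau>. \<mu> \<omega> * f (spin \<omega> u) * f (spin \<omega> v))
        - c v * (\<Sum>\<omega>\<in>star \<tau>. \<mu> \<omega> * f (spin \<omega> u)) - c u * (\<Sum>\<omega>\<in>star \<tau>. \<mu> \<omega> * f (spin \<omega> v)) + c u * c v * Z"
        unfolding Z_def by (simp add: g_def algebra_simps sum.distrib sum_subtractf sum_distrib_left)
      thus ?thesis unfolding mean by (simp add: algebra_simps)
    qed
    have "(\<Sum>\<omega>\<in>star \<tau>. \<mu> \<omega> * g u (spin \<omega> u)) = 0" for u
      using mean[of u]
      by (simp add: g_def Z_def right_diff_distrib sum_subtractf mult.commute flip: sum_distrib_right)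
    hence cs: "(\<Sum>\<omega>\<in>star \<tau>. \<mu> \<omega> * g u (spin \<omega> u) * g v (spin \<omega> v)) \<le> m u v * (a u * a v)"
      if "u \<in> ?R" "v \<in> ?R" "u \<noteq> v" for u v
      unfolding a_def using corr[OF that] finite_star star_pos
      by (intro corr_le_cauchy_schwarz[where X = "\<lambda>\<omega>. spin \<omega> u" and Y = "\<lambda>\<omega>. spin \<omega> v" and f = "g u" and g = "g v"]) auto
    have "(real (codim V \<tau>) - 1) * (\<Sum>u\<in>?R. Z * c u) = 0"
      using f ip_link_deg[OF \<tau>(1), of f "\<lambda>_. 1"] \<tau>(2) by (simp add: mean)
    \<comment> \<open>Orthogonality to the constants only says that the site means add up to 0; the
      products \<open>c u * c v\<close> over distinct sites then sum to minus the sum of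
      squares.\<close>
    hence csum: "(\<Sum>u\<in>?R. c u) = 0" using k Z by (simp flip: sum_distrib_left)
    have "bil (link_vertices X \<tau>) (link_weight X \<mu> \<tau>) f f
      = (\<Sum>u\<in>?R. \<Sum>v\<in>?R - {u}. (\<Sum>\<omega>\<in>star \<tau>. \<mu> \<omega> * g u (spin \<omega> u) * g v (spin \<omega> v)) + Z * (c u * c v))"
      unfolding bil_link_weight[OF \<tau>(1)] prod ..
    also have "\<dots> \<le> (\<Sum>u\<in>?R. \<Sum>v\<in>?R - {u}. m u v * (a u * a v) + Z * (c u * c v))"
      using cs by (intro sum_mono add_right_mono) auto
    also have "\<dots> = (\<Sum>u\<in>?R. \<Sum>v\<in>?R. ?M u v * a u * a v) - Z * (\<Sum>u\<in>?R. (c u)\<^sup>2)"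
    proof -
      have "(\<Sum>u\<in>?R. \<Sum>v\<in>?R - {u}. m u v * (a u * a v)) = (\<Sum>u\<in>?R. \<Sum>v\<in>?R. ?M u v * a u * a v)"
        using finR by (intro sum.cong refl sum.mono_neutral_cong_left) auto
      moreover have "(\<Sum>u\<in>?R. \<Sum>v\<in>?R - {u}. Z * (c u * c v)) = - (Z * (\<Sum>u\<in>?R. (c u)\<^sup>2))"
      proof -
        have "(\<Sum>v\<in>?R - {u}. c v) = - c u" if "u \<in> ?R" for u
          using csum sum.remove[OF finR that, of c] by simp
        hence "(\<Sum>u\<in>?R. \<Sum>v\<in>?R - {u}. Z * (c u * c v)) = (\<Sum>u\<in>?R. Z * (c u * - c u))"
          by (intro sum.cong refl) (simp flip: sum_distrib_left)
        thus ?thesis by (simp add: sum_distrib_left power2_eq_square sum_negf)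
      qed
      ultimately show ?thesis by (simp add: sum.distrib)
    qed
    also have "\<dots> \<le> L * (\<Sum>u\<in>?R. (a u)\<^sup>2)"
    proof -
      have "Z * (\<Sum>u\<in>?R. (c u)\<^sup>2) \<ge> 0" using Z by (intro mult_nonneg_nonneg sum_nonneg) auto
      thus ?thesis using rayleigh[of a] by linarith
    qed
    also have "\<dots> \<le> L * (\<Sum>u\<in>?R. \<Sum>\<omega>\<in>star \<tau>. \<mu> \<omega> * (f (spin \<omega> u) * f (spin \<omega> u)))"
    proof (intro mult_left_mono sum_mono L)
      fix u
      have "(\<Sum>\<omega>\<in>star \<tau>. \<mu> \<omega> * (g u (spin \<omega> u))\<^sup>2) \<ge> 0"
        using star_pos by (intro sum_nonneg) (auto simp: less_imp_le)
      hence "(a u)\<^sup>2 = (\<Sum>\<omega>\<in>star \<tau>. \<mu> \<omega> * (g u (spin \<omega> u))\<^sup>2)" by (simp add: a_def)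
      also have "\<dots> = (\<Sum>\<omega>\<in>star \<tau>. \<mu> \<omega> * (f (spin \<omega> u) * f (spin \<omega> u))) - Z * (c u)\<^sup>2"
        using prod[of u u] by (simp add: power2_eq_square mult.assoc)
      finally show "(a u)\<^sup>2 \<le> (\<Sum>\<omega>\<in>star \<tau>. \<mu> \<omega> * (f (spin \<omega> u) * f (spin \<omega> u)))" using Z by simp
    qed
    also have "\<dots> = L / (real (codim V \<tau>) - 1) * ip (link_vertices X \<tau>) (link_deg \<tau>) f f"
      using ip_link_deg[OF \<tau>(1), of f f] \<tau>(2) k by simp
    finally show "bil (link_vertices X \<tau>) (link_weight X \<mu> \<tau>) f f
      \<le> L / (real (codim V \<tau>) - 1) * ip (link_vertices X \<tau>) (link_deg \<tau>) f f" .
  qed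
qed

end

text \<open>Every edge of the link lies in a facet, and consecutive facets along a path share a spin
  outside \<open>\<tau>\<close>, so the value of \<open>F\<close> propagates through the connected
  graph.\<close>

lemma (in connected_partite_complex) star_function_const:
  assumes \<tau>: "\<tau> \<in> X" "2 \<le> codim V \<tau>"
    and F: "\<And>\<omega> \<omega>' x. \<omega> \<in> star \<tau> \<Longrightarrow> \<omega>' \<in> star \<tau> \<Longrightarrow> x \<in> \<omega> - \<tau> \<Longrightarrow> x \<in> \<omega>' - \<tau> \<Longrightarrow> F \<omega> = F \<omega>'"
  shows "\<exists>c. \<forall>\<omega>\<in>star \<tau>. F \<omega> = c"
proof -
  have nonempty: "\<exists>x. x \<in> \<omega> - \<tau>" if "\<omega> \<in> star \<tau>" for \<omega>
  proof -
    have "card (\<omega> - \<tau>) \<noteq> 0" using bij_betw_same_card[OF star_diff[OF that]] card_free[OF \<tau>(1)] \<tau>(2) by simp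
    thus ?thesis by (metis card.empty ex_in_conv)
  qed
  have path: "F \<omega> = F \<omega>'"
    if "(x, y) \<in> (link_edges X \<tau>)\<^sup>*" "\<omega> \<in> star \<tau>" "x \<in> \<omega> - \<tau>" "\<omega>' \<in> star \<tau>" "y \<in> \<omega>' - \<tau>" for x y \<omega> \<omega>'
    using that
  proof (induction arbitrary: \<omega>' rule: rtrancl_induct)
    case base
    thus ?case using F by blast
  next
    case (step y z)
    then obtain \<rho> where "\<rho> \<in> star \<tau>" "y \<in> \<rho> - \<tau>" "z \<in> \<rho> - \<tau>" using link_edges_iff[OF \<tau>(1)] by blast
    thus ?case using step F by metis
  qed
  have "F \<omega> = F \<omega>'" if \<omega>: "\<omega> \<in> star \<tau>" "\<omega>' \<in> star \<tau>" for \<omega> \<omega>'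
  proof -
    obtain x y where xy: "x \<in> \<omega> - \<tau>" "y \<in> \<omega>' - \<tau>" using nonempty \<omega> by blast
    hence "x \<in> link_vertices X \<tau>" "y \<in> link_vertices X \<tau>" unfolding link_vertices_eq[OF \<tau>(1)] using \<omega> by blast+
    hence "(x, y) \<in> (link_edges X \<tau>)\<^sup>*" using connected[OF \<tau>] by (simp add: link_connected_def)
    thus ?thesis using path \<omega> xy by blast
  qed
  thus ?thesis using star_nonempty[OF \<tau>(1)] by blast
qed

section \<open>Induction on the codimension\<close>

locale bounded_by_absorbing_walk =
  connected_partite_complex V S X \<mu> + absorbing_walk V B W
  for V :: "'v set" and S :: "'v \<Rightarrow> 's set" and X \<mu> B W +
  assumes codim2_lambda2: "\<And>\<sigma> u v. \<sigma> \<in> faces_of_size X (card V - 2) \<Longrightarrow> u \<noteq> v \<Longrightarrow>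
    V - sites_of V S \<sigma> = {u, v} \<Longrightarrow> lambda2 (link_walk X \<mu> \<sigma>) \<le> sqrt (W u v * W v u)"
begin

lemma corr_le_codim2:
  assumes \<tau>: "\<tau> \<in> X" and uv: "free \<tau> = {u, v}" "u \<noteq> v"
  shows "corr_le (star \<tau>) \<mu> (\<lambda>\<omega>. spin \<omega> u) (\<lambda>\<omega>. spin \<omega> v) (infl (sites_of V S \<tau>) u v)"
proof (rule corr_le_mono)
  show "corr_le (star \<tau>) \<mu> (\<lambda>\<omega>. spin \<omega> u) (\<lambda>\<omega>. spin \<omega> v) (lambda2 (link_walk X \<mu> \<tau>))"
    using assms by (rule codim2_corr_le)
  have "codim V \<tau> = 2" using card_free[OF \<tau>] uv by simp
  hence "\<tau> \<in> faces_of_size X (card V - 2)" using \<tau> by (simp add: faces_of_size_def codim_def)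
  hence "lambda2 (link_walk X \<mu> \<tau>) \<le> sqrt (W u v * W v u)" using uv by (intro codim2_lambda2)
  also have "\<dots> \<le> infl (sites_of V S \<tau>) u v" using uv by (intro infl_ge) auto
  finally show "lambda2 (link_walk X \<mu> \<tau>) \<le> infl (sites_of V S \<tau>) u v" .
qed (use star_pos in \<open>auto simp: less_imp_le\<close>)

lemma corr_le_infl:
  "\<tau> \<in> X \<Longrightarrow> a \<in> free \<tau> \<Longrightarrow> b \<in> free \<tau> \<Longrightarrow> a \<noteq> b \<Longrightarrow>
    corr_le (star \<tau>) \<mu> (\<lambda>\<omega>. spin \<omega> a) (\<lambda>\<omega>. spin \<omega> b) (infl (sites_of V S \<tau>) a b)"
proof (induction "codim V \<tau>" arbitrary: \<tau> a b rule: less_induct)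
  case less
  note \<tau> = less.prems(1) and a = less.prems(2) and b = less.prems(3) and ab = less.prems(4)
  let ?U = "sites_of V S \<tau>"
  \<comment> \<open>The induction hypothesis is kept for every free site \<open>z\<close>, because
    the connectivity argument also pins sites outside the triple. If \<open>x\<close> does not occur
    at \<open>z\<close>, the slice is empty and the bound is vacuous.\<close>
  have pinned: "corr_le {\<omega> \<in> star \<tau>. spin \<omega> z = x} \<mu> (\<lambda>\<omega>. spin \<omega> u) (\<lambda>\<omega>. spin \<omega> v) (infl (insert z ?U) u v)"
    if z: "z \<in> free \<tau>" "u \<in> free \<tau>" "v \<in> free \<tau>" "u \<noteq> v" "u \<noteq> z" "v \<noteq> z" for z u v x
  proof (cases "{\<omega> \<in> star \<tau>. spin \<omega> z = x} = {}")
    case False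
    then obtain \<omega> where "\<omega> \<in> star \<tau>" "spin \<omega> z = x" by blast
    note pin = pin_spin[OF \<tau> z(1) this]
    have "free (insert x \<tau>) = free \<tau> - {z}" unfolding pin(2) by blast
    moreover have "finite (free \<tau>)" using finite_sites by simp
    ultimately have "card (free (insert x \<tau>)) < card (free \<tau>)" using z(1) by (metis card_Diff1_less)
    hence "codim V (insert x \<tau>) < codim V \<tau>" by (simp only: card_free[OF \<tau>] card_free[OF pin(1)])
    moreover have "u \<in> free (insert x \<tau>)" "v \<in> free (insert x \<tau>)" unfolding pin(2) using z by auto
    ultimately show ?thesis using less.hyps[of "insert x \<tau>" u v] pin z(4) by simp
  qed (simp only: corr_le_empty)
  show ?case
  proof (cases "free \<tau> = {a, b}")
    case True
    thus ?thesis using \<tau> ab by (intro corr_le_codim2)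
  next
    case False
    then obtain c where c: "c \<in> free \<tau>" "c \<noteq> a" "c \<noteq> b" using a b by blast
    define site where "site s = (if s = 0 then a else if s = 1 then b else c)" for s :: nat
    define Y where "Y s \<omega> = spin \<omega> (site s)" for s \<omega>
    define \<kappa> where "\<kappa> s = (if s = 0 then infl (insert a ?U) b c else if s = 1 then infl (insert b ?U) a c
      else infl (insert c ?U) a b)" for s :: nat
    have site_free: "site s \<in> free \<tau>" for s using a b c by (simp add: site_def)
    have site_inj: "site s \<noteq> site t" if "s < 3" "t < 3" "s \<noteq> t" for s t
      using that ab c by (auto simp: site_def)
    have \<kappa>: "\<kappa> s = infl (insert (site s) ?U) (site u) (site (third s u))" if "s < 3" "u < 3" "s \<noteq> u" for s u
    proof -
      have "s = 0 \<or> s = 1 \<or> s = 2" "u = 0 \<or> u = 1 \<or> u = 2" using that by auto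
      thus ?thesis using that(3) by (elim disjE) (auto simp: \<kappa>_def site_def third_def infl_commute)
    qed
    have \<kappa>_lt: "\<kappa> s < 1" if "s < 3" for s
    proof -
      define u where "u = (if s = 0 then 1 else (0::nat))"
      have u: "u < 3" "s \<noteq> u" using that by (auto simp: u_def)
      note n3 = third_props[OF that u]
      show ?thesis unfolding \<kappa>[OF that u]
        using site_free[of u] site_free[of "third s u"] site_inj[OF that u] site_inj[OF that n3(1)] site_inj[OF u(1) n3(1)] n3(2,3)
        by (intro infl_less_1) auto
    qed
    have abcU: "a \<in> V - ?U" "b \<in> V - ?U" "c \<in> V - ?U" "a \<noteq> b" "a \<noteq> c" "b \<noteq> c" using a b c ab by auto
    note three = infl_three[OF abcU]
    have codim: "2 \<le> codim V \<tau>"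
    proof -
      have "card {a, b} \<le> card (free \<tau>)" using a b finite_sites by (intro card_mono) auto
      thus ?thesis using card_free[OF \<tau>] ab by simp
    qed
    interpret three_sites "star \<tau>" \<mu> Y \<kappa>
    proof
      show "finite (star \<tau>)" by (rule finite_star)
      show "\<mu> \<omega> > 0" if "\<omega> \<in> star \<tau>" for \<omega> using that by (rule star_pos)
      show "0 \<le> \<kappa> s" for s by (simp add: \<kappa>_def infl_nonneg)
      show "\<kappa> s < 1" if "s < 3" for s using that by (rule \<kappa>_lt)
      show "(\<kappa> 0)\<^sup>2 + (\<kappa> 1)\<^sup>2 + (\<kappa> 2)\<^sup>2 + 2 * \<kappa> 0 * \<kappa> 1 * \<kappa> 2 < 1"
        using three(1) by (simp add: \<kappa>_def)
      show "corr_le {\<omega> \<in> star \<tau>. Y s \<omega> = x} \<mu> (Y u) (Y (third s u)) (\<kappa> s)"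
        if su: "s < 3" "u < 3" "s \<noteq> u" for s u x
      proof -
        note n3 = third_props[OF su]
        show ?thesis unfolding \<kappa>[OF su] Y_def
          using site_inj[OF su] site_inj[OF su(1) n3(1)] site_inj[OF su(2) n3(1)] n3(2,3)
          by (intro pinned site_free) auto
      qed
      fix \<phi> :: "nat \<Rightarrow> 's \<Rightarrow> real"
      assume \<phi>: "\<And>\<omega> s t. \<omega> \<in> star \<tau> \<Longrightarrow> s < 3 \<Longrightarrow> t < 3 \<Longrightarrow> \<phi> s (Y s \<omega>) = \<phi> t (Y t \<omega>)"
      show "\<exists>k. \<forall>\<omega>\<in>star \<tau>. \<phi> 0 (Y 0 \<omega>) = k"
      proof (rule star_function_const[OF \<tau> codim])
        fix \<omega> \<omega>' x assume *: "\<omega> \<in> star \<tau>" "\<omega>' \<in> star \<tau>" "x \<in> \<omega> - \<tau>" "x \<in> \<omega>' - \<tau>"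
        have "x \<in> spin \<omega> ` free \<tau>" using star_diff[OF *(1)] *(3) unfolding bij_betw_def by blast
        then obtain z where z: "z \<in> free \<tau>" "spin \<omega> z = x" by blast
        have z': "spin \<omega>' z = x"
          using spin_mem[of \<omega> z] spin_eqI[of \<omega>' z x] z * by (auto simp: star_def)
        show "\<phi> 0 (Y 0 \<omega>) = \<phi> 0 (Y 0 \<omega>')"
        proof (cases "\<exists>s<3. z = site s")
          case True
          then obtain s where s: "s < 3" "Y s \<omega> = x" "Y s \<omega>' = x" using z z' by (auto simp: Y_def)
          thus ?thesis using \<phi>[OF *(1) s(1), of 0] \<phi>[OF *(2) s(1), of 0] by simp
        next
          case False
          have zs: "site s \<noteq> z" if "s < 3" for s using False that by blast
          \<comment> \<open>Given the spin at a site outside the triple, sites 0 and 1 have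
            correlation below 1, so their common function is constant on the slice, which contains
            both facets.\<close>
          have "corr_le {\<omega> \<in> star \<tau>. spin \<omega> z = x} \<mu> (Y 0) (Y 1) (infl (insert z ?U) (site 0) (site 1))"
            unfolding Y_def using z zs site_inj[of 0 1] by (intro pinned site_free) auto
          moreover have "infl (insert z ?U) (site 0) (site 1) < 1"
            using site_free[of 0] site_free[of 1] zs site_inj[of 0 1] by (intro infl_less_1) auto
          ultimately have "\<exists>k. \<forall>\<omega>\<in>{\<omega> \<in> star \<tau>. spin \<omega> z = x}. \<phi> 0 (Y 0 \<omega>) = k"
          proof (rule corr_le_common_function_const)
            show "\<phi> 0 (Y 0 \<omega>) = \<phi> 1 (Y 1 \<omega>)" if "\<omega> \<in> {\<omega> \<in> star \<tau>. spin \<omega> z = x}" for \<omega>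
              using that by (intro \<phi>) auto
          qed (use finite_star star_pos in auto)
          thus ?thesis using * z z' by auto
        qed
      qed
    qed
    have "corr_le (star \<tau>) \<mu> (Y 0) (Y 1) ((\<kappa> 2 + \<kappa> 0 * \<kappa> 1) / sqrt ((1 - (\<kappa> 0)\<^sup>2) * (1 - (\<kappa> 1)\<^sup>2)))"
      by (rule corr_le_0_1)
    moreover have "(\<kappa> 2 + \<kappa> 0 * \<kappa> 1) / sqrt ((1 - (\<kappa> 0)\<^sup>2) * (1 - (\<kappa> 1)\<^sup>2)) \<le> infl ?U a b"
      using three(2) by (simp add: \<kappa>_def)
    ultimately have "corr_le (star \<tau>) \<mu> (Y 0) (Y 1) (infl ?U a b)"
      by (rule corr_le_mono) (use star_pos in \<open>auto simp: less_imp_le\<close>)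
    moreover have "Y 0 = (\<lambda>\<omega>. spin \<omega> a)" "Y 1 = (\<lambda>\<omega>. spin \<omega> b)" by (auto simp: Y_def site_def)
    ultimately show ?thesis by simp
  qed
qed

lemma lambda2_link_walk_le:
  assumes "\<tau> \<in> X" "2 \<le> codim V \<tau>"
  shows "lambda2 (link_walk X \<mu> \<tau>)
    \<le> lambda_max (hit_matrix V B W (sites_of V S \<tau>)) / (real (codim V \<tau>) - 1)"
proof -
  have "hit_matrix V B W (sites_of V S \<tau>)
    = mat_on (free \<tau>) (\<lambda>u v. if u = v then 0 else infl (sites_of V S \<tau>) u v)"
    unfolding hit_matrix_def infl_def by (simp only: Un_insert_right Un_empty_right)
  thus ?thesis using lambda2_le_corr_le[OF assms corr_le_infl[OF assms(1)] infl_commute] by simp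
qed

end

theorem theorem1p4:
  fixes V B :: "'v set" and S :: "'v \<Rightarrow> 's set" and X :: "'s set set"
    and \<mu> :: "'s set \<Rightarrow> real" and W :: "'v \<Rightarrow> 'v \<Rightarrow> real"
  assumes "connected_partite_complex V S X \<mu>"
    and "2 \<le> card V"
    and "absorbing_walk V B W"
    and "\<And>\<sigma> u v. \<sigma> \<in> faces_of_size X (card V - 2) \<Longrightarrow> u \<noteq> v \<Longrightarrow>
           V - sites_of V S \<sigma> = {u, v} \<Longrightarrow>
           lambda2 (link_walk X \<mu> \<sigma>) \<le> sqrt (W u v * W v u)"
  shows "lambda2 (link_walk X \<mu> {}) \<le> lambda_max (hit_matrix V B W {}) / (real (card V) - 1)
    \<and> (\<forall>\<tau>\<in>X. 2 \<le> codim V \<tau> \<longrightarrow>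
          lambda2 (link_walk X \<mu> \<tau>)
            \<le> lambda_max (hit_matrix V B W (sites_of V S \<tau>)) / (real (codim V \<tau>) - 1))"
proof -
  interpret connected_partite_complex V S X \<mu> by fact
  interpret absorbing_walk V B W by fact
  interpret bounded_by_absorbing_walk V S X \<mu> B W by unfold_locales (fact assms(4))
  have "facets X \<noteq> {}" using facet_sum by auto
  then obtain \<omega> where "\<omega> \<in> X" by (auto simp: facets_def)
  hence "{} \<in> X" using faces_down_closed by blast
  moreover have "sites_of V S {} = {}" "codim V ({} :: 's set) = card V" by (simp_all add: sites_of_def codim_def)
  ultimately have "lambda2 (link_walk X \<mu> {}) \<le> lambda_max (hit_matrix V B W {}) / (real (card V) - 1)"
    using lambda2_link_walk_le[of "{}"] assms(2) by simp
  thus ?thesis using lambda2_link_walk_le by blast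
qed

end
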